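(* Let $\alpha\in(0,2)$, $\gamma\in(1-\frac{\alpha}{2},\alpha)$, and let $\beta\ge 0$ satisfy $\beta>1+\frac{\gamma-1}{\alpha}$. Let $F:\mathbb{R}\to\mathbb{R}$ be continuous with $F(\lambda v)=\lambda^{\gamma}F(v)$ for all $v\in\mathbb{R}$, $\lambda>0$. If either $\alpha\in(0,1]$, or $\alpha\in(1,2)$ and $\gamma\ge 1$, assume furthermore that $vF(v)\ge 0$ for all $v\in\mathbb{R}$. Let $L$ be the $\alpha$-stable Lévy process described in the context, let $t_0>0$, $v_0>0$, $x_0\in\mathbb{R}$, and let $(V_t,X_t)_{t\ge t_0}$ be the solution to $$\mathrm{d}V_t=\mathrm{d}L_t-t^{-\beta}F(V_t)\,\mathrm{d}t,\quad V_{t_0}=v_0,\qquad \mathrm{d}X_t=V_t\,\mathrm{d}t,\quad X_{t_0}=x_0 .$$ Let $(\mathcal{S}_t)_{t\ge0}$ be an $\alpha$-stable process having the same distribution as $(L_t)_{t\ge0}$. Then, as $\varepsilon\to0$, the process $$\left(\varepsilon^{\frac1\alpha}V_{t/\varepsilon},\ \varepsilon^{1+\frac1\alpha}X_{t/\varepsilon}\right)_{t\ge\varepsilon t_0}$$ converges in distribution in the space $\mathcal{D}$ (Skorokhod topology) to $$\left(\mathcal{S}_t,\ \int_0^t\mathcal{S}_s\,\mathrm{d}s\right)_{t>0}.$$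
   Context: Driving process. $L$ is the $\alpha$-stable Lévy process with Lévy measure $\nu(\mathrm{d}z)=|z|^{-1-\alpha}[a_+\mathbb{1}_{\{z>0\}}+a_-\mathbb{1}_{\{z<0\}}]\mathrm{d}z$, $a_+,a_-\ge0$, with $a_+=a_-$ if $\alpha=1$. With $N$ the Poisson random measure of its jumps (intensity $\mathrm{d}s\,\nu(\mathrm{d}z)$) and $\widetilde N$ the compensated measure, $L_t=\int_0^t\int_{\mathbb{R}^*}zN(\mathrm{d}s,\mathrm{d}z)$ if $\alpha\in(0,1)$; $L_t=\int_0^t\int_{0<|z|<1}z\widetilde N(\mathrm{d}s,\mathrm{d}z)+\int_0^t\int_{|z|\ge1}zN(\mathrm{d}s,\mathrm{d}z)$ if $\alpha=1$; $L_t=\int_0^t\int_{\mathbb{R}^*}z\widetilde N(\mathrm{d}s,\mathrm{d}z)$ if $\alpha\in(1,2)$. Space of paths. $\mathcal{D}$ is the space of càdlàg functions on $(0,+\infty)$ with the Skorokhod metric $$d_s(f,g)=\sum_{n\ge1}2^{-n}\min\Big(1,\inf\Big\{a:\exists\lambda\in\Lambda,\ \sup_{s\ne t}\Big|\log\tfrac{\lambda(t)-\lambda(s)}{t-s}\Big|\le a,\ \sup_{t\ge 1/n}|k_n(t)(f(\lambda(t))-g(t))|\le a\Big\}\Big),$$ where $\Lambda$ is the set of continuous increasing $\lambda:\mathbb{R}^+\to\mathbb{R}^+$ with $\lambda(0)=0$ and $\lim_{t\to+\infty}\lambda(t)=+\infty$, and $k_n(t)=1$ on $[\frac1n,n]$,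 $k_n(t)=n+1-t$ on $(n,n+1)$, $k_n(t)=0$ for $t\ge n+1$. Pairs of processes are regarded as random elements of $\mathcal{D}\times\mathcal{D}$. A process defined for $t\ge\varepsilon t_0$ is extended to $(0,\varepsilon t_0)$ by its value at $\varepsilon t_0$. *)

theory Defs
  imports "HOL-Probability.Probability"
begin

section \<open>Cadlag paths and the Skorokhod topology on \<open>(0,\<infinity>)\<close>\<close>

definition cadlag_on :: "real set \<Rightarrow> (real \<Rightarrow> real) \<Rightarrow> bool" where
  "cadlag_on I f \<longleftrightarrow>
     (\<forall>t\<in>I. continuous (at t within I \<inter> {t..}) f \<and> (\<exists>l. (f \<longlongrightarrow> l) (at t within I \<inter> {..<t})))"

text \<open>Paths are functions on \<open>(0,\<infinity>)\<close>, encoded as functions on the reals that are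
  \<^const>\<open>undefined\<close> elsewhere.\<close>

definition cadlag_space :: "(real \<Rightarrow> real) set" where
  "cadlag_space = {f \<in> extensional {0<..}. cadlag_on {0<..} f}"

text \<open>Strictness of the monotonicity is implicit in the metric below, where
  \<open>\<bar>log 0\<bar> = \<infinity>\<close>; it has to be stated here because \<open>ln 0 = 0\<close> in HOL.\<close>

definition time_changes :: "(real \<Rightarrow> real) set" where
  "time_changes = {l. continuous_on {0..} l \<and> strict_mono_on {0..} l \<and> l 0 = 0 \<and>
                      filterlim l at_top at_top}"

definition cutoff :: "nat \<Rightarrow> real \<Rightarrow> real" where
  "cutoff n t = (if t \<le> real n then 1 else if t < real n + 1 then real n + 1 - t else 0)"

definition skorokhod_gap :: "nat \<Rightarrow> (real \<Rightarrow> real) \<Rightarrow> (real \<Rightarrow> real) \<Rightarrow> real" where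
  "skorokhod_gap n f g =
     Inf {a. \<exists>l\<in>time_changes.
           (\<forall>s\<ge>0. \<forall>t\<ge>0. s \<noteq> t \<longrightarrow> \<bar>ln ((l t - l s) / (t - s))\<bar> \<le> a) \<and>
           (\<forall>t\<ge>1 / real n. \<bar>cutoff n t * (f (l t) - g t)\<bar> \<le> a)}"

definition skorokhod_dist :: "(real \<Rightarrow> real) \<Rightarrow> (real \<Rightarrow> real) \<Rightarrow> real" where
  "skorokhod_dist f g = (\<Sum>m. (1 / 2) ^ Suc m * min 1 (skorokhod_gap (Suc m) f g))"

text \<open>The formula for \<^const>\<open>skorokhod_dist\<close> is not literally symmetric, so the balls are
  spelled out here instead of going through \<^locale>\<open>Metric_space\<close>.  The centre \<open>f\<close> is the
  second argument, so that \<open>f\<^sub>n\<close> tends to \<open>f\<close> when \<open>f\<^sub>n \<circ> \<lambda>\<^sub>n\<close> is close to \<open>f\<close>.\<close>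

definition skorokhod_topology :: "(real \<Rightarrow> real) topology" where
  "skorokhod_topology = topology (\<lambda>U. U \<subseteq> cadlag_space \<and>
     (\<forall>f\<in>U. \<exists>r>0. \<forall>g\<in>cadlag_space. skorokhod_dist g f < r \<longrightarrow> g \<in> U))"

lemma openin_skorokhod_topology:
  "openin skorokhod_topology U \<longleftrightarrow> U \<subseteq> cadlag_space \<and>
     (\<forall>f\<in>U. \<exists>r>0. \<forall>g\<in>cadlag_space. skorokhod_dist g f < r \<longrightarrow> g \<in> U)"
proof -
  have "istopology (\<lambda>U. U \<subseteq> cadlag_space \<and>
     (\<forall>f\<in>U. \<exists>r>0. \<forall>g\<in>cadlag_space. skorokhod_dist g f < r \<longrightarrow> g \<in> U))"
    unfolding istopology_def
  proof (intro conjI allI impI, goal_cases)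
    case (2 S T)
    show ?case
    proof
      fix f assume f: "f \<in> S \<inter> T"
      obtain r where r: "r > 0" "\<forall>g\<in>cadlag_space. skorokhod_dist g f < r \<longrightarrow> g \<in> S"
        using 2 f by blast
      obtain q where q: "q > 0" "\<forall>g\<in>cadlag_space. skorokhod_dist g f < q \<longrightarrow> g \<in> T"
        using 2 f by blast
      show "\<exists>r>0. \<forall>g\<in>cadlag_space. skorokhod_dist g f < r \<longrightarrow> g \<in> S \<inter> T"
        using r q by (intro exI[of _ "min r q"]) auto
    qed
  next
    case (4 \<K>)
    then show ?case by (meson Union_iff)
  qed blast+
  then show ?thesis
    unfolding skorokhod_topology_def by (simp add: topology_inverse')
qed

lemma topspace_skorokhod_topology: "topspace skorokhod_topology = cadlag_space"
proof
  show "topspace skorokhod_topology \<subseteq> cadlag_space"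
    using openin_topspace[of skorokhod_topology] unfolding openin_skorokhod_topology by blast
  have "openin skorokhod_topology cadlag_space"
    unfolding openin_skorokhod_topology by (auto intro: exI[of _ 1])
  then show "cadlag_space \<subseteq> topspace skorokhod_topology"
    by (rule openin_subset)
qed

text \<open>A path given on \<open>[a,\<infinity>)\<close> is extended to \<open>(0,a)\<close> by its value at \<open>a\<close>.\<close>

definition extended_path :: "real \<Rightarrow> (real \<Rightarrow> real) \<Rightarrow> real \<Rightarrow> real" where
  "extended_path a f = (\<lambda>t\<in>{0<..}. f (max a t))"


section \<open>Convergence in distribution of random elements of a topological space\<close>

definition borel_of_topology :: "'x topology \<Rightarrow> 'x measure" where
  "borel_of_topology T = sigma (topspace T) {U. openin T U}"

definition converges_in_distribution ::
  "'x topology \<Rightarrow> 'a measure \<Rightarrow> ('i \<Rightarrow> 'a \<Rightarrow> 'x) \<Rightarrow> 'b measure \<Rightarrow> ('b \<Rightarrow> 'x) \<Rightarrow> 'i filter \<Rightarrow> bool" where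
  "converges_in_distribution T M Y M' Z Q \<longleftrightarrow>
     (\<forall>\<^sub>F i in Q. Y i \<in> M \<rightarrow>\<^sub>M borel_of_topology T) \<and>
     Z \<in> M' \<rightarrow>\<^sub>M borel_of_topology T \<and>
     (\<forall>\<Phi>. continuous_map T euclideanreal \<Phi> \<and> bounded (\<Phi> ` topspace T) \<longrightarrow>
        ((\<lambda>i. \<integral>\<omega>. \<Phi> (Y i \<omega>) \<partial>M) \<longlongrightarrow> (\<integral>\<omega>. \<Phi> (Z \<omega>) \<partial>M')) Q)"

definition same_law ::
  "'a measure \<Rightarrow> (real \<Rightarrow> 'a \<Rightarrow> real) \<Rightarrow> 'b measure \<Rightarrow> (real \<Rightarrow> 'b \<Rightarrow> real) \<Rightarrow> bool" where
  "same_law M X M' Y \<longleftrightarrow>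
     distr M (Pi\<^sub>M {0..} (\<lambda>_. borel)) (\<lambda>\<omega>. \<lambda>t\<in>{0..}. X t \<omega>) =
     distr M' (Pi\<^sub>M {0..} (\<lambda>_. borel)) (\<lambda>\<omega>. \<lambda>t\<in>{0..}. Y t \<omega>)"

definition cadlag_process :: "'a measure \<Rightarrow> real set \<Rightarrow> (real \<Rightarrow> 'a \<Rightarrow> real) \<Rightarrow> bool" where
  "cadlag_process M I X \<longleftrightarrow>
     (\<forall>t\<in>I. X t \<in> borel_measurable M) \<and> (\<forall>\<omega>\<in>space M. cadlag_on I (\<lambda>t. X t \<omega>))"


section \<open>Stable Levy processes driven by a Poisson random measure\<close>

definition poisson_random_measure ::
  "'a measure \<Rightarrow> 'e measure \<Rightarrow> ('a \<Rightarrow> 'e measure) \<Rightarrow> bool" where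
  "poisson_random_measure M \<mu> N \<longleftrightarrow>
     (\<forall>\<omega>\<in>space M. sets (N \<omega>) = sets \<mu>) \<and>
     (\<forall>A\<in>sets \<mu>. (\<lambda>\<omega>. emeasure (N \<omega>) A) \<in> borel_measurable M) \<and>
     (\<forall>A\<in>sets \<mu>. emeasure \<mu> A < \<infinity> \<longrightarrow>
        (\<forall>k::nat. measure M {\<omega>\<in>space M. emeasure (N \<omega>) A = of_nat k} =
           measure \<mu> A ^ k / fact k * exp (- measure \<mu> A))) \<and>
     (\<forall>A\<in>sets \<mu>. emeasure \<mu> A = \<infinity> \<longrightarrow> (AE \<omega> in M. emeasure (N \<omega>) A = \<infinity>)) \<and>
     (\<forall>A::nat \<Rightarrow> 'e set. range A \<subseteq> sets \<mu> \<and> disjoint_family A \<longrightarrow>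
        prob_space.indep_vars M (\<lambda>_. borel) (\<lambda>i \<omega>. emeasure (N \<omega>) (A i)) UNIV)"

definition stable_levy_measure :: "real \<Rightarrow> real \<Rightarrow> real \<Rightarrow> real measure" where
  "stable_levy_measure \<alpha> ap am =
     density lborel (\<lambda>z. ennreal (\<bar>z\<bar> powr (-1 - \<alpha>) *
       (ap * indicator {0<..} z + am * indicator {..<0} z)))"

definition jump_intensity :: "real measure \<Rightarrow> (real \<times> real) measure" where
  "jump_intensity \<nu> = density lborel (indicator {0..}) \<Otimes>\<^sub>M \<nu>"

definition jump_integral :: "('a \<Rightarrow> (real \<times> real) measure) \<Rightarrow> real \<Rightarrow> real set \<Rightarrow> 'a \<Rightarrow> real" where
  "jump_integral N t A \<omega> = (LINT p : {0<..t} \<times> A | N \<omega>. snd p)"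

text \<open>\<open>Y\<close> is (a version of) the integral of \<open>z\<close> over \<open>(0,t] \<times> A\<close> against the compensated
  measure: the limit in probability, as \<open>\<delta>\<close> decreases to 0, of the compensated integrals over
  the jumps larger than \<open>\<delta>\<close>.  The uncompensated integral over \<open>A\<close> need not exist.\<close>

definition compensated_jump_integral ::
  "'a measure \<Rightarrow> real measure \<Rightarrow> ('a \<Rightarrow> (real \<times> real) measure) \<Rightarrow> real \<Rightarrow> real set \<Rightarrow>
     ('a \<Rightarrow> real) \<Rightarrow> bool" where
  "compensated_jump_integral M \<nu> N t A Y \<longleftrightarrow> Y \<in> borel_measurable M \<and>
     (\<forall>e>0. ((\<lambda>\<delta>. measure M {\<omega>\<in>space M.
         e \<le> \<bar>jump_integral N t (A \<inter> {z. \<delta> < \<bar>z\<bar>}) \<omega>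
               - t * (LINT z : A \<inter> {z. \<delta> < \<bar>z\<bar>} | \<nu>. z) - Y \<omega>\<bar>}) \<longlongrightarrow> 0) (at_right 0))"

definition stable_levy_process ::
  "'a measure \<Rightarrow> real \<Rightarrow> real \<Rightarrow> real \<Rightarrow> ('a \<Rightarrow> (real \<times> real) measure) \<Rightarrow>
     (real \<Rightarrow> 'a \<Rightarrow> real) \<Rightarrow> bool" where
  "stable_levy_process M \<alpha> ap am N L \<longleftrightarrow>
     (let \<nu> = stable_levy_measure \<alpha> ap am in
      poisson_random_measure M (jump_intensity \<nu>) N \<and>
      cadlag_process M {0..} L \<and>
      (\<forall>t\<ge>0.
        if \<alpha> < 1 then AE \<omega> in M. L t \<omega> = jump_integral N t (- {0}) \<omega>
        else if \<alpha> = 1 then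
          \<exists>Y. compensated_jump_integral M \<nu> N t {z. 0 < \<bar>z\<bar> \<and> \<bar>z\<bar> < 1} Y \<and>
              (AE \<omega> in M. L t \<omega> = Y \<omega> + jump_integral N t {z. 1 \<le> \<bar>z\<bar>} \<omega>)
        else compensated_jump_integral M \<nu> N t (- {0}) (L t)))"


section \<open>The stochastic differential equation\<close>

text \<open>\<open>N\<close> is a Poisson random measure relative to the filtration: its restriction to times up
  to \<open>t\<close> is known at \<open>t\<close>, and its restriction to later times is independent of the past.\<close>

definition filtration_for_jumps ::
  "'a measure \<Rightarrow> (real \<Rightarrow> 'a measure) \<Rightarrow> ('a \<Rightarrow> (real \<times> real) measure) \<Rightarrow> bool" where
  "filtration_for_jumps M \<F> N \<longleftrightarrow>
     filtration (space M) \<F> \<and> (\<forall>t. subalgebra M (\<F> t)) \<and>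
     (\<forall>t\<ge>0.
       (\<forall>A\<in>sets (borel \<Otimes>\<^sub>M borel). A \<subseteq> {0..t} \<times> UNIV \<longrightarrow>
          (\<lambda>\<omega>. emeasure (N \<omega>) A) \<in> borel_measurable (\<F> t)) \<and>
       prob_space.indep_set M (sets (\<F> t))
         (sigma_sets (space M)
           {{\<omega>\<in>space M. emeasure (N \<omega>) A \<in> B} | A B.
              A \<in> sets (borel \<Otimes>\<^sub>M borel) \<and> A \<subseteq> {t<..} \<times> UNIV \<and> B \<in> sets borel}))"

definition adapted_on ::
  "real set \<Rightarrow> (real \<Rightarrow> 'a measure) \<Rightarrow> (real \<Rightarrow> 'a \<Rightarrow> real) \<Rightarrow> bool" where
  "adapted_on I \<F> X \<longleftrightarrow> (\<forall>t\<in>I. X t \<in> borel_measurable (\<F> t))"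

definition kinetic_solution ::
  "'a measure \<Rightarrow> (real \<Rightarrow> 'a measure) \<Rightarrow> (real \<Rightarrow> 'a \<Rightarrow> real) \<Rightarrow> real \<Rightarrow> (real \<Rightarrow> real) \<Rightarrow>
     real \<Rightarrow> real \<Rightarrow> real \<Rightarrow> (real \<Rightarrow> 'a \<Rightarrow> real) \<Rightarrow> (real \<Rightarrow> 'a \<Rightarrow> real) \<Rightarrow> bool" where
  "kinetic_solution M \<F> L \<beta> F t0 v0 x0 V X \<longleftrightarrow>
     cadlag_process M {t0..} V \<and> adapted_on {t0..} \<F> V \<and>
     cadlag_process M {t0..} X \<and> adapted_on {t0..} \<F> X \<and>
     (AE \<omega> in M. \<forall>t\<ge>t0.
        V t \<omega> = v0 + (L t \<omega> - L t0 \<omega>) - (LINT s : {t0..t} | lborel. s powr (- \<beta>) * F (V s \<omega>)) \<and>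
        X t \<omega> = x0 + (LINT s : {t0..t} | lborel. V s \<omega>))"

end

theory Submission
  imports Defs
begin

text \<open>
  By self-similarity \<open>L\<^sup>\<epsilon> = \<epsilon>\<^sup>1\<^sup>/\<^sup>\<alpha> L\<^sub>t\<^sub>/\<^sub>\<epsilon>\<close> has the law of \<open>L\<close>, because the rescaled jumps form a Poisson random
  measure with the same intensity and \<open>L\<close> is a limit in probability of functionals of its jumps.
  It remains to see that the rescaled drift vanishes uniformly on compacts, in probability.  All
  estimates on \<open>V\<close> are pathwise: \<open>sup\<^sub>s\<^sub>\<le>\<^sub>T \<bar>V\<^sub>s\<bar> \<le> C (T\<^sup>1\<^sup>/\<^sup>\<alpha> + sup\<^sub>s\<^sub>\<le>\<^sub>T \<bar>L\<^sub>s\<bar>)\<close> holds either because the force is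
  restoring or, when \<open>\<gamma> < 1\<close>, by absorbing the sublinear drift.  Hence \<open>V\<close> grows like \<open>t\<^sup>1\<^sup>/\<^sup>\<alpha>\<close> up to a
  small power of the time horizon, and \<open>\<integral> s\<^sup>-\<^sup>\<beta> \<bar>V\<^sub>s\<bar>\<^sup>\<gamma> ds = o(T\<^sup>1\<^sup>/\<^sup>\<alpha>)\<close> since \<open>1 - \<beta> + \<gamma>/\<alpha> < 1/\<alpha>\<close>.  Finally the
  approximating pair is uniformly close to \<open>(L\<^sup>\<epsilon>, \<integral>L\<^sup>\<epsilon>)\<close>, whose law does not depend on \<open>\<epsilon>\<close>, and this
  suffices for convergence in distribution without any tightness argument.
\<close>


section \<open>Time changes and the Skorokhod uniformity\<close>

text \<open>The hypotheses and self-similarity speak of finite-dimensional laws, that is of the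
  product sigma-algebra \<open>coords\<close>, whereas the conclusion speaks of Borel sets of a
  product of two Skorokhod topologies. Bridging the two shapes the topological half. The relation
  \<open>skorokhod_near\<close> takes the place of the metric. Every path is approximated in this
  relation by roundings that have only countably many possible values; this identifies the trace of
  every open set on the space of paths with the trace of a coordinate-measurable set.

  On the probabilistic side a single level for the running supremum of L on [0,1] is chosen, and
  self-similarity carries it to each time of a finite geometric grid. The ratio of the grid is a
  small power of the horizon, hence the small power lost in the growth of V; the strict inequality
  assumed on \<beta> leaves room for it.

  The representation of L as a limit in probability is needed for uniqueness in law: one measurable
  functional must represent both L and its rescaling, each in terms of its own Poisson
  measure.\<close>

definition log_slope_le :: "real \<Rightarrow> (real \<Rightarrow> real) \<Rightarrow> bool" where
  "log_slope_le a l \<longleftrightarrow> (\<forall>s\<ge>0. \<forall>t\<ge>0. s \<noteq> t \<longrightarrow> \<bar>ln ((l t - l s) / (t - s))\<bar> \<le> a)"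

text \<open>A one-parameter base of the uniformity behind \<^const>\<open>skorokhod_dist\<close>.  Unlike that formula it is
  visibly symmetric and transitive, up to halving the parameter.\<close>

definition skorokhod_near :: "real \<Rightarrow> (real \<Rightarrow> real) \<Rightarrow> (real \<Rightarrow> real) \<Rightarrow> bool" where
  "skorokhod_near a g f \<longleftrightarrow>
     (\<exists>l\<in>time_changes. log_slope_le a l \<and> (\<forall>t\<in>{a..1 / a}. \<bar>g (l t) - f t\<bar> \<le> a))"

lemma time_change_ratio_pos:
  assumes "l \<in> time_changes" "0 \<le> s" "0 \<le> t" "s \<noteq> t"
  shows "(l t - l s) / (t - s) > 0"
proof (cases "s < t")
  case True
  then have "l s < l t" using assms by (auto simp: time_changes_def strict_mono_on_def)
  with True show ?thesis by simp
next
  case False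
  then have "t < s" using assms by simp
  then have "l t < l s" using assms by (auto simp: time_changes_def strict_mono_on_def)
  with \<open>t < s\<close> show ?thesis by (simp add: zero_less_divide_iff)
qed

lemma time_change_ratio_bounds:
  assumes "l \<in> time_changes" "log_slope_le a l" "0 \<le> s" "s < t"
  shows "exp (- a) * (t - s) \<le> l t - l s" "l t - l s \<le> exp a * (t - s)"
proof -
  let ?r = "(l t - l s) / (t - s)"
  have pos: "?r > 0" using assms by (intro time_change_ratio_pos) auto
  have ln: "\<bar>ln ?r\<bar> \<le> a" using assms by (auto simp: log_slope_le_def)
  have "exp (- a) \<le> ?r" "?r \<le> exp a"
    using ln pos by (metis abs_le_D2 exp_le_cancel_iff exp_ln minus_le_iff)
      (use ln pos in \<open>metis abs_le_D1 exp_le_cancel_iff exp_ln\<close>)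
  then show "exp (- a) * (t - s) \<le> l t - l s" "l t - l s \<le> exp a * (t - s)"
    using assms(4) by (auto simp: field_simps)
qed

lemma time_change_bounds:
  assumes "l \<in> time_changes" "log_slope_le a l" "0 \<le> t"
  shows "exp (- a) * t \<le> l t" "l t \<le> exp a * t" "0 \<le> l t"
proof -
  have 0: "l 0 = 0" using assms by (simp add: time_changes_def)
  show 1: "exp (- a) * t \<le> l t" "l t \<le> exp a * t"
    using time_change_ratio_bounds[OF assms(1,2), of 0 t] 0 assms(3) by (cases "t = 0"; simp)+
  show "0 \<le> l t"
    using 1(1) assms(3) by (smt (verit) exp_ge_zero mult_nonneg_nonneg)
qed

lemma exp_half_less_2: "exp (1/2::real) < 2"
proof -
  have "exp (1/2::real) \<le> 1 + 1/2 + (1/2)\<^sup>2"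
    by (rule exp_bound) auto
  then show ?thesis by (simp add: power2_eq_square)
qed

text \<open>The factor 2 is what halving the parameter of the uniformity pays for: a time change
  with log slope at most 1/2 moves a point of \<open>{a..1 / a}\<close> within
  \<open>{a / 2..1 / (a / 2)}\<close>, the window on which the other closeness relation is
  available.\<close>

lemma time_change_bounds2:
  assumes "l \<in> time_changes" "log_slope_le a l" "0 \<le> t" "a \<le> 1/2"
  shows "t / 2 \<le> l t" "l t \<le> 2 * t"
proof -
  have "exp a \<le> exp (1/2)" using assms by simp
  then have e: "exp a \<le> 2" using exp_half_less_2 by linarith
  then have "exp (- a) \<ge> 1/2" by (simp add: exp_minus field_simps)
  then show "t / 2 \<le> l t" "l t \<le> 2 * t"
    using time_change_bounds[OF assms(1-3)] mult_right_mono[OF e assms(3)]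
      mult_right_mono[of "1/2" "exp (-a)" t] assms(3) by auto
qed

lemma time_changes_comp:
  assumes "l \<in> time_changes" "k \<in> time_changes"
  shows "l \<circ> k \<in> time_changes"
proof -
  have k: "continuous_on {0..} k" "strict_mono_on {0..} k" "k 0 = 0" "filterlim k at_top at_top"
    and l: "continuous_on {0..} l" "strict_mono_on {0..} l" "l 0 = 0" "filterlim l at_top at_top"
    using assms by (auto simp: time_changes_def)
  have nn: "k t \<ge> 0" if "t \<ge> 0" for t
    using k(2,3) that by (cases "t = 0") (force simp: strict_mono_on_def)+
  have "continuous_on {0..} (l \<circ> k)"
    by (intro continuous_on_compose k continuous_on_subset[OF l(1)]) (use nn in auto)
  moreover have "strict_mono_on {0..} (l \<circ> k)"
    using k(2) l(2) nn by (auto simp: strict_mono_on_def)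
  moreover have "filterlim (l \<circ> k) at_top at_top"
    unfolding comp_def by (rule filterlim_compose[OF l(4) k(4)])
  ultimately show ?thesis
    using k(3) l(3) by (auto simp: time_changes_def)
qed

text \<open>The difference quotient of a composition is a product of difference quotients, so the
  logarithms add.\<close>

lemma log_slope_le_comp:
  assumes "l \<in> time_changes" "k \<in> time_changes" "log_slope_le a l" "log_slope_le b k"
  shows "log_slope_le (a + b) (l \<circ> k)"
  unfolding log_slope_le_def
proof (intro allI impI)
  fix s t :: real assume st: "0 \<le> s" "0 \<le> t" "s \<noteq> t"
  have kp: "(k t - k s) / (t - s) > 0" by (intro time_change_ratio_pos assms st)
  then have ne: "k s \<noteq> k t" by auto
  have nn: "0 \<le> k s" "0 \<le> k t"
    using time_change_bounds(3)[OF assms(2,4)] st by auto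
  have lp: "(l (k t) - l (k s)) / (k t - k s) > 0"
    by (rule time_change_ratio_pos[OF assms(1) nn ne])
  have "ln ((l (k t) - l (k s)) / (t - s))
      = ln ((l (k t) - l (k s)) / (k t - k s) * ((k t - k s) / (t - s)))"
    using ne by simp
  also have "\<dots> = ln ((l (k t) - l (k s)) / (k t - k s)) + ln ((k t - k s) / (t - s))"
    using kp lp by (subst ln_mult) auto
  finally show "\<bar>ln (((l \<circ> k) t - (l \<circ> k) s) / (t - s))\<bar> \<le> a + b"
    using assms(3,4) st nn ne unfolding log_slope_le_def comp_def
    by (smt (verit))
qed

lemma log_slope_le_mono: "log_slope_le a l \<Longrightarrow> a \<le> b \<Longrightarrow> log_slope_le b l"
  unfolding log_slope_le_def by fastforce

lemma skorokhod_near_mono: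
  assumes "skorokhod_near a g f" "0 < a" "a \<le> b"
  shows "skorokhod_near b g f"
proof -
  have "1 / b \<le> 1 / a" using assms by (simp add: frac_le)
  then have "{b..1/b} \<subseteq> {a..1/a}" using assms by auto
  then show ?thesis
    using assms log_slope_le_mono unfolding skorokhod_near_def by (meson order_trans subset_iff)
qed

lemma skorokhod_near_trans:
  assumes "skorokhod_near (a / 2) h g" "skorokhod_near (a / 2) g f" "0 < a" "a \<le> 1"
  shows "skorokhod_near a h f"
proof -
  obtain l where l: "l \<in> time_changes" "log_slope_le (a/2) l" "\<And>t. t \<in> {a/2..1 / (a/2)} \<Longrightarrow> \<bar>h (l t) - g t\<bar> \<le> a/2"
    using assms(1) unfolding skorokhod_near_def by blast
  obtain k where k: "k \<in> time_changes" "log_slope_le (a/2) k" "\<And>t. t \<in> {a/2..1 / (a/2)} \<Longrightarrow> \<bar>g (k t) - f t\<bar> \<le> a/2"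
    using assms(2) unfolding skorokhod_near_def by blast
  have "log_slope_le a (l \<circ> k)"
    using log_slope_le_comp[OF l(1) k(1) l(2) k(2)] by simp
  moreover have "\<bar>h (l (k t)) - f t\<bar> \<le> a" if t: "t \<in> {a..1/a}" for t
  proof -
    have "t / 2 \<le> k t" "k t \<le> 2 * t"
      using time_change_bounds2[OF k(1,2), of t] t assms by auto
    then have 1: "k t \<in> {a/2..1/(a/2)}" using t by auto
    have 2: "t \<in> {a/2..1/(a/2)}" using t assms(3) by (auto simp: divide_right_mono elim: order_trans)
    show ?thesis using l(3)[OF 1] k(3)[OF 2] by linarith
  qed
  ultimately show ?thesis
    unfolding skorokhod_near_def using time_changes_comp[OF l(1) k(1)]
    by (intro bexI[of _ "l \<circ> k"]) auto
qed

text \<open>The lower linear bound on l and the intermediate value theorem make l onto the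
  half-line. Difference quotients of the inverse are reciprocals of those of l, so the logarithm
  only changes sign and the same a serves. The linear bounds also give Lipschitz continuity of k and
  its divergence.\<close>

lemma time_change_inverse:
  assumes l: "l \<in> time_changes" and a: "log_slope_le a l"
  obtains k where "k \<in> time_changes" "log_slope_le a k" "\<And>t. 0 \<le> t \<Longrightarrow> l (k t) = t" "\<And>t. 0 \<le> t \<Longrightarrow> 0 \<le> k t"
proof -
  have L: "continuous_on {0..} l" "strict_mono_on {0..} l" "l 0 = 0" "filterlim l at_top at_top"
    using l by (auto simp: time_changes_def)
  have ex: "\<exists>s\<ge>0. l s = t" if t: "t \<ge> 0" for t
  proof -
    define u where "u = exp a * t"
    have u0: "u \<ge> 0" using t by (simp add: u_def)
    have "t \<le> l u"
      using time_change_bounds(1)[OF l a u0] by (simp add: u_def exp_minus flip: mult.assoc)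
    moreover have "continuous_on {0..u} l" by (rule continuous_on_subset[OF L(1)]) auto
    ultimately show ?thesis
      using IVT'[of l 0 t u] L(3) t u0 by auto
  qed
  define k where "k t = (SOME s. s \<ge> 0 \<and> l s = t)" for t
  have k: "k t \<ge> 0" "l (k t) = t" if "t \<ge> 0" for t
    using someI_ex[OF ex[OF that, unfolded Bex_def]] by (auto simp: k_def)
  have mono: "k s < k t" if "0 \<le> s" "s < t" for s t
  proof (rule ccontr)
    assume "\<not> k s < k t"
    then have "k t < k s \<or> k t = k s" by auto
    then have "l (k t) \<le> l (k s)"
      using L(2) k(1)[of s] k(1)[of t] that by (auto simp: strict_mono_on_def less_imp_le)
    then show False using k that by auto
  qed
  have inj: "l s = l t \<Longrightarrow> s \<ge> 0 \<Longrightarrow> t \<ge> 0 \<Longrightarrow> s = t" for s t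
    using L(2) by (metis atLeast_iff strict_mono_on_eqD)
  have k0: "k 0 = 0" using inj[of "k 0" 0] k[of 0] L(3) by auto
  have slope: "log_slope_le a k"
    unfolding log_slope_le_def
  proof (intro allI impI)
    fix s t :: real assume st: "0 \<le> s" "0 \<le> t" "s \<noteq> t"
    then have ne: "k s \<noteq> k t" using k by metis
    have p: "(l (k t) - l (k s)) / (k t - k s) > 0"
      using time_change_ratio_pos[OF l _ _ ne] k st by auto
    have "ln ((k t - k s) / (t - s)) = ln (inverse ((l (k t) - l (k s)) / (k t - k s)))"
      using k st by simp
    also have "\<dots> = - ln ((l (k t) - l (k s)) / (k t - k s))"
      by (rule ln_inverse)
    finally show "\<bar>ln ((k t - k s) / (t - s))\<bar> \<le> a"
      using a[unfolded log_slope_le_def, rule_format, of "k s" "k t"] k st ne by simp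
  qed
  have lip: "\<bar>k t - k s\<bar> \<le> exp a * \<bar>t - s\<bar>" if "0 \<le> s" "s < t" for s t
    using time_change_ratio_bounds(1)[OF l a k(1)[OF that(1)] mono[OF that]] k that mono[OF that]
    by (auto simp: exp_minus field_simps)
  have lip': "dist (k t) (k s) \<le> exp a * dist t s" if "0 \<le> s" "0 \<le> t" for s t
    using lip[of s t] lip[of t s] that unfolding dist_real_def
    by (cases s t rule: linorder_cases) (auto simp: abs_minus_commute)
  have "continuous_on {0..} k"
    unfolding continuous_on_iff
  proof (intro ballI allI impI)
    fix x e :: real assume x: "x \<in> {0..}" and e: "0 < e"
    show "\<exists>d>0. \<forall>x'\<in>{0..}. dist x' x < d \<longrightarrow> dist (k x') (k x) < e"
    proof (intro exI[of _ "e / exp a"] conjI ballI impI)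
      show "e / exp a > 0" using e by simp
      fix x' :: real assume x': "x' \<in> {0..}" "dist x' x < e / exp a"
      have "dist (k x') (k x) \<le> exp a * dist x' x" using lip'[of x x'] x x' by auto
      also have "\<dots> < exp a * (e / exp a)" using x' by (intro mult_strict_left_mono) auto
      finally show "dist (k x') (k x) < e" by simp
    qed
  qed
  moreover have "filterlim k at_top at_top"
  proof (rule filterlim_at_top_mono)
    show "filterlim (\<lambda>t. exp (- a) * t) at_top at_top"
      by (intro filterlim_tendsto_pos_mult_at_top[OF tendsto_const]) (auto simp: filterlim_ident)
    show "\<forall>\<^sub>F t in at_top. exp (- a) * t \<le> k t"
      using eventually_ge_at_top[of 0]
    proof eventually_elim
      case (elim t)
      show ?case using time_change_bounds(2)[OF l a k(1)[OF elim]] k[OF elim]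
        by (simp add: exp_minus field_simps)
    qed
  qed
  ultimately have "k \<in> time_changes"
    using mono k0 by (auto simp: time_changes_def strict_mono_on_def)
  then show thesis using that slope k by blast
qed

text \<open>The inverse time change exchanges the roles of the two paths; halving the parameter
  makes room for the displacement of the window.\<close>

lemma skorokhod_near_sym:
  assumes "skorokhod_near (a / 2) g f" "0 < a" "a \<le> 1"
  shows "skorokhod_near a f g"
proof -
  obtain l where l: "l \<in> time_changes" "log_slope_le (a/2) l" "\<And>t. t \<in> {a/2..1 / (a/2)} \<Longrightarrow> \<bar>g (l t) - f t\<bar> \<le> a/2"
    using assms(1) unfolding skorokhod_near_def by blast
  obtain k where k: "k \<in> time_changes" "log_slope_le (a/2) k" "\<And>t. 0 \<le> t \<Longrightarrow> l (k t) = t"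
    "\<And>t. 0 \<le> t \<Longrightarrow> 0 \<le> k t"
    using time_change_inverse[OF l(1,2)] by metis
  have "\<bar>f (k t) - g t\<bar> \<le> a" if t: "t \<in> {a..1/a}" for t
  proof -
    have "t / 2 \<le> k t" "k t \<le> 2 * t"
      using time_change_bounds2[OF k(1,2), of t] t assms by auto
    then have 1: "k t \<in> {a/2..1/(a/2)}" using t by auto
    have "l (k t) = t" using k(3)[of t] t assms by auto
    then show ?thesis using l(3)[OF 1] assms(2) by (simp add: abs_minus_commute)
  qed
  then show ?thesis
    unfolding skorokhod_near_def using k log_slope_le_mono[OF k(2), of a] assms
    by (intro bexI[of _ k]) auto
qed

section \<open>Time changes close to the identity\<close>

lemma ln_near_1:
  fixes x :: real assumes "\<bar>x - 1\<bar> \<le> c" "c \<le> 1/2" shows "\<bar>ln x\<bar> \<le> 2 * c"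
proof -
  have "\<bar>ln (1 + (x - 1)) - (x - 1)\<bar> \<le> 2 * (x - 1)\<^sup>2"
    using assms by (intro abs_ln_one_plus_x_minus_x_bound) auto
  moreover have "2 * (x - 1)\<^sup>2 \<le> \<bar>x - 1\<bar>"
  proof -
    have "(x-1)\<^sup>2 = \<bar>x-1\<bar> * \<bar>x-1\<bar>" by (simp add: power2_eq_square)
    also have "\<dots> \<le> \<bar>x-1\<bar> * (1/2)" using assms by (intro mult_left_mono) auto
    finally show ?thesis by simp
  qed
  ultimately show ?thesis using assms by simp
qed

text \<open>Adding a function with Lipschitz constant c changes the difference quotients of the
  identity, all equal to 1, by at most c. The bound c \<le> 1/2 keeps them above 1/2, whence strict
  growth and divergence, and it makes the linear estimate of the logarithm near 1
  applicable.\<close>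

lemma time_change_perturbation:
  assumes lip: "\<And>s t. 0 \<le> s \<Longrightarrow> 0 \<le> t \<Longrightarrow> \<bar>h t - h s\<bar> \<le> c * \<bar>t - s\<bar>"
    and "h 0 = 0" "c \<le> 1/2"
  shows "(\<lambda>t. t + h t) \<in> time_changes" "log_slope_le (2 * c) (\<lambda>t. t + h t)"
proof -
  have c0: "c \<ge> 0" using lip[of 0 1] by auto
  have up: "t + h t - (s + h s) \<ge> (t - s) / 2" if "0 \<le> s" "s < t" for s t
  proof -
    have "\<bar>h t - h s\<bar> \<le> c * (t - s)" using lip[of s t] that by auto
    also have "\<dots> \<le> 1/2 * (t - s)" using assms that by (intro mult_right_mono) auto
    finally show ?thesis by (simp add: abs_if field_simps split: if_splits)
  qed
  have "continuous_on {0..} h"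
    unfolding continuous_on_iff
  proof (intro ballI allI impI)
    fix x e :: real assume x: "x \<in> {0..}" and e: "0 < e"
    show "\<exists>d>0. \<forall>x'\<in>{0..}. dist x' x < d \<longrightarrow> dist (h x') (h x) < e"
    proof (intro exI[of _ e] conjI ballI impI)
      fix x' :: real assume x': "x' \<in> {0..}" "dist x' x < e"
      have "dist (h x') (h x) \<le> c * dist x' x" using lip[of x x'] x x' by (auto simp: dist_real_def)
      also have "\<dots> \<le> 1 * dist x' x" using assms by (intro mult_right_mono) auto
      finally show "dist (h x') (h x) < e" using x' by simp
    qed fact
  qed
  moreover have "filterlim (\<lambda>t. t + h t) at_top at_top"
  proof (rule filterlim_at_top_mono)
    show "filterlim (\<lambda>t::real. (1/2) * t) at_top at_top"
      by (intro filterlim_tendsto_pos_mult_at_top[OF tendsto_const]) (auto simp: filterlim_ident)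
    show "\<forall>\<^sub>F t in at_top. (1/2) * t \<le> t + h t"
      using eventually_gt_at_top[of 0]
      by eventually_elim (use up[of 0] assms in auto)
  qed
  moreover have "strict_mono_on {0..} (\<lambda>t. t + h t)"
    using up by (fastforce simp: strict_mono_on_def)
  ultimately show "(\<lambda>t. t + h t) \<in> time_changes"
    using assms by (auto simp: time_changes_def intro!: continuous_intros)
  show "log_slope_le (2 * c) (\<lambda>t. t + h t)"
    unfolding log_slope_le_def
  proof (intro allI impI)
    fix s t :: real assume st: "0 \<le> s" "0 \<le> t" "s \<noteq> t"
    have "(t + h t - (s + h s)) / (t - s) - 1 = (h t - h s) / (t - s)"
      using st by (simp add: field_simps)
    moreover have "\<bar>(h t - h s) / (t - s)\<bar> \<le> c"
      using lip[OF st(1,2)] st by (simp add: abs_divide field_simps)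
    ultimately show "\<bar>ln ((t + h t - (s + h s)) / (t - s))\<bar> \<le> 2 * c"
      using assms by (intro ln_near_1) auto
  qed
qed

text \<open>A sum of hat functions centred at the prescribed points moves each of them independently.\<close>

lemma time_change_prescribed:
  assumes fin: "finite P" and pos: "P \<subseteq> {0<..}" and a: "0 < a"
  obtains \<theta> where "0 < \<theta>"
    "\<And>p'. (\<And>p. p \<in> P \<Longrightarrow> \<bar>p' p - p\<bar> \<le> \<theta>) \<Longrightarrow>
       \<exists>l\<in>time_changes. log_slope_le a l \<and> (\<forall>p\<in>P. l p = p' p)"
proof -
  \<comment> \<open>\<delta> bounds from below the points themselves and their mutual distances. A
    hat of half-width \<delta> then vanishes at 0, which must stay fixed, and at all other points of
    P.\<close>
  have "\<exists>\<delta>>0. \<forall>p\<in>P. \<delta> \<le> p \<and> (\<forall>q\<in>P. p \<noteq> q \<longrightarrow> \<delta> \<le> \<bar>p - q\<bar>)"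
  proof -
    define E where "E = insert 1 (P \<union> (\<lambda>(p, q). \<bar>p - q\<bar>) ` {pq \<in> P \<times> P. fst pq \<noteq> snd pq})"
    have E: "finite E" using fin unfolding E_def by auto
    have "Min E > 0" using E pos by (subst Min_gr_iff) (auto simp: E_def)
    moreover have "Min E \<le> p" if "p \<in> P" for p using that E by (intro Min_le) (auto simp: E_def)
    moreover have "Min E \<le> \<bar>p - q\<bar>" if "p \<in> P" "q \<in> P" "p \<noteq> q" for p q
      using that E by (intro Min_le) (force simp: E_def)+
    ultimately show ?thesis by blast
  qed
  then obtain \<delta> where \<delta>: "\<delta> > 0" "\<And>p. p \<in> P \<Longrightarrow> \<delta> \<le> p" "\<And>p q. p \<in> P \<Longrightarrow> q \<in> P \<Longrightarrow> p \<noteq> q \<Longrightarrow> \<delta> \<le> \<bar>p - q\<bar>"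
    by blast
  define hat where "hat p t = max 0 (1 - \<bar>t - p\<bar> / \<delta>)" for p t :: real
  have hat_lip: "\<bar>hat p t - hat p s\<bar> \<le> \<bar>t - s\<bar> / \<delta>" for p s t
  proof -
    have "\<bar>hat p t - hat p s\<bar> \<le> \<bar>\<bar>t - p\<bar> / \<delta> - \<bar>s - p\<bar> / \<delta>\<bar>"
      unfolding hat_def by linarith
    also have "\<dots> = \<bar>\<bar>t - p\<bar> - \<bar>s - p\<bar>\<bar> / \<delta>"
      using \<delta>(1) by (simp add: abs_divide flip: diff_divide_distrib)
    also have "\<dots> \<le> \<bar>t - s\<bar> / \<delta>"
      using \<delta>(1) by (intro divide_right_mono) auto
    finally show ?thesis .
  qed
  have hat0: "hat p 0 = 0" if "p \<in> P" for p
    using \<delta>(1) \<delta>(2)[OF that] by (auto simp: hat_def max_def field_simps)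
  have hat_self: "hat p p = 1" for p by (simp add: hat_def)
  have hat_other: "hat p q = 0" if "p \<in> P" "q \<in> P" "p \<noteq> q" for p q
    using \<delta>(1) \<delta>(3)[OF that] by (auto simp: hat_def max_def field_simps abs_minus_commute)
  define c where "c = min (a/2) (1/2)"
  \<comment> \<open>A sum of \<open>card P\<close> hats with height at most \<theta> and width
    \<delta> must have Lipschitz constant at most c. The summand 1 in the denominator covers an
    empty P.\<close>
  define \<theta> where "\<theta> = c * \<delta> / (real (card P) + 1)"
  have c: "c > 0" "c \<le> 1/2" "2 * c \<le> a" using a by (auto simp: c_def)
  show thesis
  proof (rule that[of \<theta>])
    show "\<theta> > 0" using c \<delta>(1) by (simp add: \<theta>_def)
    fix p' assume p': "\<And>p. p \<in> P \<Longrightarrow> \<bar>p' p - p\<bar> \<le> \<theta>"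
    define h where "h t = (\<Sum>p\<in>P. (p' p - p) * hat p t)" for t
    have lip: "\<bar>h t - h s\<bar> \<le> c * \<bar>t - s\<bar>" for s t
    proof -
      have "\<bar>h t - h s\<bar> = \<bar>\<Sum>p\<in>P. (p' p - p) * (hat p t - hat p s)\<bar>"
        by (simp add: h_def right_diff_distrib flip: sum_subtractf)
      also have "\<dots> \<le> (\<Sum>p\<in>P. \<bar>(p' p - p) * (hat p t - hat p s)\<bar>)" by (rule sum_abs)
      also have "\<dots> \<le> (\<Sum>p\<in>P. \<theta> * (\<bar>t - s\<bar> / \<delta>))"
        unfolding abs_mult using p' hat_lip \<open>\<theta> > 0\<close> by (intro sum_mono mult_mono) auto
      also have "\<dots> = real (card P) / (real (card P) + 1) * c * \<bar>t - s\<bar>"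
        using \<delta>(1) by (simp add: \<theta>_def field_simps)
      also have "\<dots> \<le> 1 * c * \<bar>t - s\<bar>" using c by (intro mult_right_mono) auto
      finally show ?thesis by simp
    qed
    have "h 0 = 0" by (simp add: h_def hat0)
    from time_change_perturbation[of h, OF lip this c(2)]
    have tc: "(\<lambda>t. t + h t) \<in> time_changes" "log_slope_le (2 * c) (\<lambda>t. t + h t)" by auto
    moreover have "q + h q = p' q" if q: "q \<in> P" for q
    proof -
      have "h q = (\<Sum>p\<in>P. if p = q then p' q - q else 0)"
        unfolding h_def using q by (intro sum.cong) (auto simp: hat_self hat_other)
      then show ?thesis using q fin by simp
    qed
    ultimately show "\<exists>l\<in>time_changes. log_slope_le a l \<and> (\<forall>p\<in>P. l p = p' p)"
      using log_slope_le_mono[OF tc(2) c(3)] by (intro bexI[of _ "\<lambda>t. t + h t"]) auto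
  qed
qed

section \<open>Cadlag paths and their dyadic approximations\<close>

lemma cadlag_on_subset: "cadlag_on I f \<Longrightarrow> J \<subseteq> I \<Longrightarrow> cadlag_on J f"
  unfolding cadlag_on_def continuous_within
  by (meson Int_mono order_refl subsetD tendsto_within_subset)

lemma cadlag_on_local:
  assumes f: "cadlag_on {c..d} f" and x: "x \<in> {c..d}" and e: "0 < e"
  obtains r l where "0 < r"
    "\<And>s. s \<in> {c..d} \<Longrightarrow> x \<le> s \<Longrightarrow> s < x + r \<Longrightarrow> \<bar>f s - f x\<bar> < e"
    "\<And>s. s \<in> {c..d} \<Longrightarrow> x - r < s \<Longrightarrow> s < x \<Longrightarrow> \<bar>f s - l\<bar> < e"
proof -
  obtain l where l: "(f \<longlongrightarrow> l) (at x within {c..d} \<inter> {..<x})"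
    and r: "(f \<longlongrightarrow> f x) (at x within {c..d} \<inter> {x..})"
    using f x unfolding cadlag_on_def continuous_within by blast
  obtain r1 where r1: "r1 > 0" "\<And>s. s \<in> {c..d} \<inter> {x..} \<Longrightarrow> s \<noteq> x \<Longrightarrow> dist s x < r1 \<Longrightarrow> dist (f s) (f x) < e"
    using r e unfolding tendsto_iff eventually_at by metis
  obtain r2 where r2: "r2 > 0" "\<And>s. s \<in> {c..d} \<inter> {..<x} \<Longrightarrow> s \<noteq> x \<Longrightarrow> dist s x < r2 \<Longrightarrow> dist (f s) l < e"
    using l e unfolding tendsto_iff eventually_at by metis
  show thesis
  proof (rule that[of "min r1 r2" l])
    show "min r1 r2 > 0" using r1 r2 by auto
    show "\<bar>f s - f x\<bar> < e" if "s \<in> {c..d}" "x \<le> s" "s < x + min r1 r2" for s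
      using r1(2)[of s] that e by (cases "s = x") (auto simp: dist_real_def)
    show "\<bar>f s - l\<bar> < e" if "s \<in> {c..d}" "x - min r1 r2 < s" "s < x" for s
      using r2(2)[of s] that by (auto simp: dist_real_def)
  qed
qed

text \<open>On each side of a point x the path oscillates little near x, so \<open>{x}\<close> is a
  partition for short intervals around x; Bolzano's bisection principle pastes such intervals,
  adding the common endpoint. Being in the same piece is expressed by
  \<open>p \<le> s \<longleftrightarrow> p \<le> t\<close>: pieces are closed on the left, in line
  with right continuity, and this form of the condition is easily carried along a strictly
  increasing time change.\<close>

lemma cadlag_on_partition:
  assumes f: "cadlag_on {c..d} f" and cd: "c \<le> d" and e: "0 < e"
  obtains P where "finite P" "P \<subseteq> {c..d}"
    "\<And>s t. s \<in> {c..<d} \<Longrightarrow> t \<in> {c..<d} \<Longrightarrow> (\<And>p. p \<in> P \<Longrightarrow> p \<le> s \<longleftrightarrow> p \<le> t) \<Longrightarrow> \<bar>f s - f t\<bar> \<le> e"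
proof -
  define Q where "Q a b \<longleftrightarrow> (\<exists>P. finite P \<and> P \<subseteq> {c..d} \<and>
     (\<forall>s\<in>{a..<b} \<inter> {c..d}. \<forall>t\<in>{a..<b} \<inter> {c..d}. (\<forall>p\<in>P. p \<le> s \<longleftrightarrow> p \<le> t) \<longrightarrow> \<bar>f s - f t\<bar> \<le> e))" for a b
  from cd have "Q c d"
  proof (induct rule: Bolzano)
    case (trans a b b')
    show ?case
    proof (cases "b \<in> {c..d}")
      case True
      from trans obtain P P' where P: "finite P" "P \<subseteq> {c..d}" "finite P'" "P' \<subseteq> {c..d}"
        "\<forall>s\<in>{a..<b} \<inter> {c..d}. \<forall>t\<in>{a..<b} \<inter> {c..d}. (\<forall>p\<in>P. p \<le> s \<longleftrightarrow> p \<le> t) \<longrightarrow> \<bar>f s - f t\<bar> \<le> e"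
        "\<forall>s\<in>{b..<b'} \<inter> {c..d}. \<forall>t\<in>{b..<b'} \<inter> {c..d}. (\<forall>p\<in>P'. p \<le> s \<longleftrightarrow> p \<le> t) \<longrightarrow> \<bar>f s - f t\<bar> \<le> e"
        unfolding Q_def by blast
      show ?thesis
        unfolding Q_def
      proof (intro exI[of _ "insert b (P \<union> P')"] conjI ballI impI)
        fix s t assume st: "s \<in> {a..<b'} \<inter> {c..d}" "t \<in> {a..<b'} \<inter> {c..d}"
          "\<forall>p\<in>insert b (P \<union> P'). p \<le> s \<longleftrightarrow> p \<le> t"
        then have "b \<le> s \<longleftrightarrow> b \<le> t" by auto
        then show "\<bar>f s - f t\<bar> \<le> e"
          using P(5)[rule_format, of s t] P(6)[rule_format, of s t] st by (cases "b \<le> s") auto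
      qed (use P True in auto)
    next
      case False
      then have "{a..<b'} \<inter> {c..d} \<subseteq> {a..<b} \<inter> {c..d} \<or> {a..<b'} \<inter> {c..d} \<subseteq> {b..<b'} \<inter> {c..d}"
        by (cases "b < c") auto
      then show ?thesis using trans(1,2) unfolding Q_def by (meson subsetD)
    qed
  next
    case (local x)
    then have x: "x \<in> {c..d}" by simp
    obtain r l where r: "0 < r"
      "\<And>s. s \<in> {c..d} \<Longrightarrow> x \<le> s \<Longrightarrow> s < x + r \<Longrightarrow> \<bar>f s - f x\<bar> < e/2"
      "\<And>s. s \<in> {c..d} \<Longrightarrow> x - r < s \<Longrightarrow> s < x \<Longrightarrow> \<bar>f s - l\<bar> < e/2"
      using cadlag_on_local[OF f x, of "e/2"] e by auto
    show ?case
    proof (intro exI[of _ r] conjI allI impI)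
      fix a b assume ab: "a \<le> x \<and> x \<le> b \<and> b - a < r"
      show "Q a b"
        unfolding Q_def
      proof (intro exI[of _ "{x}"] conjI ballI impI)
        fix s t assume st: "s \<in> {a..<b} \<inter> {c..d}" "t \<in> {a..<b} \<inter> {c..d}" "\<forall>p\<in>{x}. p \<le> s \<longleftrightarrow> p \<le> t"
        show "\<bar>f s - f t\<bar> \<le> e"
        proof (cases "x \<le> s")
          case True
          then have "\<bar>f s - f x\<bar> < e/2" "\<bar>f t - f x\<bar> < e/2"
            using st ab by (intro r(2); auto)+
          then show ?thesis by linarith
        next
          case False
          then have "\<bar>f s - l\<bar> < e/2" "\<bar>f t - l\<bar> < e/2"
            using st ab by (intro r(3); auto)+
          then show ?thesis by linarith
        qed
      qed (use x in auto)
    qed fact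
  qed
  then obtain P where P: "finite P" "P \<subseteq> {c..d}" "\<forall>s\<in>{c..<d} \<inter> {c..d}. \<forall>t\<in>{c..<d} \<inter> {c..d}. (\<forall>p\<in>P. p \<le> s \<longleftrightarrow> p \<le> t) \<longrightarrow> \<bar>f s - f t\<bar> \<le> e"
    unfolding Q_def by blast
  show thesis by (rule that[OF P(1,2)]) (use P(3) in auto)
qed

lemma cadlag_on_bounded:
  assumes f: "cadlag_on {c..d} f"
  obtains B where "0 \<le> B" "\<And>s. s \<in> {c..d} \<Longrightarrow> \<bar>f s\<bar> \<le> B"
proof (cases "c \<le> d")
  case True
  define Q where "Q a b \<longleftrightarrow> (\<exists>B. \<forall>s\<in>{a..b} \<inter> {c..d}. \<bar>f s\<bar> \<le> B)" for a b
  from True have "Q c d"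
  proof (induct rule: Bolzano)
    case (trans a b b')
    then obtain B B' where "\<forall>s\<in>{a..b} \<inter> {c..d}. \<bar>f s\<bar> \<le> B" "\<forall>s\<in>{b..b'} \<inter> {c..d}. \<bar>f s\<bar> \<le> B'"
      unfolding Q_def by blast
    then have "\<forall>s\<in>{a..b'} \<inter> {c..d}. \<bar>f s\<bar> \<le> max B B'"
      by (metis IntE IntI atLeastAtMost_iff le_max_iff_disj linear)
    then show ?case unfolding Q_def by blast
  next
    case (local x)
    then have x: "x \<in> {c..d}" by simp
    obtain r l where r: "0 < r"
      "\<And>s. s \<in> {c..d} \<Longrightarrow> x \<le> s \<Longrightarrow> s < x + r \<Longrightarrow> \<bar>f s - f x\<bar> < 1"
      "\<And>s. s \<in> {c..d} \<Longrightarrow> x - r < s \<Longrightarrow> s < x \<Longrightarrow> \<bar>f s - l\<bar> < 1"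
      using cadlag_on_local[OF f x, of 1] by auto
    show ?case
    proof (intro exI[of _ r] conjI allI impI)
      fix a b assume ab: "a \<le> x \<and> x \<le> b \<and> b - a < r"
      have "\<bar>f s\<bar> \<le> \<bar>f x\<bar> + \<bar>l\<bar> + 1" if s: "s \<in> {a..b} \<inter> {c..d}" for s
        using r(2)[of s] r(3)[of s] s ab by (cases "x \<le> s") auto
      then show "Q a b" unfolding Q_def by blast
    qed fact
  qed
  then obtain B where B: "\<forall>s\<in>{c..d}. \<bar>f s\<bar> \<le> B" unfolding Q_def by auto
  show thesis using B True by (intro that[of B]) (auto intro: order_trans[OF abs_ge_zero])
next
  case False
  then show thesis by (intro that[of 0]) auto
qed

section \<open>Rounding times and values to the dyadic grid\<close>

definition dyadic_floor :: "nat \<Rightarrow> real \<Rightarrow> real" where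
  "dyadic_floor k t = of_int \<lfloor>2 ^ k * t\<rfloor> / 2 ^ k"

definition dyadic_ceiling :: "nat \<Rightarrow> real \<Rightarrow> real" where
  "dyadic_ceiling k t = of_int \<lceil>2 ^ k * t\<rceil> / 2 ^ k"

lemma dyadic_floor_bounds: "dyadic_floor k t \<le> t" "t - 1 / 2 ^ k < dyadic_floor k t"
proof -
  have pos: "(0::real) < 2 ^ k" by simp
  have "of_int \<lfloor>2 ^ k * t\<rfloor> \<le> t * 2 ^ k" "t * 2 ^ k - 1 < of_int \<lfloor>2 ^ k * t\<rfloor>"
    using floor_correct[of "2 ^ k * t"] by (simp_all add: mult.commute)
  then show "dyadic_floor k t \<le> t" "t - 1 / 2 ^ k < dyadic_floor k t"
    by (simp_all only: dyadic_floor_def pos_divide_le_eq[OF pos] pos_less_divide_eq[OF pos]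
        left_diff_distrib) simp
qed

lemma dyadic_ceiling_bounds: "t \<le> dyadic_ceiling k t" "dyadic_ceiling k t < t + 1 / 2 ^ k"
proof -
  have pos: "(0::real) < 2 ^ k" by simp
  have "t * 2 ^ k \<le> of_int \<lceil>2 ^ k * t\<rceil>" "of_int \<lceil>2 ^ k * t\<rceil> < t * 2 ^ k + 1"
    using ceiling_correct[of "2 ^ k * t"] by (simp_all add: mult.commute)
  then show "t \<le> dyadic_ceiling k t" "dyadic_ceiling k t < t + 1 / 2 ^ k"
    by (simp_all only: dyadic_ceiling_def pos_divide_less_eq[OF pos] pos_le_divide_eq[OF pos]
        distrib_right) simp
qed

text \<open>A Galois connection between rounding down and rounding up. It says that a jump of f at p
  is seen by the path sampled at \<open>dyadic_floor k t\<close> exactly from the time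
  \<open>dyadic_ceiling k p\<close> on, which tells where a time change has to send p.\<close>

lemma le_dyadic_floor_iff: "p \<le> dyadic_floor k t \<longleftrightarrow> dyadic_ceiling k p \<le> t"
proof -
  have "p \<le> dyadic_floor k t \<longleftrightarrow> 2 ^ k * p \<le> of_int \<lfloor>2 ^ k * t\<rfloor>"
    by (simp add: dyadic_floor_def pos_le_divide_eq mult.commute)
  also have "\<dots> \<longleftrightarrow> of_int \<lceil>2 ^ k * p\<rceil> \<le> 2 ^ k * t"
    by (metis ceiling_le_iff le_floor_iff)
  also have "\<dots> \<longleftrightarrow> dyadic_ceiling k p \<le> t"
    by (simp add: dyadic_ceiling_def pos_divide_le_eq mult.commute)
  finally show ?thesis .
qed

lemma inverse_pow2_tendsto: "(\<lambda>k. 1 / 2 ^ k :: real) \<longlonglongrightarrow> 0"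
  using LIMSEQ_realpow_zero[of "1/2::real"] by (simp add: power_one_over)

lemma eventually_inverse_pow2_less: "0 < e \<Longrightarrow> \<forall>\<^sub>F k in sequentially. 1 / 2 ^ k < (e::real)"
  using order_tendstoD(2)[OF inverse_pow2_tendsto] .

text \<open>The rounded times approach t from the right, so right continuity gives the limit; t < d
  keeps them in the interval eventually.\<close>

lemma dyadic_ceiling_tendsto:
  assumes "cadlag_on {c..d} f" "c \<le> t" "t < d"
  shows "(\<lambda>k. f (dyadic_ceiling k t)) \<longlonglongrightarrow> f t"
proof (rule tendstoI)
  fix e :: real assume e: "0 < e"
  have "t \<in> {c..d}" using assms by simp
  from cadlag_on_local[OF assms(1) this e]
  obtain r where r: "0 < r"
    "\<And>s. s \<in> {c..d} \<Longrightarrow> t \<le> s \<Longrightarrow> s < t + r \<Longrightarrow> \<bar>f s - f t\<bar> < e"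
    by metis
  have "\<forall>\<^sub>F k in sequentially. 1 / 2 ^ k < min r (d - t)"
    using r assms by (intro eventually_inverse_pow2_less) auto
  then show "\<forall>\<^sub>F k in sequentially. dist (f (dyadic_ceiling k t)) (f t) < e"
  proof eventually_elim
    case (elim k)
    have b: "t \<le> dyadic_ceiling k t" "dyadic_ceiling k t < t + min r (d - t)"
      using dyadic_ceiling_bounds[where t=t and k=k] elim by linarith+
    then have "dyadic_ceiling k t \<in> {c..d}" "dyadic_ceiling k t < t + r"
      using assms(2,3) by simp_all
    then show ?case
      using r(2) b(1) by (simp add: dist_real_def)
  qed
qed

text \<open>Measurable for an arbitrary f, because the argument of f takes countably many values,
  each on an interval.\<close>

lemma measurable_dyadic_ceiling:
  "(\<lambda>s. f (dyadic_ceiling k s)) \<in> borel_measurable borel"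
proof -
  have "(\<lambda>s::real. \<lceil>2 ^ k * s\<rceil>) \<in> borel \<rightarrow>\<^sub>M count_space UNIV"
    by measurable
  from measurable_compose_countable[OF _ this, of "\<lambda>i s. f (of_int i / 2 ^ k)" borel]
  have "(\<lambda>s::real. f (of_int \<lceil>2 ^ k * s\<rceil> / 2 ^ k)) \<in> borel_measurable borel"
    by simp
  then show ?thesis by (simp add: dyadic_ceiling_def)
qed

lemma cadlag_on_measurable:
  assumes f: "cadlag_on {a..} f"
  shows "(\<lambda>s. f (max a s)) \<in> borel_measurable borel"
proof (rule borel_measurable_LIMSEQ_real)
  show "(\<lambda>k. f (max a (dyadic_ceiling k s))) \<longlonglongrightarrow> f (max a s)" for s
  proof (cases "s < a")
    case True
    have "\<forall>\<^sub>F k in sequentially. 1 / 2 ^ k < a - s"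
      using True by (intro eventually_inverse_pow2_less) auto
    then have "\<forall>\<^sub>F k in sequentially. f (max a (dyadic_ceiling k s)) = f (max a s)"
    proof eventually_elim
      case (elim k)
      then show ?case using dyadic_ceiling_bounds[where t=s and k=k] True by (simp add: max_def)
    qed
    then show ?thesis by (rule tendsto_eventually)
  next
    case False
    have "max a (dyadic_ceiling k s) = dyadic_ceiling k s" for k
      using dyadic_ceiling_bounds[where t=s and k=k] False by simp
    moreover have "cadlag_on {a..s+1} f" by (rule cadlag_on_subset[OF f]) auto
    ultimately show ?thesis
      using dyadic_ceiling_tendsto[of a "s+1" f s] False by (simp add: max_def)
  qed
  show "(\<lambda>s. f (max a (dyadic_ceiling k s))) \<in> borel_measurable borel" for k
    by (rule measurable_dyadic_ceiling[of "\<lambda>s. f (max a s)"])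
qed

text \<open>Time and value are both rounded and the path is cut off outside a compact window, so
  that the result is described by finitely many integers. It need not belong to
  \<open>cadlag_space\<close>; this is harmless because \<open>skorokhod_near\<close> and its
  composition laws make sense for arbitrary functions.\<close>

definition dyadic_step :: "nat \<Rightarrow> (real \<Rightarrow> real) \<Rightarrow> real \<Rightarrow> real" where
  "dyadic_step k f t =
     (if 1 / 2 ^ k \<le> t \<and> t \<le> real k then of_int \<lfloor>2 ^ k * f (dyadic_floor k t)\<rfloor> / 2 ^ k else 0)"

text \<open>The path is cut into finitely many pieces of small oscillation, and a time change l
  close to the identity sends each cut p to \<open>dyadic_ceiling k p\<close>. By the Galois
  connection t and the sampled time \<open>dyadic_floor k (l t)\<close> then lie in the same piece,
  so the sampled value is close to \<open>f t\<close>; rounding it costs less than the grid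
  width.\<close>

lemma dyadic_step_near:
  assumes f: "cadlag_on {0<..} f" and a: "0 < a" "a \<le> 1"
  shows "\<forall>\<^sub>F k in sequentially. skorokhod_near a (dyadic_step k f) f"
proof -
  \<comment> \<open>For t in the window, \<open>l t\<close> lies between a / 2 and 2 / a. Rounding
    down loses less than a / 4, so the sampled time stays above c, and d exceeds 2 / a.\<close>
  define c d where "c = a / 4" and "d = 2 / a + 2"
  have "0 < 2 / a" using a by simp
  then have cd: "0 < c" "c < d" using a unfolding c_def d_def by linarith+
  have "cadlag_on {c..d} f" by (rule cadlag_on_subset[OF f]) (use cd in auto)
  from cadlag_on_partition[OF this, of "a/2"] cd a
  obtain P where P: "finite P" "P \<subseteq> {c..d}"
    "\<And>s t. s \<in> {c..<d} \<Longrightarrow> t \<in> {c..<d} \<Longrightarrow> (\<And>p. p \<in> P \<Longrightarrow> p \<le> s \<longleftrightarrow> p \<le> t) \<Longrightarrow> \<bar>f s - f t\<bar> \<le> a/2"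
    by auto
  have "P \<subseteq> {0<..}" using P cd by auto
  moreover have "0 < a/2" using a by simp
  ultimately obtain \<theta> where \<theta>: "0 < \<theta>"
    "\<And>p'. (\<And>p. p \<in> P \<Longrightarrow> \<bar>p' p - p\<bar> \<le> \<theta>) \<Longrightarrow>
       \<exists>l\<in>time_changes. log_slope_le (a/2) l \<and> (\<forall>p\<in>P. l p = p' p)"
    using time_change_prescribed[OF P(1)] by metis
  have "\<forall>\<^sub>F k in sequentially. 1 / 2 ^ k < min \<theta> c"
    using \<theta> cd by (intro eventually_inverse_pow2_less) auto
  moreover have "\<forall>\<^sub>F k in sequentially. d \<le> real k"
    by (rule eventually_sequentiallyI[of "nat \<lceil>d\<rceil>"]) linarith
  ultimately show ?thesis
  proof eventually_elim
    case (elim k)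
    have "\<bar>dyadic_ceiling k p - p\<bar> \<le> \<theta>" for p
      using dyadic_ceiling_bounds[where t=p and k=k] elim by auto
    from \<theta>(2)[of "dyadic_ceiling k", OF this]
    obtain l where l: "l \<in> time_changes" "log_slope_le (a/2) l" "\<And>p. p \<in> P \<Longrightarrow> l p = dyadic_ceiling k p"
      by auto
    have "\<bar>dyadic_step k f (l t) - f t\<bar> \<le> a" if t: "t \<in> {a..1/a}" for t
    proof -
      define u where "u = dyadic_floor k (l t)"
      have t0: "0 \<le> t" using t a by auto
      have lt: "t / 2 \<le> l t" "l t \<le> 2 * t"
        using time_change_bounds2[OF l(1,2) t0] a by auto
      have "2 * t < d" using t by (auto simp: d_def)
      then have ltd: "l t < d" using lt by auto
      have ub: "u \<le> l t" "l t - c < u"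
        using dyadic_floor_bounds[where t="l t" and k=k] elim by (auto simp: u_def)
      then have "u \<in> {c..<d}" using lt ltd t by (auto simp: c_def)
      moreover have "t \<in> {c..<d}" using t a \<open>2 * t < d\<close> t0 by (auto simp: c_def)
      moreover have "p \<le> u \<longleftrightarrow> p \<le> t" if p: "p \<in> P" for p
      proof -
        have p0: "0 \<le> p" using P(2) p cd by auto
        have sm: "strict_mono_on {0..} l" using l(1) by (simp add: time_changes_def)
        have "p \<le> u \<longleftrightarrow> l p \<le> l t" by (simp add: u_def le_dyadic_floor_iff l(3)[OF p])
        also have "\<dots> \<longleftrightarrow> p \<le> t"
          using strict_mono_on_less_eq[OF sm] p0 t0 by simp
        finally show ?thesis .
      qed
      ultimately have 1: "\<bar>f u - f t\<bar> \<le> a/2" by (intro P(3)) auto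
      have "1 / 2 ^ k \<le> l t" using lt elim t by (auto simp: c_def)
      then have "dyadic_step k f (l t) = dyadic_floor k (f u)"
        using ltd elim by (simp add: dyadic_step_def u_def dyadic_floor_def)
      moreover have "c < a/2" using a by (simp add: c_def)
      ultimately show ?thesis
        using dyadic_floor_bounds[where t="f u" and k=k] elim 1 by linarith
    qed
    then show "skorokhod_near a (dyadic_step k f) f"
      unfolding skorokhod_near_def using l log_slope_le_mono[OF l(2), of a] a by (intro bexI[of _ l]) auto
  qed
qed

section \<open>From the uniformity to the Skorokhod metric\<close>

lemma skorokhod_gap_props:
  assumes "f \<in> cadlag_space" "g \<in> cadlag_space" "0 < n"
  shows "0 \<le> skorokhod_gap n g f"
    "\<And>a. 0 < a \<Longrightarrow> a \<le> 1 / real n \<Longrightarrow> real n + 1 \<le> 1 / a \<Longrightarrow> skorokhod_near a g f \<Longrightarrow> skorokhod_gap n g f \<le> a"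
proof -
  define A where "A = {a. \<exists>l\<in>time_changes.
           (\<forall>s\<ge>0. \<forall>t\<ge>0. s \<noteq> t \<longrightarrow> \<bar>ln ((l t - l s) / (t - s))\<bar> \<le> a) \<and>
           (\<forall>t\<ge>1 / real n. \<bar>cutoff n t * (g (l t) - f t)\<bar> \<le> a)}"
  have gap: "skorokhod_gap n g f = Inf A" by (simp add: skorokhod_gap_def A_def)
  have pos: "0 \<le> a" if "a \<in> A" for a
  proof -
    from that obtain l where "\<forall>s\<ge>0. \<forall>t\<ge>0. s \<noteq> t \<longrightarrow> \<bar>ln ((l t - l s) / (t - s))\<bar> \<le> a"
      unfolding A_def by blast
    from this[rule_format, of 0 1] show ?thesis by linarith
  qed
  have cut: "0 \<le> cutoff n t" "cutoff n t \<le> 1" "t \<ge> real n + 1 \<Longrightarrow> cutoff n t = 0" for t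
    by (auto simp: cutoff_def)
  \<comment> \<open>The real \<open>Inf\<close> of an empty set carries no information, so A must be
    inhabited. The identity time change works, with the sum of the bounds of the two paths on the
    compact stretch where the cutoff is positive.\<close>
  have "A \<noteq> {}"
  proof -
    have c: "cadlag_on {1 / real n..real n + 1} f" "cadlag_on {1 / real n..real n + 1} g"
      using assms by (auto simp: cadlag_space_def intro!: cadlag_on_subset[of "{0<..}"] intro: less_le_trans[of 0 "1 / real n"])
    obtain B where B: "0 \<le> B" "\<And>s. s \<in> {1 / real n..real n + 1} \<Longrightarrow> \<bar>f s\<bar> \<le> B"
      using cadlag_on_bounded[OF c(1)] by metis
    obtain B' where B': "0 \<le> B'" "\<And>s. s \<in> {1 / real n..real n + 1} \<Longrightarrow> \<bar>g s\<bar> \<le> B'"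
      using cadlag_on_bounded[OF c(2)] by metis
    have "\<bar>cutoff n t * (g t - f t)\<bar> \<le> B + B'" if "t \<ge> 1 / real n" for t
    proof (cases "t \<ge> real n + 1")
      case False
      have "\<bar>cutoff n t * (g t - f t)\<bar> \<le> 1 * (B + B')"
        unfolding abs_mult using B(2)[of t] B'(2)[of t] cut[of t] that False
        by (intro mult_mono) auto
      then show ?thesis by simp
    qed (use cut B B' in auto)
    moreover have "(\<lambda>t. t) \<in> time_changes"
      by (auto simp: time_changes_def strict_mono_on_def filterlim_ident)
    ultimately have "B + B' \<in> A"
      unfolding A_def using B B' by (auto intro!: bexI[of _ "\<lambda>t. t"])
    then show ?thesis by blast
  qed
  then show "0 \<le> skorokhod_gap n g f" unfolding gap using pos by (intro cInf_greatest) auto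
  \<comment> \<open>The two numerical conditions on a place the stretch from 1 / n to n + 1 inside
    \<open>{a..1 / a}\<close>; to the right of that stretch the cutoff vanishes.\<close>
  fix a assume a: "0 < a" "a \<le> 1 / real n" "real n + 1 \<le> 1 / a" "skorokhod_near a g f"
  obtain l where l: "l \<in> time_changes" "log_slope_le a l" "\<And>t. t \<in> {a..1/a} \<Longrightarrow> \<bar>g (l t) - f t\<bar> \<le> a"
    using a(4) unfolding skorokhod_near_def by blast
  have "\<bar>cutoff n t * (g (l t) - f t)\<bar> \<le> a" if "t \<ge> 1 / real n" for t
  proof (cases "t \<ge> real n + 1")
    case False
    have "\<bar>cutoff n t * (g (l t) - f t)\<bar> \<le> 1 * a"
      unfolding abs_mult using l(3)[of t] cut[of t] that False a
      by (intro mult_mono) auto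
    then show ?thesis by simp
  qed (use cut a in auto)
  then have "a \<in> A" unfolding A_def using l by (auto simp: log_slope_le_def)
  moreover have "bdd_below A" using pos by (auto simp: bdd_below_def)
  ultimately show "skorokhod_gap n g f \<le> a" unfolding gap by (intro cInf_lower)
qed

text \<open>The series beyond its first m terms is at most \<open>(1/2)^m\<close>, and the first m
  gaps are at most a once the window \<open>{a..1 / a}\<close> is large enough, which is the role of
  1 / (m + 2) in the choice of a. The comparison goes from the uniformity to the metric: it makes
  every Skorokhod-open set open for the uniformity.\<close>

lemma skorokhod_near_dist:
  assumes r: "0 < r"
  obtains a where "0 < a"
    "\<And>f g. f \<in> cadlag_space \<Longrightarrow> g \<in> cadlag_space \<Longrightarrow> skorokhod_near a g f \<Longrightarrow> skorokhod_dist g f < r"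
proof -
  have "\<forall>\<^sub>F k in sequentially. 1 / 2 ^ k < r / 2"
    using r by (intro eventually_inverse_pow2_less) auto
  then obtain m :: nat where m: "1 / 2 ^ m < r / 2" by (auto simp: eventually_sequentially)
  define a where "a = min (1 / (real m + 2)) (r / 2)"
  have a0: "0 < a" using r by (simp add: a_def)
  show thesis
  proof (rule that[OF a0])
    fix f g assume fg: "f \<in> cadlag_space" "g \<in> cadlag_space" and near: "skorokhod_near a g f"
    define u where "u i = (1 / 2) ^ Suc i * min 1 (skorokhod_gap (Suc i) g f)" for i
    have gap0: "0 \<le> skorokhod_gap (Suc i) g f" for i
      using skorokhod_gap_props(1)[OF fg, of "Suc i"] by simp
    have u0: "0 \<le> u i" "u i \<le> (1/2) ^ Suc i" for i
    proof -
      show "0 \<le> u i" using gap0[of i] by (simp add: u_def)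
      have "u i \<le> (1/2) ^ Suc i * 1" unfolding u_def by (intro mult_left_mono) auto
      then show "u i \<le> (1/2) ^ Suc i" by simp
    qed
    have gs: "summable (\<lambda>i. (1/2::real) ^ Suc i)"
      using power_half_series sums_summable by blast
    have us: "summable u" using u0 by (intro summable_comparison_test'[OF gs, of 0]) auto
    have ui: "u i \<le> a * (1/2) ^ Suc i" if "i < m" for i
    proof -
      have "real (Suc i) \<le> real m + 2" using that by auto
      then have "1 / (real m + 2) \<le> 1 / real (Suc i)" by (intro divide_left_mono) auto
      then have 1: "a \<le> 1 / real (Suc i)" unfolding a_def by linarith
      have "real (Suc i) + 1 \<le> real m + 2" using that by auto
      also have "\<dots> \<le> 1 / a"
      proof -
        have "a \<le> 1 / (real m + 2)" by (simp add: a_def)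
        then show ?thesis using a0 by (simp add: field_simps)
      qed
      finally have "skorokhod_gap (Suc i) g f \<le> a"
        by (intro skorokhod_gap_props(2)[OF fg _ a0 1 _ near]) auto
      then have "u i \<le> (1/2) ^ Suc i * a" unfolding u_def by (intro mult_left_mono) auto
      then show ?thesis by (simp add: mult.commute)
    qed
    have "suminf u = (\<Sum>i. u (i + m)) + (\<Sum>i<m. u i)"
      by (rule suminf_split_initial_segment[OF us])
    also have "(\<Sum>i. u (i + m)) \<le> (\<Sum>i. (1/2)^m * (1/2) ^ Suc i)"
    proof (rule suminf_le)
      show "u (i + m) \<le> (1/2)^m * (1/2) ^ Suc i" for i using u0(2)[of "i + m"] by (simp add: power_add mult.commute)
    qed (use us gs in \<open>auto intro!: summable_mult simp del: power_Suc simp: summable_iff_shift\<close>)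
    also have "(\<Sum>i. (1/2)^m * (1/2) ^ Suc i) = (1/2::real)^m"
      using power_half_series by (subst suminf_mult[OF gs]) (simp add: sums_iff)
    also have "(\<Sum>i<m. u i) \<le> (\<Sum>i<m. a * (1/2) ^ Suc i)" using ui by (intro sum_mono) auto
    also have "\<dots> = a * (\<Sum>i<m. (1/2) ^ Suc i)" by (simp add: sum_distrib_left)
    also have "\<dots> \<le> a * 1"
    proof (rule mult_left_mono)
      have "(\<Sum>i<m. (1/2::real) ^ Suc i) \<le> (\<Sum>i. (1/2) ^ Suc i)" by (rule sum_le_suminf[OF gs]) auto
      then show "(\<Sum>i<m. (1/2::real) ^ Suc i) \<le> 1" using power_half_series by (simp add: sums_iff)
    qed (use a0 in simp)
    finally have "suminf u \<le> (1/2)^m + a" by simp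
    also have "\<dots> < r" using m by (simp add: a_def power_one_over min_def split: if_splits) 
    finally show "skorokhod_dist g f < r" unfolding skorokhod_dist_def u_def .
  qed
qed

section \<open>Borel sets of the Skorokhod topology\<close>

definition paths2 :: "((real \<Rightarrow> real) \<times> (real \<Rightarrow> real)) set" where
  "paths2 = cadlag_space \<times> cadlag_space"

definition near2 :: "real \<Rightarrow> (real \<Rightarrow> real) \<times> (real \<Rightarrow> real) \<Rightarrow> (real \<Rightarrow> real) \<times> (real \<Rightarrow> real) \<Rightarrow> bool" where
  "near2 a g f \<longleftrightarrow> skorokhod_near a (fst g) (fst f) \<and> skorokhod_near a (snd g) (snd f)"

text \<open>Openness of the trace of U on \<open>paths2\<close>: only points and neighbours inside
  the path space are tested.\<close>

definition near_open :: "((real \<Rightarrow> real) \<times> (real \<Rightarrow> real)) set \<Rightarrow> bool" where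
  "near_open U \<longleftrightarrow> (\<forall>f\<in>U \<inter> paths2. \<exists>a>0. \<forall>g\<in>paths2. near2 a g f \<longrightarrow> g \<in> U)"

text \<open>The sigma-algebra on which finite-dimensional distributions determine a law.
  \<open>paths2\<close> is not one of its sets, since uncountably many coordinates matter for path
  regularity; hence everything below compares traces on \<open>paths2\<close>.\<close>

abbreviation coords :: "((real \<Rightarrow> real) \<times> (real \<Rightarrow> real)) measure" where
  "coords \<equiv> Pi\<^sub>M {0<..} (\<lambda>_. borel) \<Otimes>\<^sub>M Pi\<^sub>M {0<..} (\<lambda>_. borel)"

lemma near2_mono: "near2 a g f \<Longrightarrow> 0 < a \<Longrightarrow> a \<le> b \<Longrightarrow> near2 b g f"
  using skorokhod_near_mono by (auto simp: near2_def)

lemma near2_trans: "near2 (a / 2) h g \<Longrightarrow> near2 (a / 2) g f \<Longrightarrow> 0 < a \<Longrightarrow> a \<le> 1 \<Longrightarrow> near2 a h f"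
  using skorokhod_near_trans by (auto simp: near2_def)

lemma near2_sym: "near2 (a / 2) g f \<Longrightarrow> 0 < a \<Longrightarrow> a \<le> 1 \<Longrightarrow> near2 a f g"
  using skorokhod_near_sym by (auto simp: near2_def)

lemma paths2_coords: "paths2 \<subseteq> space coords"
  by (auto simp: paths2_def cadlag_space_def space_pair_measure space_PiM PiE_def)

lemma openin_skorokhod_near:
  assumes "openin skorokhod_topology U" "f \<in> U"
  obtains a where "0 < a" "\<And>g. g \<in> cadlag_space \<Longrightarrow> skorokhod_near a g f \<Longrightarrow> g \<in> U"
proof -
  obtain r where r: "r > 0" "\<forall>g\<in>cadlag_space. skorokhod_dist g f < r \<longrightarrow> g \<in> U"
    using assms unfolding openin_skorokhod_topology by blast
  obtain a where "0 < a"
    "\<And>f g. f \<in> cadlag_space \<Longrightarrow> g \<in> cadlag_space \<Longrightarrow> skorokhod_near a g f \<Longrightarrow> skorokhod_dist g f < r"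
    using skorokhod_near_dist[OF r(1)] by metis
  moreover have "f \<in> cadlag_space" using assms unfolding openin_skorokhod_topology by blast
  ultimately show thesis using that r by blast
qed

lemma openin_near_open:
  assumes "openin (prod_topology skorokhod_topology skorokhod_topology) U"
  shows "near_open U"
  unfolding near_open_def
proof
  fix f assume f: "f \<in> U \<inter> paths2"
  obtain f1 f2 where f12: "f = (f1, f2)" by (cases f)
  with f have "(f1, f2) \<in> U" by simp
  with assms[unfolded openin_prod_topology_alt, rule_format, of f1 f2]
  obtain U1 U2 where U: "openin skorokhod_topology U1" "openin skorokhod_topology U2"
    "f1 \<in> U1" "f2 \<in> U2" "U1 \<times> U2 \<subseteq> U"
    by metis
  obtain a where a: "0 < a" "\<And>g. g \<in> cadlag_space \<Longrightarrow> skorokhod_near a g f1 \<Longrightarrow> g \<in> U1"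
    using openin_skorokhod_near[OF U(1,3)] by metis
  obtain b where b: "0 < b" "\<And>g. g \<in> cadlag_space \<Longrightarrow> skorokhod_near b g f2 \<Longrightarrow> g \<in> U2"
    using openin_skorokhod_near[OF U(2,4)] by metis
  show "\<exists>a>0. \<forall>g\<in>paths2. near2 a g f \<longrightarrow> g \<in> U"
  proof (intro exI[of _ "min a b"] conjI ballI impI)
    fix g assume g: "g \<in> paths2" "near2 (min a b) g f"
    then have "skorokhod_near a (fst g) f1" "skorokhod_near b (snd g) f2"
      using skorokhod_near_mono[of "min a b"] a(1) b(1) by (auto simp: near2_def f12)
    then show "g \<in> U" using U(5) a(2) b(2) g(1) by (cases g) (auto simp: paths2_def)
  qed (use a b in simp)
qed

definition near_interior :: "((real \<Rightarrow> real) \<times> (real \<Rightarrow> real)) set \<Rightarrow> ((real \<Rightarrow> real) \<times> (real \<Rightarrow> real)) set" where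
  "near_interior A = {f \<in> paths2. \<exists>a>0. \<forall>g\<in>paths2. near2 a g f \<longrightarrow> g \<in> A}"

lemma near_open_interior: "near_open (near_interior A)"
  unfolding near_open_def
proof
  fix f assume "f \<in> near_interior A \<inter> paths2"
  then obtain a where a: "0 < a" "\<forall>g\<in>paths2. near2 a g f \<longrightarrow> g \<in> A"
    unfolding near_interior_def by blast
  define b where "b = min a 1"
  have b: "0 < b" "b \<le> 1" "b \<le> a" using a by (auto simp: b_def)
  have "g \<in> near_interior A" if g: "g \<in> paths2" "near2 (b/2) g f" for g
  proof -
    have "h \<in> A" if "h \<in> paths2" "near2 (b/2) h g" for h
      using near2_trans[OF that(2) g(2) b(1,2)] near2_mono[OF _ b(1,3)] a(2) that(1) by blast
    then show ?thesis unfolding near_interior_def using g(1) b(1) by (auto intro!: exI[of _ "b/2"])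
  qed
  then show "\<exists>a>0. \<forall>g\<in>paths2. near2 a g f \<longrightarrow> g \<in> near_interior A"
    using b(1) by (intro exI[of _ "b/2"]) auto
qed

definition dyadic_step2 :: "nat \<Rightarrow> (real \<Rightarrow> real) \<times> (real \<Rightarrow> real) \<Rightarrow> (real \<Rightarrow> real) \<times> (real \<Rightarrow> real)" where
  "dyadic_step2 k p = (dyadic_step k (fst p), dyadic_step k (snd p))"

lemma dyadic_step2_near:
  assumes f: "f \<in> paths2" and a: "0 < a"
  shows "\<forall>\<^sub>F k in sequentially. near2 a (dyadic_step2 k f) f"
proof -
  define b where "b = min a 1"
  have b: "0 < b" "b \<le> 1" "b \<le> a" using a by (auto simp: b_def)
  have "cadlag_on {0<..} (fst f)" "cadlag_on {0<..} (snd f)"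
    using f by (auto simp: paths2_def cadlag_space_def)
  from this[THEN dyadic_step_near, OF b(1,2)] show ?thesis
    by eventually_elim (auto simp: near2_def dyadic_step2_def intro: skorokhod_near_mono[OF _ b(1,3)])
qed

text \<open>The step approximation depends on finitely many integers, hence on the path in a
  measurable way whatever sigma-algebra is put on its range.\<close>

lemma measurable_dyadic_step2: "dyadic_step2 k \<in> coords \<rightarrow>\<^sub>M count_space UNIV"
proof -
  define I :: "int set" where "I = {1..int k * 2 ^ k}"
  define q where "q f = (\<lambda>i\<in>I. \<lfloor>2 ^ k * f (of_int i / 2 ^ k)\<rfloor>)" for f :: "real \<Rightarrow> real"
  define r where "r v t = (if 1 / 2 ^ k \<le> t \<and> t \<le> real k then of_int (v \<lfloor>2 ^ k * t\<rfloor>) / 2 ^ k else 0 :: real)"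
    for v :: "int \<Rightarrow> int" and t :: real
  have step: "dyadic_step k f = r (q f)" for f
  proof
    fix t
    show "dyadic_step k f t = r (q f) t"
    proof (cases "1 / 2 ^ k \<le> t \<and> t \<le> real k")
      case True
      then have "1 \<le> 2 ^ k * t" by (simp add: field_simps)
      moreover have "2 ^ k * t \<le> of_int (int k * 2 ^ k)" using True by simp
      ultimately have "\<lfloor>2 ^ k * t\<rfloor> \<in> I" unfolding I_def
        by (metis atLeastAtMost_iff floor_mono floor_of_int le_floor_iff of_int_1)
      then show ?thesis using True by (simp add: dyadic_step_def r_def q_def dyadic_floor_def)
    next
      case False
      then show ?thesis by (auto simp: dyadic_step_def r_def)
    qed
  qed
  have I: "finite I" by (simp add: I_def)
  have q: "q \<in> Pi\<^sub>M {0<..} (\<lambda>_. borel) \<rightarrow>\<^sub>M Pi\<^sub>M I (\<lambda>_. count_space UNIV)"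
    unfolding q_def
  proof (rule measurable_restrict)
    fix i assume i: "i \<in> I"
    define x :: real where "x = of_int i / 2 ^ k"
    have "x \<in> {0<..}" using i by (simp add: I_def x_def)
    then have "(\<lambda>f. f x) \<in> Pi\<^sub>M {0<..} (\<lambda>_. borel) \<rightarrow>\<^sub>M (borel :: real measure)"
      by (rule measurable_component_singleton)
    then have "(\<lambda>f. \<lfloor>2 ^ k * (f x :: real)\<rfloor>) \<in> Pi\<^sub>M {0<..} (\<lambda>_. borel) \<rightarrow>\<^sub>M count_space UNIV"
      by measurable
    then show "(\<lambda>f. \<lfloor>2 ^ k * f (of_int i / 2 ^ k :: real)\<rfloor>) \<in> Pi\<^sub>M {0<..} (\<lambda>_. borel :: real measure) \<rightarrow>\<^sub>M count_space UNIV"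
      by (simp add: x_def)
  qed
  have "Pi\<^sub>M I (\<lambda>_. count_space UNIV) = count_space (PiE I (\<lambda>_. UNIV :: int set))"
    using I by (intro count_space_PiM_finite) auto
  \<comment> \<open>With countable factors the product sigma-algebra is again the discrete one, so
    the reconstruction r of a step function from its integers can be composed with q as an arbitrary
    map.\<close>
  moreover have "countable (PiE I (\<lambda>_. UNIV :: int set))"
    using I by (intro countable_PiE) auto
  ultimately have "Pi\<^sub>M I (\<lambda>_. count_space UNIV) \<Otimes>\<^sub>M Pi\<^sub>M I (\<lambda>_. count_space UNIV)
      = count_space (PiE I (\<lambda>_. UNIV :: int set) \<times> PiE I (\<lambda>_. UNIV :: int set))"
    by (simp add: pair_measure_countable)
  moreover have "(\<lambda>p. (q (fst p), q (snd p))) \<in> coords \<rightarrow>\<^sub>M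
      Pi\<^sub>M I (\<lambda>_. count_space UNIV) \<Otimes>\<^sub>M Pi\<^sub>M I (\<lambda>_. count_space UNIV)"
    by (intro measurable_Pair measurable_compose[OF measurable_fst q] measurable_compose[OF measurable_snd q])
  ultimately have "(\<lambda>p. (q (fst p), q (snd p))) \<in> coords \<rightarrow>\<^sub>M
     count_space (PiE I (\<lambda>_. UNIV :: int set) \<times> PiE I (\<lambda>_. UNIV :: int set))"
    by simp
  from measurable_compose[OF this, of "\<lambda>(v, w). (r v, r w)" "count_space UNIV"]
  have "(\<lambda>p. (r (q (fst p)), r (q (snd p)))) \<in> coords \<rightarrow>\<^sub>M count_space UNIV"
    by simp
  also have "(\<lambda>p. (r (q (fst p)), r (q (snd p)))) = dyadic_step2 k"
    by (auto simp: fun_eq_iff dyadic_step2_def step)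
  finally show ?thesis .
qed

text \<open>A path f lies in U iff, for some j, its roundings eventually lie in the set
  \<open>A j\<close> of all functions whose neighbourhood of radius 1 / (j + 1) in
  \<open>paths2\<close> is contained in U. One direction uses that the roundings converge to f
  together with the triangle inequality, the other uses symmetry. The sets \<open>A j\<close> are
  arbitrary, but the roundings are measurable into a discrete space, so C is measurable.\<close>

lemma near_open_trace:
  assumes U: "near_open U"
  obtains C where "C \<in> sets coords" "\<And>f. f \<in> paths2 \<Longrightarrow> f \<in> U \<longleftrightarrow> f \<in> C"
proof -
  define A where "A j = {h. \<forall>g\<in>paths2. near2 (1 / real (Suc j)) g h \<longrightarrow> g \<in> U}" for j
  define C where "C = {p \<in> space coords. \<exists>j. \<exists>K. \<forall>k\<ge>K. dyadic_step2 k p \<in> A j}"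
  have "Measurable.pred coords (\<lambda>p. dyadic_step2 k p \<in> A j)" for k j
    by (rule measurable_compose[OF measurable_dyadic_step2]) simp
  then have "Measurable.pred coords (\<lambda>p. \<exists>j. \<exists>K. \<forall>k\<ge>K. dyadic_step2 k p \<in> A j)"
    by measurable
  then have "C \<in> sets coords" unfolding C_def by (rule predE)
  moreover have "f \<in> U \<longleftrightarrow> f \<in> C" if f: "f \<in> paths2" for f
  proof
    assume "f \<in> U"
    then obtain a where a: "0 < a" "\<forall>g\<in>paths2. near2 a g f \<longrightarrow> g \<in> U"
      using U f unfolding near_open_def by blast
    define b where "b = min a 1"
    have b: "0 < b" "b \<le> 1" "b \<le> a" using a by (auto simp: b_def)
    obtain j where j: "1 / real (Suc j) < b/2"
      using b(1) by (metis half_gt_zero_iff nat_approx_posE)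
    have "\<forall>\<^sub>F k in sequentially. near2 (b/2) (dyadic_step2 k f) f"
      using b f by (intro dyadic_step2_near) auto
    then have "\<forall>\<^sub>F k in sequentially. dyadic_step2 k f \<in> A j"
    proof eventually_elim
      case (elim k)
      have "g \<in> U" if g: "g \<in> paths2" "near2 (1 / real (Suc j)) g (dyadic_step2 k f)" for g
      proof -
        have "near2 (b/2) g (dyadic_step2 k f)"
          using near2_mono[OF g(2), of "b/2"] j by simp
        from near2_trans[OF this elim b(1,2)] near2_mono[OF _ b(1,3)] a(2) g(1)
        show ?thesis by blast
      qed
      then show ?case by (auto simp: A_def)
    qed
    then show "f \<in> C"
      using paths2_coords f unfolding C_def eventually_sequentially by blast
  next
    assume "f \<in> C"
    then obtain j K where jK: "\<And>k. k \<ge> K \<Longrightarrow> dyadic_step2 k f \<in> A j" unfolding C_def by blast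
    define b where "b = 1 / real (Suc j)"
    have b: "0 < b" "b \<le> 1" by (auto simp: b_def)
    have "\<forall>\<^sub>F k in sequentially. near2 (b/2) (dyadic_step2 k f) f"
      using b f by (intro dyadic_step2_near) auto
    then have "\<forall>\<^sub>F k in sequentially. f \<in> U"
      using eventually_ge_at_top[of K]
    proof eventually_elim
      case (elim k)
      from near2_sym[OF elim(1) b] jK[OF elim(2)] f show ?case by (auto simp: A_def b_def)
    qed
    then show "f \<in> U" by simp
  qed
  ultimately show thesis by (rule that)
qed

lemma sets_near_open:
  assumes "Y \<in> M \<rightarrow>\<^sub>M coords" "\<And>\<omega>. \<omega> \<in> space M \<Longrightarrow> Y \<omega> \<in> paths2" "near_open U"
  shows "{\<omega> \<in> space M. Y \<omega> \<in> U} \<in> sets M"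
proof -
  obtain C where C: "C \<in> sets coords" "\<And>f. f \<in> paths2 \<Longrightarrow> f \<in> U \<longleftrightarrow> f \<in> C"
    using near_open_trace[OF assms(3)] by metis
  have "{\<omega> \<in> space M. Y \<omega> \<in> U} = Y -` C \<inter> space M"
    using C(2)[OF assms(2)] by blast
  then show ?thesis using measurable_sets[OF assms(1) C(1)] by simp
qed

text \<open>The trace of U is the trace of some set in \<open>coords\<close>, so laws on the
  coordinates already determine its probability.\<close>

lemma emeasure_near_open_cong:
  assumes Y: "Y \<in> M \<rightarrow>\<^sub>M coords" "\<And>\<omega>. \<omega> \<in> space M \<Longrightarrow> Y \<omega> \<in> paths2"
    and Z: "Z \<in> M' \<rightarrow>\<^sub>M coords" "\<And>\<omega>. \<omega> \<in> space M' \<Longrightarrow> Z \<omega> \<in> paths2"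
    and law: "distr M coords Y = distr M' coords Z" and U: "near_open U"
  shows "emeasure M {\<omega> \<in> space M. Y \<omega> \<in> U} = emeasure M' {\<omega> \<in> space M'. Z \<omega> \<in> U}"
proof -
  obtain C where C: "C \<in> sets coords" "\<And>f. f \<in> paths2 \<Longrightarrow> f \<in> U \<longleftrightarrow> f \<in> C"
    using near_open_trace[OF U] by metis
  have "{\<omega> \<in> space M. Y \<omega> \<in> U} = Y -` C \<inter> space M" "{\<omega> \<in> space M'. Z \<omega> \<in> U} = Z -` C \<inter> space M'"
    using C(2)[OF Y(2)] C(2)[OF Z(2)] by blast+
  then show ?thesis
    using law emeasure_distr[OF Y(1) C(1)] emeasure_distr[OF Z(1) C(1)] by simp
qed

section \<open>Borel sets of the product of two Skorokhod topologies\<close>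

abbreviation skorokhod2 :: "((real \<Rightarrow> real) \<times> (real \<Rightarrow> real)) topology" where
  "skorokhod2 \<equiv> prod_topology skorokhod_topology skorokhod_topology"

lemma topspace_skorokhod2: "topspace skorokhod2 = paths2"
  by (simp add: topspace_skorokhod_topology paths2_def)

lemma sets_borel_of_topology: "sets (borel_of_topology T) = sigma_sets (topspace T) {U. openin T U}"
  unfolding borel_of_topology_def using openin_subset by (intro sets_measure_of) auto

lemma space_borel_of_topology: "space (borel_of_topology T) = topspace T"
  unfolding borel_of_topology_def using openin_subset by (intro space_measure_of) auto

lemma measurable_skorokhod2:
  assumes "Y \<in> M \<rightarrow>\<^sub>M coords" "\<And>\<omega>. \<omega> \<in> space M \<Longrightarrow> Y \<omega> \<in> paths2"
  shows "Y \<in> M \<rightarrow>\<^sub>M borel_of_topology skorokhod2"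
  unfolding borel_of_topology_def
proof (rule measurable_measure_of)
  show "{U. openin skorokhod2 U} \<subseteq> Pow (topspace skorokhod2)" using openin_subset by blast
  show "Y \<in> space M \<rightarrow> topspace skorokhod2" using assms(2) by (auto simp: topspace_skorokhod2 simp del: topspace_prod_topology)
  fix U assume "U \<in> {U. openin skorokhod2 U}"
  then have "near_open U" using openin_near_open by blast
  from sets_near_open[OF assms this] show "Y -` U \<inter> space M \<in> sets M"
    by (simp add: vimage_def Int_def conj_commute)
qed

text \<open>The open sets form an intersection-stable generator that contains the whole space, and
  the two image measures agree on it.\<close>

lemma distr_skorokhod2_eq:
  assumes M: "finite_measure M"
    and Y: "Y \<in> M \<rightarrow>\<^sub>M coords" "\<And>\<omega>. \<omega> \<in> space M \<Longrightarrow> Y \<omega> \<in> paths2"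
    and Z: "Z \<in> M' \<rightarrow>\<^sub>M coords" "\<And>\<omega>. \<omega> \<in> space M' \<Longrightarrow> Z \<omega> \<in> paths2"
    and law: "distr M coords Y = distr M' coords Z"
  shows "distr M (borel_of_topology skorokhod2) Y = distr M' (borel_of_topology skorokhod2) Z"
proof (rule measure_eqI_generator_eq)
  show "Int_stable {U. openin skorokhod2 U}" by (auto simp: Int_stable_def)
  show "{U. openin skorokhod2 U} \<subseteq> Pow (topspace skorokhod2)" using openin_subset by blast
  show "range (\<lambda>_::nat. topspace skorokhod2) \<subseteq> {U. openin skorokhod2 U}" by (simp del: topspace_prod_topology)
  show "emeasure (distr M (borel_of_topology skorokhod2) Y) (topspace skorokhod2) \<noteq> \<infinity>"
    using finite_measure.emeasure_finite[OF finite_measure.finite_measure_distr[OF M measurable_skorokhod2[OF Y]]]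
    by (simp del: topspace_prod_topology)
  fix U assume "U \<in> {U. openin skorokhod2 U}"
  then have U: "openin skorokhod2 U" by simp
  then have "U \<in> sets (borel_of_topology skorokhod2)" by (auto simp: sets_borel_of_topology)
  moreover have "Y -` U \<inter> space M = {\<omega> \<in> space M. Y \<omega> \<in> U}" "Z -` U \<inter> space M' = {\<omega> \<in> space M'. Z \<omega> \<in> U}"
    by auto
  ultimately show "emeasure (distr M (borel_of_topology skorokhod2) Y) U
      = emeasure (distr M' (borel_of_topology skorokhod2) Z) U"
    using emeasure_near_open_cong[OF Y Z law openin_near_open[OF U]]
    by (simp add: emeasure_distr measurable_skorokhod2[OF Y] measurable_skorokhod2[OF Z])
qed (simp_all add: sets_borel_of_topology del: topspace_prod_topology)

lemma continuous_map_measurable: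
  assumes "continuous_map T euclideanreal \<Phi>"
  shows "\<Phi> \<in> borel_measurable (borel_of_topology T)"
proof (rule borel_measurableI)
  fix S :: "real set" assume "open S"
  then have "openin T {x \<in> topspace T. \<Phi> x \<in> S}"
    using assms openin_continuous_map_preimage by fastforce
  moreover have "\<Phi> -` S \<inter> space (borel_of_topology T) = {x \<in> topspace T. \<Phi> x \<in> S}"
    by (auto simp: space_borel_of_topology)
  ultimately show "\<Phi> -` S \<inter> space (borel_of_topology T) \<in> sets (borel_of_topology T)"
    by (auto simp: sets_borel_of_topology)
qed

lemma continuous_map_near:
  assumes \<Phi>: "continuous_map skorokhod2 euclideanreal \<Phi>" and f: "f \<in> paths2" and e: "0 < e"
  obtains a where "0 < a" "\<And>g. g \<in> paths2 \<Longrightarrow> near2 a g f \<Longrightarrow> \<bar>\<Phi> g - \<Phi> f\<bar> < e"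
proof -
  have "openin skorokhod2 {g \<in> topspace skorokhod2. \<Phi> g \<in> ball (\<Phi> f) e}"
    using \<Phi> by (intro openin_continuous_map_preimage) (auto simp del: topspace_prod_topology)
  from openin_near_open[OF this] f e obtain a where a: "0 < a"
    "\<forall>g\<in>paths2. near2 a g f \<longrightarrow> \<Phi> g \<in> ball (\<Phi> f) e"
    unfolding near_open_def topspace_skorokhod2 by (force simp del: mem_ball)
  show thesis
    by (rule that[OF a(1)]) (use a(2) in \<open>simp add: dist_real_def abs_minus_commute\<close>)
qed

section \<open>Laws of Poisson random measures\<close>

lemma restrict_mem_prod_emb:
  assumes "J \<subseteq> I"
  shows "(\<lambda>i\<in>I. f i) \<in> prod_emb I (\<lambda>_. borel) J (Pi\<^sub>E J A) \<longleftrightarrow> (\<forall>i\<in>J. f i \<in> A i)"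
proof -
  have "restrict (\<lambda>i\<in>I. f i) J = restrict f J"
    using assms by (auto simp: restrict_def fun_eq_iff)
  then show ?thesis by (auto simp: prod_emb_def PiE_iff)
qed

lemma distr_PiM_eqI:
  fixes X :: "'i \<Rightarrow> 'a \<Rightarrow> 'c::topological_space" and X' :: "'i \<Rightarrow> 'b \<Rightarrow> 'c"
  assumes M: "prob_space M"
    and X: "\<And>i. i \<in> I \<Longrightarrow> X i \<in> borel_measurable M" and X': "\<And>i. i \<in> I \<Longrightarrow> X' i \<in> borel_measurable M'"
    and fin: "\<And>J. finite J \<Longrightarrow> J \<subseteq> I \<Longrightarrow>
      distr M (Pi\<^sub>M J (\<lambda>_. borel)) (\<lambda>\<omega>. \<lambda>i\<in>J. X i \<omega>) = distr M' (Pi\<^sub>M J (\<lambda>_. borel)) (\<lambda>\<omega>. \<lambda>i\<in>J. X' i \<omega>)"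
  shows "distr M (Pi\<^sub>M I (\<lambda>_. borel)) (\<lambda>\<omega>. \<lambda>i\<in>I. X i \<omega>) = distr M' (Pi\<^sub>M I (\<lambda>_. borel)) (\<lambda>\<omega>. \<lambda>i\<in>I. X' i \<omega>)"
proof (rule measure_eqI_PiM_infinite)
  interpret prob_space M by fact
  have mX: "(\<lambda>\<omega>. \<lambda>i\<in>J. X i \<omega>) \<in> M \<rightarrow>\<^sub>M Pi\<^sub>M J (\<lambda>_. borel)" if "J \<subseteq> I" for J
    using X that by (intro measurable_restrict) auto
  have mX': "(\<lambda>\<omega>. \<lambda>i\<in>J. X' i \<omega>) \<in> M' \<rightarrow>\<^sub>M Pi\<^sub>M J (\<lambda>_. borel)" if "J \<subseteq> I" for J
    using X' that by (intro measurable_restrict) auto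
  show "finite_measure (distr M (Pi\<^sub>M I (\<lambda>_. borel)) (\<lambda>\<omega>. \<lambda>i\<in>I. X i \<omega>))"
    by (rule finite_measure_distr[OF mX[OF order_refl]])
  fix A :: "'i \<Rightarrow> 'c set" and J assume J: "finite J" "J \<subseteq> I" and A: "\<And>i. i \<in> J \<Longrightarrow> A i \<in> sets borel"
  have PA: "Pi\<^sub>E J A \<in> sets (Pi\<^sub>M J (\<lambda>_. borel))" using J A by (intro sets_PiM_I_finite) auto
  have emb: "prod_emb I (\<lambda>_. borel) J (Pi\<^sub>E J A) \<in> sets (Pi\<^sub>M I (\<lambda>_. borel))"
    using J A by (intro sets_PiM_I) auto
  have eq1: "(\<lambda>\<omega>. \<lambda>i\<in>I. Y i \<omega>) -` prod_emb I (\<lambda>_. borel) J (Pi\<^sub>E J A) \<inter> S = (\<lambda>\<omega>. \<lambda>i\<in>J. Y i \<omega>) -` Pi\<^sub>E J A \<inter> S"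
    for Y :: "'i \<Rightarrow> 'a \<Rightarrow> 'c" and S
    by (auto simp: restrict_mem_prod_emb[OF J(2)] PiE_iff)
  have eq2: "(\<lambda>\<omega>. \<lambda>i\<in>I. Y i \<omega>) -` prod_emb I (\<lambda>_. borel) J (Pi\<^sub>E J A) \<inter> S = (\<lambda>\<omega>. \<lambda>i\<in>J. Y i \<omega>) -` Pi\<^sub>E J A \<inter> S"
    for Y :: "'i \<Rightarrow> 'b \<Rightarrow> 'c" and S
    by (auto simp: restrict_mem_prod_emb[OF J(2)] PiE_iff)
  show "emeasure (distr M (Pi\<^sub>M I (\<lambda>_. borel)) (\<lambda>\<omega>. \<lambda>i\<in>I. X i \<omega>)) (prod_emb I (\<lambda>_. borel) J (Pi\<^sub>E J A))
      = emeasure (distr M' (Pi\<^sub>M I (\<lambda>_. borel)) (\<lambda>\<omega>. \<lambda>i\<in>I. X' i \<omega>)) (prod_emb I (\<lambda>_. borel) J (Pi\<^sub>E J A))"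
    using arg_cong[OF fin[OF J], of "\<lambda>D. emeasure D (Pi\<^sub>E J A)"]
    by (simp add: emeasure_distr[OF mX PA] emeasure_distr[OF mX' PA] emeasure_distr[OF mX emb]
        emeasure_distr[OF mX' emb] J eq1 eq2)
qed simp_all

text \<open>Counts take values in \<open>ennreal\<close>, where infinity and non-integers are
  possible a priori. As the point masses at the integers already add up to 1, nothing is left
  elsewhere and the masses determine the measure.\<close>

lemma measure_eqI_ennreal_of_nat:
  fixes D D' :: "ennreal measure"
  assumes "prob_space D" "prob_space D'" and s: "sets D = sets borel" "sets D' = sets borel"
    and p: "\<And>k::nat. measure D {of_nat k} = p k" "\<And>k::nat. measure D' {of_nat k} = p k" and sum: "p sums 1"
  shows "D = D'"
proof -
  have inj: "of_nat k = (of_nat l :: ennreal) \<longleftrightarrow> k = l" for k l :: nat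
    by (simp add: ennreal_of_nat_eq_real_of_nat)
  have main: "emeasure E B = (\<Sum>k. if of_nat k \<in> B then ennreal (p k) else 0)"
    if E: "prob_space E" "sets E = sets borel" "\<And>k::nat. measure E {of_nat k} = p k" and B: "B \<in> sets borel"
    for E :: "ennreal measure" and B
  proof -
    interpret E: prob_space E by fact
    have pnn: "0 \<le> p k" for k using E(3)[of k] measure_nonneg by metis
    have point: "emeasure E (C \<inter> {of_nat k}) = (if of_nat k \<in> C then ennreal (p k) else 0)" for C k
      using E.emeasure_eq_measure[of "{of_nat k}"] E(3)[of k] by (cases "of_nat k \<in> C") auto
    have sC: "emeasure E (C \<inter> range of_nat) = (\<Sum>k. if of_nat k \<in> C then ennreal (p k) else 0)"
      if C: "C \<in> sets borel" for C
    proof -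
      have "(\<Sum>k. emeasure E (C \<inter> {of_nat k})) = emeasure E (\<Union>k. C \<inter> {of_nat k})"
      proof (rule suminf_emeasure)
        have "C \<inter> {of_nat k} \<in> sets borel" for k using C by (intro sets.Int) auto
        then show "range (\<lambda>k. C \<inter> {of_nat k}) \<subseteq> sets E" using E(2) by blast
        show "disjoint_family (\<lambda>k. C \<inter> {of_nat k})"
          unfolding disjoint_family_on_def using inj by blast
      qed
      also have "(\<Union>k. C \<inter> {of_nat k}) = C \<inter> range of_nat" by auto
      finally show ?thesis by (simp add: point)
    qed
    have r: "range (of_nat :: nat \<Rightarrow> ennreal) \<in> sets borel"
      by (rule sets.countable) simp_all
    have "emeasure E (range of_nat) = (\<Sum>k. ennreal (p k))"
      using sC[of UNIV] by simp
    also have "\<dots> = 1"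
      using sum pnn by (subst suminf_ennreal2) (auto simp: sums_iff)
    finally have "emeasure E (space E - range of_nat) = 0"
      using r E(2) E.emeasure_space_1 by (subst emeasure_compl) auto
    then have "emeasure E (B - range of_nat) = 0"
      using emeasure_mono[of "B - range of_nat" "space E - range of_nat" E] r E(2) sets_eq_imp_space_eq[OF E(2)]
      by auto
    moreover have "emeasure E B = emeasure E (B \<inter> range of_nat) + emeasure E (B - range of_nat)"
      using B r E(2) by (subst plus_emeasure) (auto simp: Int_Diff_Un)
    ultimately show ?thesis using sC[OF B] by simp
  qed
  show ?thesis
  proof (rule measure_eqI)
    show "sets D = sets D'" using s by simp
    fix B assume "B \<in> sets D"
    then have "B \<in> sets borel" using s by simp
    from main[OF assms(1) s(1) p(1) this] main[OF assms(2) s(2) p(2) this]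
    show "emeasure D B = emeasure D' B" by simp
  qed
qed

lemma poisson_marginal_cong:
  assumes M: "prob_space M" "prob_space M'"
    and N: "poisson_random_measure M \<mu> N" "poisson_random_measure M' \<mu> N'" and A: "A \<in> sets \<mu>"
  shows "distr M borel (\<lambda>\<omega>. emeasure (N \<omega>) A) = distr M' borel (\<lambda>\<omega>. emeasure (N' \<omega>) A)"
proof -
  interpret M: prob_space M by fact
  interpret M': prob_space M' by fact
  have mN: "(\<lambda>\<omega>. emeasure (N \<omega>) A) \<in> borel_measurable M" "(\<lambda>\<omega>. emeasure (N' \<omega>) A) \<in> borel_measurable M'"
    using N A by (auto simp: poisson_random_measure_def)
  show ?thesis
  proof (cases "emeasure \<mu> A = \<infinity>")
    case True
    then have ae: "AE \<omega> in M. emeasure (N \<omega>) A = \<infinity>" "AE \<omega> in M'. emeasure (N' \<omega>) A = \<infinity>"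
      using N A by (auto simp: poisson_random_measure_def)
    have "distr M borel (\<lambda>\<omega>. emeasure (N \<omega>) A) = distr M borel (\<lambda>\<omega>. \<infinity>)"
      by (rule distr_cong_AE) (use ae mN in auto)
    also have "\<dots> = return borel \<infinity>" by (rule M.distr_const) simp
    also have "\<dots> = distr M' borel (\<lambda>\<omega>. \<infinity>)" by (rule M'.distr_const[symmetric]) simp
    also have "\<dots> = distr M' borel (\<lambda>\<omega>. emeasure (N' \<omega>) A)"
      by (rule distr_cong_AE) (use ae mN in auto)
    finally show ?thesis .
  next
    case False
    define p where "p k = measure \<mu> A ^ k / fact k * exp (- measure \<mu> A)" for k
    have "(\<lambda>k. measure \<mu> A ^ k / fact k) sums exp (measure \<mu> A)"
      using exp_converges[of "measure \<mu> A"] by (simp add: divide_inverse mult.commute)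
    from sums_mult2[OF this, of "exp (- measure \<mu> A)"] have "p sums (exp (measure \<mu> A) * exp (- measure \<mu> A))"
      by (simp only: p_def[abs_def])
    then have "p sums 1" by (simp add: mult_exp_exp)
    moreover have "measure M {\<omega>\<in>space M. emeasure (N \<omega>) A = of_nat k} = p k"
      "measure M' {\<omega>\<in>space M'. emeasure (N' \<omega>) A = of_nat k} = p k" for k
      using N A False by (auto simp: poisson_random_measure_def p_def less_top)
    ultimately show ?thesis
      by (intro measure_eqI_ennreal_of_nat[of _ _ p] M.prob_space_distr M'.prob_space_distr mN)
        (simp_all add: measure_distr mN vimage_def Int_def conj_commute)
  qed
qed

lemma poisson_disjoint_cong:
  assumes M: "prob_space M" "prob_space M'"
    and N: "poisson_random_measure M \<mu> N" "poisson_random_measure M' \<mu> N'"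
    and B: "range B \<subseteq> sets \<mu>" "disjoint_family (B :: nat \<Rightarrow> _)"
  shows "distr M (Pi\<^sub>M UNIV (\<lambda>_. borel)) (\<lambda>\<omega>. \<lambda>i\<in>UNIV. emeasure (N \<omega>) (B i))
       = distr M' (Pi\<^sub>M UNIV (\<lambda>_. borel)) (\<lambda>\<omega>. \<lambda>i\<in>UNIV. emeasure (N' \<omega>) (B i))"
proof -
  have mN: "(\<lambda>\<omega>. emeasure (N \<omega>) (B i)) \<in> borel_measurable M" "(\<lambda>\<omega>. emeasure (N' \<omega>) (B i)) \<in> borel_measurable M'" for i
    using N B(1) by (auto simp: poisson_random_measure_def)
  have "prob_space.indep_vars M (\<lambda>_. borel) (\<lambda>i \<omega>. emeasure (N \<omega>) (B i)) UNIV"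
    "prob_space.indep_vars M' (\<lambda>_. borel) (\<lambda>i \<omega>. emeasure (N' \<omega>) (B i)) UNIV"
    using N B by (auto simp: poisson_random_measure_def)
  then show ?thesis
    using poisson_marginal_cong[OF M N, of "B _"] B(1) mN
    by (subst (asm) (1 2) prob_space.indep_vars_iff_distr_eq_PiM) (auto simp: M image_subset_iff)
qed

text \<open>The sets in K may overlap, whereas independence is postulated for disjoint ones. The
  atoms of the finite algebra generated by K are disjoint, and every count on K is a sum of counts
  on atoms. The list of atoms is padded with empty sets since independence is formulated for
  infinite sequences.\<close>

lemma poisson_finite_cong:
  assumes M: "prob_space M" "prob_space M'"
    and N: "poisson_random_measure M \<mu> N" "poisson_random_measure M' \<mu> N'"
    and K: "finite K" "K \<subseteq> sets \<mu>"
  shows "distr M (Pi\<^sub>M K (\<lambda>_. borel)) (\<lambda>\<omega>. \<lambda>A\<in>K. emeasure (N \<omega>) A)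
       = distr M' (Pi\<^sub>M K (\<lambda>_. borel)) (\<lambda>\<omega>. \<lambda>A\<in>K. emeasure (N' \<omega>) A)"
proof -
  define atom where "atom S = {x \<in> space \<mu>. \<forall>A\<in>K. x \<in> A \<longleftrightarrow> A \<in> S}" for S
  have atom: "atom S \<in> sets \<mu>" for S
    unfolding atom_def
  proof (rule sets.sets_Collect_finite_All[OF _ K(1)])
    fix A assume "A \<in> K"
    then have "{x \<in> space \<mu>. x \<in> A} \<in> sets \<mu>" using K(2) by auto
    then show "{x \<in> space \<mu>. x \<in> A \<longleftrightarrow> A \<in> S} \<in> sets \<mu>"
      by (cases "A \<in> S") (auto intro: sets.sets_Collect_neg)
  qed
  have "finite (Pow K)" using K by simp
  then obtain e where e: "bij_betw e {0..<card (Pow K)} (Pow K)"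
    using ex_bij_betw_nat_finite by blast
  define n where "n = card (Pow K)"
  define B where "B i = (if i < n then atom (e i) else {})" for i
  have B: "range B \<subseteq> sets \<mu>" using atom by (auto simp: B_def)
  have disj: "disjoint_family B"
    unfolding disjoint_family_on_def
  proof (intro ballI impI)
    fix i j :: nat assume ij: "i \<noteq> j"
    show "B i \<inter> B j = {}"
    proof (rule ccontr)
      assume "B i \<inter> B j \<noteq> {}"
      then obtain x where x: "x \<in> B i" "x \<in> B j" by blast
      then have ijn: "i < n" "j < n" by (auto simp: B_def split: if_splits)
      then have sub: "e i \<subseteq> K" "e j \<subseteq> K" using e by (auto simp: bij_betw_def n_def)
      have "e i = e j" using x ijn sub by (auto simp: B_def atom_def)
      then show False using e ijn ij by (auto simp: bij_betw_def inj_on_def n_def)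
    qed
  qed
  define I where "I A = {i. i < n \<and> A \<in> e i}" for A
  have I: "finite (I A)" for A by (simp add: I_def)
  have UN: "A = (\<Union>i\<in>I A. B i)" if A: "A \<in> K" for A
  proof
    show "(\<Union>i\<in>I A. B i) \<subseteq> A" using A by (auto simp: I_def B_def atom_def)
    show "A \<subseteq> (\<Union>i\<in>I A. B i)"
    proof
      fix x assume x: "x \<in> A"
      have "{C \<in> K. x \<in> C} \<in> e ` {0..<card (Pow K)}" using e by (auto simp: bij_betw_def)
      then obtain i where i: "i < n" "e i = {C \<in> K. x \<in> C}" by (auto simp: n_def)
      then have "i \<in> I A" "x \<in> B i"
        using x A sets.sets_into_space[of A \<mu>] K(2) by (auto simp: I_def B_def atom_def)
      then show "x \<in> (\<Union>i\<in>I A. B i)" by blast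
    qed
  qed
  have sum: "emeasure m A = (\<Sum>i\<in>I A. emeasure m (B i))" if "A \<in> K" "sets m = sets \<mu>" for A m
  proof -
    have "(\<Sum>i\<in>I A. emeasure m (B i)) = emeasure m (\<Union>i\<in>I A. B i)"
    proof (rule sum_emeasure)
      show "B ` I A \<subseteq> sets m" using B that(2) by blast
      show "disjoint_family_on B (I A)" using disj disjoint_family_on_mono by blast
    qed (rule I)
    then show ?thesis using UN[OF that(1)] by simp
  qed
  define g where "g v = (\<lambda>A\<in>K. \<Sum>i\<in>I A. v i)" for v :: "nat \<Rightarrow> ennreal"
  have g: "g \<in> Pi\<^sub>M UNIV (\<lambda>_. borel) \<rightarrow>\<^sub>M Pi\<^sub>M K (\<lambda>_. borel)"
    unfolding g_def by (intro measurable_restrict borel_measurable_sum measurable_component_singleton) auto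
  have law: "distr M0 (Pi\<^sub>M K (\<lambda>_. borel)) (\<lambda>\<omega>. \<lambda>A\<in>K. emeasure (N0 \<omega>) A)
      = distr (distr M0 (Pi\<^sub>M UNIV (\<lambda>_. borel)) (\<lambda>\<omega>. \<lambda>i\<in>UNIV. emeasure (N0 \<omega>) (B i))) (Pi\<^sub>M K (\<lambda>_. borel)) g"
    if N0: "poisson_random_measure M0 \<mu> N0" for M0 :: "'z measure" and N0
  proof -
    have "(\<lambda>\<omega>. \<lambda>i\<in>UNIV. emeasure (N0 \<omega>) (B i)) \<in> M0 \<rightarrow>\<^sub>M Pi\<^sub>M UNIV (\<lambda>_. borel)"
      using N0 B by (intro measurable_restrict) (auto simp: poisson_random_measure_def)
    then have "distr (distr M0 (Pi\<^sub>M UNIV (\<lambda>_. borel)) (\<lambda>\<omega>. \<lambda>i\<in>UNIV. emeasure (N0 \<omega>) (B i))) (Pi\<^sub>M K (\<lambda>_. borel)) g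
      = distr M0 (Pi\<^sub>M K (\<lambda>_. borel)) (g \<circ> (\<lambda>\<omega>. \<lambda>i\<in>UNIV. emeasure (N0 \<omega>) (B i)))"
      by (rule distr_distr[OF g])
    also have "\<dots> = distr M0 (Pi\<^sub>M K (\<lambda>_. borel)) (\<lambda>\<omega>. \<lambda>A\<in>K. emeasure (N0 \<omega>) A)"
      using N0 sum by (intro distr_cong) (auto simp: g_def poisson_random_measure_def fun_eq_iff restrict_def)
    finally show ?thesis by simp
  qed
  show ?thesis
    unfolding law[OF N(1)] law[OF N(2)] poisson_disjoint_cong[OF M N B disj] ..
qed

lemma poisson_law_cong:
  assumes M: "prob_space M" "prob_space M'"
    and N: "poisson_random_measure M \<mu> N" "poisson_random_measure M' \<mu> N'"
  shows "distr M (Pi\<^sub>M (sets \<mu>) (\<lambda>_. borel)) (\<lambda>\<omega>. \<lambda>A\<in>sets \<mu>. emeasure (N \<omega>) A)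
       = distr M' (Pi\<^sub>M (sets \<mu>) (\<lambda>_. borel)) (\<lambda>\<omega>. \<lambda>A\<in>sets \<mu>. emeasure (N' \<omega>) A)"
proof (rule distr_PiM_eqI[OF M(1)])
  show "(\<lambda>\<omega>. emeasure (N \<omega>) A) \<in> borel_measurable M" if "A \<in> sets \<mu>" for A
    using N(1) that by (auto simp: poisson_random_measure_def)
  show "(\<lambda>\<omega>. emeasure (N' \<omega>) A) \<in> borel_measurable M'" if "A \<in> sets \<mu>" for A
    using N(2) that by (auto simp: poisson_random_measure_def)
qed (rule poisson_finite_cong[OF M N])

section \<open>Integrals as measurable functionals of the integrating measure\<close>

lemma borel_measurable_sets_eq:
  "f \<in> borel_measurable \<mu> \<Longrightarrow> sets m = sets \<mu> \<Longrightarrow> f \<in> borel_measurable m"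
  by (simp cong: measurable_cong_sets)

text \<open>A single h has to serve all measures m at once: it expresses an integral against a
  random measure through the vector of its values on measurable sets, and the law of that vector is
  what \<open>poisson_law_cong\<close> controls. The induction over indicators, multiples, sums and
  monotone limits builds h and its measurability together.\<close>

lemma nn_integral_functional:
  assumes "f \<in> borel_measurable \<mu>"
  shows "\<exists>h\<in>borel_measurable (Pi\<^sub>M (sets \<mu>) (\<lambda>_. borel)).
    \<forall>m. sets m = sets \<mu> \<longrightarrow> (\<integral>\<^sup>+x. f x \<partial>m) = h (\<lambda>A\<in>sets \<mu>. emeasure m A)"
  using assms
proof (induction rule: borel_measurable_induct)
  case (cong f g)
  then obtain h where h: "h\<in>borel_measurable (Pi\<^sub>M (sets \<mu>) (\<lambda>_. borel))"
    "\<And>m. sets m = sets \<mu> \<Longrightarrow> (\<integral>\<^sup>+x. g x \<partial>m) = h (\<lambda>A\<in>sets \<mu>. emeasure m A)" by blast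
  moreover have "(\<integral>\<^sup>+x. f x \<partial>m) = (\<integral>\<^sup>+x. g x \<partial>m)" if "sets m = sets \<mu>" for m
    using cong(3) sets_eq_imp_space_eq[OF that] by (intro nn_integral_cong) auto
  ultimately show ?case by (intro bexI[of _ h]) (auto simp: restrict_def)
next
  case (set A)
  then show ?case
    by (intro bexI[of _ "\<lambda>w. w A"]) auto
next
  case (mult u c)
  then obtain h where h: "h\<in>borel_measurable (Pi\<^sub>M (sets \<mu>) (\<lambda>_. borel))"
    "\<And>m. sets m = sets \<mu> \<Longrightarrow> (\<integral>\<^sup>+x. u x \<partial>m) = h (\<lambda>A\<in>sets \<mu>. emeasure m A)" by blast
  show ?case
    using h mult(2)[THEN borel_measurable_sets_eq]
    by (intro bexI[of _ "\<lambda>w. c * h w"]) (auto simp: nn_integral_cmult restrict_def)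
next
  case (add u v)
  from add.IH(1) obtain h where h: "h\<in>borel_measurable (Pi\<^sub>M (sets \<mu>) (\<lambda>_. borel))"
    "\<And>m. sets m = sets \<mu> \<Longrightarrow> (\<integral>\<^sup>+x. u x \<partial>m) = h (\<lambda>A\<in>sets \<mu>. emeasure m A)" by blast
  from add.IH(2) obtain h' where h': "h'\<in>borel_measurable (Pi\<^sub>M (sets \<mu>) (\<lambda>_. borel))"
    "\<And>m. sets m = sets \<mu> \<Longrightarrow> (\<integral>\<^sup>+x. v x \<partial>m) = h' (\<lambda>A\<in>sets \<mu>. emeasure m A)" by blast
  show ?case
    using h h' add.hyps(1,3)[THEN borel_measurable_sets_eq]
    by (intro bexI[of _ "\<lambda>w. h' w + h w"]) (auto simp: nn_integral_add restrict_def)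
next
  case (seq U)
  then have "\<forall>i. \<exists>h. h\<in>borel_measurable (Pi\<^sub>M (sets \<mu>) (\<lambda>_. borel)) \<and>
    (\<forall>m. sets m = sets \<mu> \<longrightarrow> (\<integral>\<^sup>+x. U i x \<partial>m) = h (\<lambda>A\<in>sets \<mu>. emeasure m A))" by blast
  then obtain h where h: "\<And>i. h i\<in>borel_measurable (Pi\<^sub>M (sets \<mu>) (\<lambda>_. borel))"
    "\<And>i m. sets m = sets \<mu> \<Longrightarrow> (\<integral>\<^sup>+x. U i x \<partial>m) = h i (\<lambda>A\<in>sets \<mu>. emeasure m A)" by metis
  have "(\<integral>\<^sup>+x. (SUP i. U i) x \<partial>m) = (SUP i. h i (\<lambda>A\<in>sets \<mu>. emeasure m A))" if m: "sets m = sets \<mu>" for m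
  proof -
    have "(\<integral>\<^sup>+x. (SUP i. U i) x \<partial>m) = (\<integral>\<^sup>+x. (SUP i. U i x) \<partial>m)" by (simp add: image_comp comp_def)
    also have "\<dots> = (SUP i. \<integral>\<^sup>+x. U i x \<partial>m)"
      using seq.hyps(3) borel_measurable_sets_eq[OF seq.hyps(1) m] by (rule nn_integral_monotone_convergence_SUP)
    finally show ?thesis using h(2)[OF m] by simp
  qed
  then show ?case using h(1) by (intro bexI[of _ "\<lambda>w. SUP i. h i w"]) (auto simp: restrict_def)
qed

lemma lebesgue_integral_functional:
  fixes f :: "'a \<Rightarrow> real"
  assumes f: "f \<in> borel_measurable \<mu>"
  obtains h where "h \<in> borel_measurable (Pi\<^sub>M (sets \<mu>) (\<lambda>_. borel))"
    "\<And>m. sets m = sets \<mu> \<Longrightarrow> (LINT x|m. f x) = h (\<lambda>A\<in>sets \<mu>. emeasure m A)"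
proof -
  have "\<exists>h\<in>borel_measurable (Pi\<^sub>M (sets \<mu>) (\<lambda>_. borel)).
    \<forall>m. sets m = sets \<mu> \<longrightarrow> (\<integral>\<^sup>+x. ennreal (norm (f x)) \<partial>m) = h (\<lambda>A\<in>sets \<mu>. emeasure m A)"
    using f by (intro nn_integral_functional) auto
  moreover have "\<exists>h\<in>borel_measurable (Pi\<^sub>M (sets \<mu>) (\<lambda>_. borel)).
    \<forall>m. sets m = sets \<mu> \<longrightarrow> (\<integral>\<^sup>+x. ennreal (f x) \<partial>m) = h (\<lambda>A\<in>sets \<mu>. emeasure m A)"
    using f by (intro nn_integral_functional) auto
  moreover have "\<exists>h\<in>borel_measurable (Pi\<^sub>M (sets \<mu>) (\<lambda>_. borel)).
    \<forall>m. sets m = sets \<mu> \<longrightarrow> (\<integral>\<^sup>+x. ennreal (- f x) \<partial>m) = h (\<lambda>A\<in>sets \<mu>. emeasure m A)"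
    using f by (intro nn_integral_functional) auto
  ultimately obtain h0 h1 h2 where
    h0: "h0 \<in> borel_measurable (Pi\<^sub>M (sets \<mu>) (\<lambda>_. borel))"
      "\<And>m. sets m = sets \<mu> \<Longrightarrow> (\<integral>\<^sup>+x. ennreal (norm (f x)) \<partial>m) = h0 (\<lambda>A\<in>sets \<mu>. emeasure m A)" and
    h1: "h1 \<in> borel_measurable (Pi\<^sub>M (sets \<mu>) (\<lambda>_. borel))"
      "\<And>m. sets m = sets \<mu> \<Longrightarrow> (\<integral>\<^sup>+x. ennreal (f x) \<partial>m) = h1 (\<lambda>A\<in>sets \<mu>. emeasure m A)" and
    h2: "h2 \<in> borel_measurable (Pi\<^sub>M (sets \<mu>) (\<lambda>_. borel))"
      "\<And>m. sets m = sets \<mu> \<Longrightarrow> (\<integral>\<^sup>+x. ennreal (- f x) \<partial>m) = h2 (\<lambda>A\<in>sets \<mu>. emeasure m A)"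
    by blast
  \<comment> \<open>The guard reproduces the default value 0 of the Bochner integral for
    non-integrable f, so that the identity holds for every m.\<close>
  define h where "h w = (if h0 w < \<infinity> then enn2real (h1 w) - enn2real (h2 w) else 0)" for w
  show thesis
  proof (rule that[of h])
    show "h \<in> borel_measurable (Pi\<^sub>M (sets \<mu>) (\<lambda>_. borel))"
      unfolding h_def using h0(1) h1(1) h2(1) by measurable
    fix m assume m: "sets m = sets \<mu>"
    have fm: "f \<in> borel_measurable m" by (rule borel_measurable_sets_eq[OF f m])
    show "(LINT x|m. f x) = h (\<lambda>A\<in>sets \<mu>. emeasure m A)"
    proof (cases "integrable m f")
      case True
      then have "(\<integral>\<^sup>+x. ennreal (norm (f x)) \<partial>m) < \<infinity>" by (simp add: integrable_iff_bounded)
      then show ?thesis using True h0(2)[OF m] h1(2)[OF m] h2(2)[OF m]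
        by (simp add: real_lebesgue_integral_def h_def)
    next
      case False
      then have "\<not> (\<integral>\<^sup>+x. ennreal (norm (f x)) \<partial>m) < \<infinity>" using fm by (simp add: integrable_iff_bounded)
      then show ?thesis using False h0(2)[OF m]
        by (simp add: not_integrable_integral_eq h_def)
    qed
  qed
qed

text \<open>One sequence of indices for both convergences, so that afterwards one and the same limit
  functional represents Z and Z'. The indices are not claimed to increase: Borel-Cantelli uses only
  that the k-th exceptional probabilities are below \<open>(1/2)^k\<close>.\<close>

lemma common_subsequence_AE:
  assumes M: "prob_space M"
    and X: "\<And>k. X k \<in> borel_measurable M" "Z \<in> borel_measurable M"
      "\<And>e. 0 < e \<Longrightarrow> (\<lambda>k. measure M {\<omega>\<in>space M. e \<le> \<bar>X k \<omega> - Z \<omega>\<bar>}) \<longlonglongrightarrow> 0"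
    and X': "\<And>k. X' k \<in> borel_measurable M" "Z' \<in> borel_measurable M"
      "\<And>e. 0 < e \<Longrightarrow> (\<lambda>k. measure M {\<omega>\<in>space M. e \<le> \<bar>X' k \<omega> - Z' \<omega>\<bar>}) \<longlonglongrightarrow> (0::real)"
  obtains r :: "nat \<Rightarrow> nat" where
    "AE \<omega> in M. (\<lambda>k. X (r k) \<omega>) \<longlonglongrightarrow> (Z \<omega> :: real)" "AE \<omega> in M. (\<lambda>k. X' (r k) \<omega>) \<longlonglongrightarrow> (Z' \<omega> :: real)"
proof -
  interpret prob_space M by fact
  have "\<exists>n. measure M {\<omega>\<in>space M. (1/2)^k \<le> \<bar>X n \<omega> - Z \<omega>\<bar>} < (1/2)^k \<and>
      measure M {\<omega>\<in>space M. (1/2)^k \<le> \<bar>X' n \<omega> - Z' \<omega>\<bar>} < (1/2)^k" for k :: nat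
  proof -
    have p: "(0::real) < (1/2)^k" by simp
    have "\<forall>\<^sub>F n in sequentially. measure M {\<omega>\<in>space M. (1/2)^k \<le> \<bar>X n \<omega> - Z \<omega>\<bar>} < (1/2)^k \<and>
      measure M {\<omega>\<in>space M. (1/2)^k \<le> \<bar>X' n \<omega> - Z' \<omega>\<bar>} < (1/2)^k"
      by (intro eventually_conj order_tendstoD(2)[OF X(3)[OF p] p] order_tendstoD(2)[OF X'(3)[OF p] p])
    then show ?thesis by (auto simp: eventually_sequentially)
  qed
  from choice[OF allI[OF this]] obtain r where
    "\<forall>k. measure M {\<omega>\<in>space M. (1/2)^k \<le> \<bar>X (r k) \<omega> - Z \<omega>\<bar>} < (1/2)^k \<and>
      measure M {\<omega>\<in>space M. (1/2)^k \<le> \<bar>X' (r k) \<omega> - Z' \<omega>\<bar>} < (1/2)^k" ..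
  then have r: "\<And>k. measure M {\<omega>\<in>space M. (1/2)^k \<le> \<bar>X (r k) \<omega> - Z \<omega>\<bar>} < (1/2)^k"
      "\<And>k. measure M {\<omega>\<in>space M. (1/2)^k \<le> \<bar>X' (r k) \<omega> - Z' \<omega>\<bar>} < (1/2)^k"
    by blast+
  have main: "AE \<omega> in M. (\<lambda>k. Y (r k) \<omega>) \<longlonglongrightarrow> W \<omega>"
    if Y[measurable]: "\<And>k. Y k \<in> borel_measurable M" "W \<in> borel_measurable M"
      and r: "\<And>k. measure M {\<omega>\<in>space M. (1/2)^k \<le> \<bar>Y (r k) \<omega> - W \<omega>\<bar>} < (1/2)^k"
    for Y and W :: "'a \<Rightarrow> real"
  proof -
    have "AE \<omega> in M. \<forall>\<^sub>F k in sequentially. \<omega> \<in> space M - {\<omega>\<in>space M. (1/2)^k \<le> \<bar>Y (r k) \<omega> - W \<omega>\<bar>}"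
    proof (rule borel_cantelli_AE1)
      show "summable (\<lambda>k. measure M {\<omega>\<in>space M. (1/2)^k \<le> \<bar>Y (r k) \<omega> - W \<omega>\<bar>})"
      proof (rule summable_comparison_test'[OF summable_geometric[of "1/2::real"], of 0])
        show "norm (measure M {\<omega>\<in>space M. (1/2)^k \<le> \<bar>Y (r k) \<omega> - W \<omega>\<bar>}) \<le> (1/2)^k" for k
          unfolding real_norm_def abs_of_nonneg[OF measure_nonneg] by (rule less_imp_le[OF r])
      qed simp
    qed (auto simp: emeasure_eq_measure)
    then show ?thesis
    proof (rule AE_mp, intro AE_I2 impI)
      fix \<omega> assume "\<omega> \<in> space M"
        and ev: "\<forall>\<^sub>F k in sequentially. \<omega> \<in> space M - {\<omega>\<in>space M. (1/2)^k \<le> \<bar>Y (r k) \<omega> - W \<omega>\<bar>}"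
      have "(\<lambda>k. Y (r k) \<omega> - W \<omega>) \<longlonglongrightarrow> 0"
      proof (rule Lim_null_comparison)
        show "\<forall>\<^sub>F k in sequentially. norm (Y (r k) \<omega> - W \<omega>) \<le> (1/2)^k"
          using ev
        proof eventually_elim
          case (elim k)
          then have "\<not> (1/2)^k \<le> \<bar>Y (r k) \<omega> - W \<omega>\<bar>" using \<open>\<omega> \<in> space M\<close> by blast
          then show ?case unfolding real_norm_def not_le by (rule less_imp_le)
        qed
      qed (rule LIMSEQ_realpow_zero, auto)
      then show "(\<lambda>k. Y (r k) \<omega>) \<longlonglongrightarrow> W \<omega>" by (simp add: LIM_zero_iff)
    qed
  qed
  show thesis
    by (rule that[of r]) (rule main[OF X(1,2) r(1)] main[OF X'(1,2) r(2)])+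
qed

text \<open>Below \<alpha> = 1 the set does not depend on \<delta>, so that a limit in probability
  over \<delta> amounts to an almost sure identity with the full jump integral.\<close>

definition jump_truncation :: "real \<Rightarrow> real \<Rightarrow> real set" where
  "jump_truncation \<alpha> \<delta> = (if \<alpha> < 1 then - {0} else {z. \<delta> < \<bar>z\<bar>})"

definition truncated_mean :: "real \<Rightarrow> real \<Rightarrow> real \<Rightarrow> real \<Rightarrow> real" where
  "truncated_mean \<alpha> ap am \<delta> =
     (if 1 < \<alpha> then LINT z : {z. \<delta> < \<bar>z\<bar>} | stable_levy_measure \<alpha> ap am. z else 0)"

text \<open>A description of \<open>L\<close> that covers the three ranges of \<open>\<alpha>\<close> at once and is compatible with scaling.
  For \<open>\<alpha> = 1\<close> the cut at \<open>\<bar>z\<bar> = 1\<close> is not scale invariant, but it disappears because the compensator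
  vanishes by symmetry.\<close>

definition levy_limit :: "'a measure \<Rightarrow> real \<Rightarrow> real \<Rightarrow> real \<Rightarrow> ('a \<Rightarrow> (real \<times> real) measure) \<Rightarrow> (real \<Rightarrow> 'a \<Rightarrow> real) \<Rightarrow> bool" where
  "levy_limit M \<alpha> ap am N L \<longleftrightarrow> (\<forall>t\<ge>0. \<forall>e>0.
     ((\<lambda>\<delta>. measure M {\<omega>\<in>space M. e \<le> \<bar>jump_integral N t (jump_truncation \<alpha> \<delta>) \<omega>
        - t * truncated_mean \<alpha> ap am \<delta> - L t \<omega>\<bar>}) \<longlongrightarrow> 0) (at_right 0))"

lemma sets_stable_levy_measure [measurable_cong]: "sets (stable_levy_measure \<alpha> ap am) = sets borel"
  by (simp add: stable_levy_measure_def)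

lemma sets_jump_intensity [measurable_cong]:
  "sets (jump_intensity (stable_levy_measure \<alpha> ap am)) = sets (borel \<Otimes>\<^sub>M borel)"
  unfolding jump_intensity_def by (intro sets_pair_measure_cong) (simp_all add: sets_stable_levy_measure)

lemma jump_truncation_sets [measurable]: "jump_truncation \<alpha> \<delta> \<in> sets borel"
proof -
  have "{z::real. \<delta> < \<bar>z\<bar>} \<in> sets borel" by measurable
  then show ?thesis by (auto simp: jump_truncation_def)
qed

lemma jump_integral_functional:
  assumes A: "A \<in> sets borel" and \<mu>: "sets \<mu> = sets (borel \<Otimes>\<^sub>M borel)"
  shows "\<exists>h. h \<in> borel_measurable (Pi\<^sub>M (sets \<mu>) (\<lambda>_. borel)) \<and>
    (\<forall>N \<omega>. sets (N \<omega>) = sets \<mu> \<longrightarrow> jump_integral N t A (\<omega>::'a) = h (\<lambda>A\<in>sets \<mu>. emeasure (N \<omega>) A))"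
proof -
  have "{0<..t} \<times> A \<in> sets (borel \<Otimes>\<^sub>M borel)" using A by auto
  then have "(\<lambda>p. indicator ({0<..t} \<times> A) p *\<^sub>R snd p :: real) \<in> borel_measurable (borel \<Otimes>\<^sub>M borel)"
    by measurable
  then have "(\<lambda>p. indicator ({0<..t} \<times> A) p *\<^sub>R snd p :: real) \<in> borel_measurable \<mu>"
    using \<mu> by (simp cong: measurable_cong_sets)
  then obtain h where h: "h \<in> borel_measurable (Pi\<^sub>M (sets \<mu>) (\<lambda>_. borel))"
    "\<And>m. sets m = sets \<mu> \<Longrightarrow> (LINT p|m. indicator ({0<..t} \<times> A) p *\<^sub>R snd p) = h (\<lambda>A\<in>sets \<mu>. emeasure m A)"
    by (rule lebesgue_integral_functional) (rule that)
  show ?thesis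
    by (intro exI[of _ h] conjI h(1) allI impI)
      (simp only: jump_integral_def set_lebesgue_integral_def h(2))
qed

lemma poisson_sets:
  assumes "poisson_random_measure M \<mu> N" "\<omega> \<in> space M"
  shows "sets (N \<omega>) = sets \<mu>"
  by (rule bspec[OF assms(1)[unfolded poisson_random_measure_def, THEN conjunct1] assms(2)])

lemma poisson_measurable:
  assumes "poisson_random_measure M \<mu> N" "A \<in> sets \<mu>"
  shows "(\<lambda>\<omega>. emeasure (N \<omega>) A) \<in> borel_measurable M"
  by (rule bspec[OF assms(1)[unfolded poisson_random_measure_def, THEN conjunct2, THEN conjunct1] assms(2)])

lemma poisson_evaluation_measurable:
  assumes "poisson_random_measure M \<mu> N"
  shows "(\<lambda>\<omega>. \<lambda>A\<in>sets \<mu>. emeasure (N \<omega>) A) \<in> M \<rightarrow>\<^sub>M Pi\<^sub>M (sets \<mu>) (\<lambda>_. borel)"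
  by (rule measurable_restrict) (rule poisson_measurable[OF assms])

lemma jump_integral_measurable:
  fixes M :: "'a measure"
  assumes N: "poisson_random_measure M \<mu> N" and \<mu>: "sets \<mu> = sets (borel \<Otimes>\<^sub>M borel)" and A: "A \<in> sets borel"
  shows "jump_integral N t A \<in> borel_measurable M"
proof -
  from jump_integral_functional[OF A \<mu>]
  obtain h where "h \<in> borel_measurable (Pi\<^sub>M (sets \<mu>) (\<lambda>_. borel)) \<and>
    (\<forall>N \<omega>. sets (N \<omega>) = sets \<mu> \<longrightarrow> jump_integral N t A (\<omega>::'a) = h (\<lambda>A\<in>sets \<mu>. emeasure (N \<omega>) A))" ..
  then have h: "h \<in> borel_measurable (Pi\<^sub>M (sets \<mu>) (\<lambda>_. borel))"
    "\<And>N \<omega>. sets (N \<omega>) = sets \<mu> \<Longrightarrow> jump_integral N t A (\<omega>::'a) = h (\<lambda>A\<in>sets \<mu>. emeasure (N \<omega>) A)"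
    by blast+
  have "(\<lambda>\<omega>. h (\<lambda>A\<in>sets \<mu>. emeasure (N \<omega>) A)) \<in> borel_measurable M"
    by (rule measurable_compose[OF poisson_evaluation_measurable[OF N] h(1)])
  then show ?thesis
    by (rule measurable_cong[THEN iffD2, rotated]) (rule h(2)[OF poisson_sets[OF N]])
qed

text \<open>For each t, both processes are almost surely the same measurable function
  \<open>G t\<close> of the evaluation vector of their own Poisson measure, and the two vectors have
  the same law. \<open>G t\<close> is the pathwise limit of compensated truncated jump integrals
  along a common subsequence.\<close>

lemma levy_limit_law_unique:
  fixes M :: "'a measure" and \<alpha> ap am :: real
  defines "\<mu> \<equiv> jump_intensity (stable_levy_measure \<alpha> ap am)"
  assumes M: "prob_space M"
    and N: "poisson_random_measure M \<mu> N" "poisson_random_measure M \<mu> N'"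
    and L: "\<And>t. 0 \<le> t \<Longrightarrow> L t \<in> borel_measurable M" "\<And>t. 0 \<le> t \<Longrightarrow> L' t \<in> borel_measurable M"
    and lim: "levy_limit M \<alpha> ap am N L" "levy_limit M \<alpha> ap am N' L'"
  shows "distr M (Pi\<^sub>M {0..} (\<lambda>_. borel)) (\<lambda>\<omega>. \<lambda>t\<in>{0..}. L t \<omega>) = distr M (Pi\<^sub>M {0..} (\<lambda>_. borel)) (\<lambda>\<omega>. \<lambda>t\<in>{0..}. L' t \<omega>)"
proof -
  interpret prob_space M by fact
  have s: "sets \<mu> = sets (borel \<Otimes>\<^sub>M borel)" by (simp add: \<mu>_def sets_jump_intensity)
  let ?ev = "\<lambda>N \<omega>. (\<lambda>A\<in>sets \<mu>. emeasure (N \<omega>) A)"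
  have "\<exists>G. G \<in> borel_measurable (Pi\<^sub>M (sets \<mu>) (\<lambda>_. borel)) \<and>
      (AE \<omega> in M. L t \<omega> = G (?ev N \<omega>)) \<and> (AE \<omega> in M. L' t \<omega> = G (?ev N' \<omega>))" if t: "0 \<le> t" for t
  proof -
    define \<delta> where "\<delta> k = inverse (real (Suc k))" for k
    have \<delta>: "filterlim \<delta> (at_right 0) sequentially"
      unfolding \<delta>_def filterlim_at using LIMSEQ_inverse_real_of_nat by (auto simp del: of_nat_Suc)
    from choice[OF allI[OF jump_integral_functional[OF jump_truncation_sets s]]]
    obtain h where "\<forall>k. h k \<in> borel_measurable (Pi\<^sub>M (sets \<mu>) (\<lambda>_. borel)) \<and>
      (\<forall>N \<omega>. sets (N \<omega>) = sets \<mu> \<longrightarrow> jump_integral N t (jump_truncation \<alpha> (\<delta> k)) (\<omega>::'a) = h k (?ev N \<omega>))" ..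
    then have h: "\<And>k. h k \<in> borel_measurable (Pi\<^sub>M (sets \<mu>) (\<lambda>_. borel))"
      "\<And>k N \<omega>. sets (N \<omega>) = sets \<mu> \<Longrightarrow> jump_integral N t (jump_truncation \<alpha> (\<delta> k)) (\<omega>::'a) = h k (?ev N \<omega>)"
      by blast+
    define J where "J N k \<omega> = jump_integral N t (jump_truncation \<alpha> (\<delta> k)) \<omega> - t * truncated_mean \<alpha> ap am (\<delta> k)"
      for N :: "'a \<Rightarrow> (real \<times> real) measure" and k \<omega>
    have Jm: "J N k \<in> borel_measurable M" "J N' k \<in> borel_measurable M" for k
      unfolding J_def
      using jump_integral_measurable[OF N(1) s jump_truncation_sets, of t \<alpha> "\<delta> k"]
        jump_integral_measurable[OF N(2) s jump_truncation_sets, of t \<alpha> "\<delta> k"]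
      by (auto intro!: borel_measurable_diff)
    have lims: "(\<lambda>k. measure M {\<omega>\<in>space M. e \<le> \<bar>J N k \<omega> - L t \<omega>\<bar>}) \<longlonglongrightarrow> 0"
      "(\<lambda>k. measure M {\<omega>\<in>space M. e \<le> \<bar>J N' k \<omega> - L' t \<omega>\<bar>}) \<longlonglongrightarrow> 0" if "0 < e" for e
      unfolding J_def using lim that t
      by (auto simp: levy_limit_def intro: filterlim_compose[OF _ \<delta>])
    obtain r :: "nat \<Rightarrow> nat" where r:
      "AE \<omega> in M. (\<lambda>k. J N (r k) \<omega>) \<longlonglongrightarrow> L t \<omega>" "AE \<omega> in M. (\<lambda>k. J N' (r k) \<omega>) \<longlonglongrightarrow> L' t \<omega>"
      using common_subsequence_AE[OF M Jm(1) L(1)[OF t] lims(1) Jm(2) L(2)[OF t] lims(2)] by blast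
    \<comment> \<open>\<open>lim\<close> is total, so G is a measurable function on the whole
      product space, including vectors where the sequence diverges.\<close>
    define G where "G w = lim (\<lambda>k. h (r k) w - t * truncated_mean \<alpha> ap am (\<delta> (r k)))" for w
    have G: "G \<in> borel_measurable (Pi\<^sub>M (sets \<mu>) (\<lambda>_. borel))"
      unfolding G_def using h(1) by (intro borel_measurable_lim_metric borel_measurable_diff) auto
    have J: "J N0 k \<omega> = h k (?ev N0 \<omega>) - t * truncated_mean \<alpha> ap am (\<delta> k)"
      if "poisson_random_measure M \<mu> N0" "\<omega> \<in> space M" for N0 k \<omega>
      unfolding J_def h(2)[of N0 \<omega>, OF poisson_sets[OF that]] ..
    have "AE \<omega> in M. L t \<omega> = G (?ev N \<omega>)"
      using r(1) by (rule AE_mp) (intro AE_I2 impI, drule limI, simp add: G_def J[OF N(1)])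
    moreover have "AE \<omega> in M. L' t \<omega> = G (?ev N' \<omega>)"
      using r(2) by (rule AE_mp) (intro AE_I2 impI, drule limI, simp add: G_def J[OF N(2)])
    ultimately show ?thesis using G by blast
  qed
  then have "\<forall>t. \<exists>G. 0 \<le> t \<longrightarrow> G \<in> borel_measurable (Pi\<^sub>M (sets \<mu>) (\<lambda>_. borel)) \<and>
      (AE \<omega> in M. L t \<omega> = G (?ev N \<omega>)) \<and> (AE \<omega> in M. L' t \<omega> = G (?ev N' \<omega>))" by blast
  from choice[OF this] obtain G where "\<forall>t. 0 \<le> t \<longrightarrow> G t \<in> borel_measurable (Pi\<^sub>M (sets \<mu>) (\<lambda>_. borel)) \<and>
      (AE \<omega> in M. L t \<omega> = G t (?ev N \<omega>)) \<and> (AE \<omega> in M. L' t \<omega> = G t (?ev N' \<omega>))" ..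
  then have G: "\<And>t. 0 \<le> t \<Longrightarrow> G t \<in> borel_measurable (Pi\<^sub>M (sets \<mu>) (\<lambda>_. borel))"
      "\<And>t. 0 \<le> t \<Longrightarrow> AE \<omega> in M. L t \<omega> = G t (?ev N \<omega>)" "\<And>t. 0 \<le> t \<Longrightarrow> AE \<omega> in M. L' t \<omega> = G t (?ev N' \<omega>)"
    by blast+
  show ?thesis
  proof (rule distr_PiM_eqI[OF M])
    fix J :: "real set" assume J: "finite J" "J \<subseteq> {0..}"
    have GJ: "(\<lambda>w. \<lambda>t\<in>J. G t w) \<in> Pi\<^sub>M (sets \<mu>) (\<lambda>_. borel) \<rightarrow>\<^sub>M Pi\<^sub>M J (\<lambda>_. borel)"
      using G(1) J by (intro measurable_restrict) auto
    have step: "distr M (Pi\<^sub>M J (\<lambda>_. borel)) (\<lambda>\<omega>. \<lambda>t\<in>J. K t \<omega>)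
       = distr (distr M (Pi\<^sub>M (sets \<mu>) (\<lambda>_. borel)) (?ev N0)) (Pi\<^sub>M J (\<lambda>_. borel)) (\<lambda>w. \<lambda>t\<in>J. G t w)"
      if N0: "poisson_random_measure M \<mu> N0" and K: "\<And>t. 0 \<le> t \<Longrightarrow> K t \<in> borel_measurable M"
        "\<And>t. 0 \<le> t \<Longrightarrow> AE \<omega> in M. K t \<omega> = G t (?ev N0 \<omega>)" for N0 K
    proof -
      have "AE \<omega> in M. \<forall>t\<in>J. K t \<omega> = G t (?ev N0 \<omega>)"
        using K(2) J by (intro AE_finite_allI) auto
      then have "AE \<omega> in M. (\<lambda>t\<in>J. K t \<omega>) = (\<lambda>t\<in>J. G t (?ev N0 \<omega>))"
        by (rule AE_mp) (intro AE_I2 impI restrict_ext, blast)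
      then have "distr M (Pi\<^sub>M J (\<lambda>_. borel)) (\<lambda>\<omega>. \<lambda>t\<in>J. K t \<omega>) = distr M (Pi\<^sub>M J (\<lambda>_. borel)) (\<lambda>\<omega>. \<lambda>t\<in>J. G t (?ev N0 \<omega>))"
      proof (rule distr_cong_AE[OF refl refl])
        show "(\<lambda>\<omega>. \<lambda>t\<in>J. K t \<omega>) \<in> M \<rightarrow>\<^sub>M Pi\<^sub>M J (\<lambda>_. borel)"
          using K(1) J by (intro measurable_restrict) auto
        show "(\<lambda>\<omega>. \<lambda>t\<in>J. G t (?ev N0 \<omega>)) \<in> M \<rightarrow>\<^sub>M Pi\<^sub>M J (\<lambda>_. borel)"
          by (rule measurable_compose[OF poisson_evaluation_measurable[OF N0] GJ])
      qed
      also have "\<dots> = distr (distr M (Pi\<^sub>M (sets \<mu>) (\<lambda>_. borel)) (?ev N0)) (Pi\<^sub>M J (\<lambda>_. borel)) (\<lambda>w. \<lambda>t\<in>J. G t w)"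
        by (subst distr_distr[OF GJ poisson_evaluation_measurable[OF N0]]) (simp add: comp_def)
      finally show ?thesis .
    qed
    show "distr M (Pi\<^sub>M J (\<lambda>_. borel)) (\<lambda>\<omega>. \<lambda>i\<in>J. L i \<omega>) = distr M (Pi\<^sub>M J (\<lambda>_. borel)) (\<lambda>\<omega>. \<lambda>i\<in>J. L' i \<omega>)"
      by (simp only: step[OF N(1) L(1) G(2)] step[OF N(2) L(2) G(3)] poisson_law_cong[OF M M N])
  qed (use L in auto)
qed

section \<open>Self-similarity of stable Levy processes\<close>

definition stable_density :: "real \<Rightarrow> real \<Rightarrow> real \<Rightarrow> real \<Rightarrow> real" where
  "stable_density \<alpha> ap am z = \<bar>z\<bar> powr (-1 - \<alpha>) * (ap * indicator {0<..} z + am * indicator {..<0} z)"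

lemma stable_levy_measure_eq: "stable_levy_measure \<alpha> ap am = density lborel (\<lambda>z. ennreal (stable_density \<alpha> ap am z))"
  by (simp add: stable_levy_measure_def stable_density_def)

lemma stable_density_measurable [measurable]: "stable_density \<alpha> ap am \<in> borel_measurable borel"
  unfolding stable_density_def by measurable

lemma stable_density_nonneg: "0 \<le> ap \<Longrightarrow> 0 \<le> am \<Longrightarrow> 0 \<le> stable_density \<alpha> ap am z"
  by (auto simp: stable_density_def)

lemma stable_density_scale:
  assumes "0 < c" shows "stable_density \<alpha> ap am (c * z) = c powr (-1 - \<alpha>) * stable_density \<alpha> ap am z"
proof -
  have "\<bar>c * z\<bar> powr (-1 - \<alpha>) = c powr (-1 - \<alpha>) * \<bar>z\<bar> powr (-1 - \<alpha>)"
    using assms by (simp add: abs_mult powr_mult)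
  moreover have "indicator {0<..} (c * z) = (indicator {0<..} z :: real)" "indicator {..<0} (c * z) = (indicator {..<0} z :: real)"
    using assms by (auto simp: indicator_def zero_less_mult_iff mult_less_0_iff)
  ultimately show ?thesis by (simp add: stable_density_def)
qed

lemma sigma_finite_stable: "sigma_finite_measure (stable_levy_measure \<alpha> ap am)"
  unfolding stable_levy_measure_eq
  by (subst sigma_finite_measure.sigma_finite_iff_density_finite[OF sigma_finite_lborel]) auto

lemma emeasure_jump_intensity:
  assumes A: "A \<in> sets (borel \<Otimes>\<^sub>M borel)"
  shows "emeasure (jump_intensity (stable_levy_measure \<alpha> ap am)) A =
    (\<integral>\<^sup>+s. indicator {0..} s * (\<integral>\<^sup>+z. ennreal (stable_density \<alpha> ap am z) * indicator A (s, z) \<partial>lborel) \<partial>lborel)"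
proof -
  interpret sigma_finite_measure "stable_levy_measure \<alpha> ap am" by (rule sigma_finite_stable)
  have A'[measurable]: "A \<in> sets (borel \<Otimes>\<^sub>M borel)" by fact
  have "A \<in> sets (density lborel (indicator {0..}) \<Otimes>\<^sub>M stable_levy_measure \<alpha> ap am)"
    using A sets_jump_intensity[of \<alpha> ap am] by (simp add: jump_intensity_def)
  then have "emeasure (jump_intensity (stable_levy_measure \<alpha> ap am)) A
      = (\<integral>\<^sup>+ s. \<integral>\<^sup>+ z. indicator A (s, z) \<partial>stable_levy_measure \<alpha> ap am \<partial>density lborel (indicator {0..}))"
    unfolding jump_intensity_def by (rule emeasure_pair_measure)
  also have "\<dots> = (\<integral>\<^sup>+ s. (\<integral>\<^sup>+z. ennreal (stable_density \<alpha> ap am z) * indicator A (s, z) \<partial>lborel) \<partial>density lborel (indicator {0..}))"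
    unfolding stable_levy_measure_eq by (intro nn_integral_cong nn_integral_density) measurable
  also have "\<dots> = (\<integral>\<^sup>+s. indicator {0..} s * (\<integral>\<^sup>+z. ennreal (stable_density \<alpha> ap am z) * indicator A (s, z) \<partial>lborel) \<partial>lborel)"
    by (intro nn_integral_density) measurable
  finally show ?thesis .
qed

text \<open>With c = \<epsilon> powr (1 / \<alpha>), the substitution z -> c z in the density
  contributes c powr (-1 - \<alpha>) * c = 1 / \<epsilon>, and the substitution s -> \<epsilon> s in
  time contributes the factor \<epsilon> that cancels it.\<close>

lemma jump_intensity_self_similar:
  assumes \<alpha>: "0 < \<alpha>" and \<epsilon>: "0 < \<epsilon>" and A: "A \<in> sets (borel \<Otimes>\<^sub>M borel)" and a: "0 \<le> ap" "0 \<le> am"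
  shows "emeasure (jump_intensity (stable_levy_measure \<alpha> ap am)) ((\<lambda>(s, z). (\<epsilon> * s, \<epsilon> powr (1/\<alpha>) * z)) -` A)
    = emeasure (jump_intensity (stable_levy_measure \<alpha> ap am)) A"
proof -
  define c where "c = \<epsilon> powr (1/\<alpha>)"
  have c: "0 < c" using \<epsilon> by (simp add: c_def)
  have ca: "c powr (-1 - \<alpha>) * c * \<epsilon> = 1"
  proof -
    have "c powr (-1 - \<alpha>) * c powr 1 = c powr (- \<alpha>)" by (subst powr_add[symmetric]) simp
    also have "\<dots> = \<epsilon> powr (- 1)" using \<alpha> by (simp add: c_def powr_powr)
    also have "\<dots> = inverse \<epsilon>" using \<epsilon> by (simp add: powr_minus)
    finally show ?thesis using c \<epsilon> by simp
  qed
  have A'[measurable]: "A \<in> sets (borel \<Otimes>\<^sub>M borel)" by fact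
  have "(\<lambda>(s, z). (\<epsilon> * s, c * z)) \<in> borel \<Otimes>\<^sub>M borel \<rightarrow>\<^sub>M borel \<Otimes>\<^sub>M borel" by measurable
  from measurable_sets[OF this A] have A2: "(\<lambda>(s, z). (\<epsilon> * s, c * z)) -` A \<in> sets (borel \<Otimes>\<^sub>M borel)"
    by (simp add: space_pair_measure)
  have inner: "(\<integral>\<^sup>+z. ennreal (stable_density \<alpha> ap am z) * indicator A (s, z) \<partial>lborel)
     = ennreal (c powr (-1 - \<alpha>) * c) * (\<integral>\<^sup>+z. ennreal (stable_density \<alpha> ap am z) * indicator A (s, c * z) \<partial>lborel)" for s
  proof -
    have "(\<integral>\<^sup>+z. ennreal (stable_density \<alpha> ap am z) * indicator A (s, z) \<partial>lborel)
        = ennreal \<bar>c\<bar> * (\<integral>\<^sup>+z. ennreal (stable_density \<alpha> ap am (0 + c * z)) * indicator A (s, 0 + c * z) \<partial>lborel)"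
      by (rule nn_integral_real_affine) (use c in auto)
    also have "(\<integral>\<^sup>+z. ennreal (stable_density \<alpha> ap am (0 + c * z)) * indicator A (s, 0 + c * z) \<partial>lborel)
        = (\<integral>\<^sup>+z. ennreal (c powr (-1 - \<alpha>)) * (ennreal (stable_density \<alpha> ap am z) * indicator A (s, c * z)) \<partial>lborel)"
      using c by (intro nn_integral_cong)
        (simp add: stable_density_scale ennreal_mult stable_density_nonneg a mult.assoc)
    also have "\<dots> = ennreal (c powr (-1 - \<alpha>)) * (\<integral>\<^sup>+z. ennreal (stable_density \<alpha> ap am z) * indicator A (s, c * z) \<partial>lborel)"
      by (rule nn_integral_cmult) measurable
    finally show ?thesis using c by (simp add: ennreal_mult mult.assoc mult.left_commute)
  qed
  define g where "g s = (\<integral>\<^sup>+z. ennreal (stable_density \<alpha> ap am z) * indicator A (s, c * z) \<partial>lborel)" for s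
  have g[measurable]: "g \<in> borel_measurable borel" unfolding g_def by measurable
  have "emeasure (jump_intensity (stable_levy_measure \<alpha> ap am)) A
      = (\<integral>\<^sup>+s. ennreal (c powr (-1 - \<alpha>) * c) * (indicator {0..} s * g s) \<partial>lborel)"
    unfolding emeasure_jump_intensity[OF A] inner g_def by (simp add: mult.left_commute)
  also have "\<dots> = ennreal (c powr (-1 - \<alpha>) * c) * (\<integral>\<^sup>+s. indicator {0..} s * g s \<partial>lborel)"
    by (rule nn_integral_cmult) measurable
  also have "(\<integral>\<^sup>+s. indicator {0..} s * g s \<partial>lborel) = ennreal \<bar>\<epsilon>\<bar> * (\<integral>\<^sup>+s. indicator {0..} (0 + \<epsilon> * s) * g (0 + \<epsilon> * s) \<partial>lborel)"
    by (rule nn_integral_real_affine) (use \<epsilon> in auto)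
  also have "(\<integral>\<^sup>+s. indicator {0..} (0 + \<epsilon> * s) * g (0 + \<epsilon> * s) \<partial>lborel) = (\<integral>\<^sup>+s. indicator {0..} s * g (\<epsilon> * s) \<partial>lborel)"
    using \<epsilon> by (intro nn_integral_cong) (auto simp: indicator_def zero_le_mult_iff)
  also have "\<dots> = emeasure (jump_intensity (stable_levy_measure \<alpha> ap am)) ((\<lambda>(s, z). (\<epsilon> * s, c * z)) -` A)"
    unfolding emeasure_jump_intensity[OF A2] g_def by (simp add: indicator_vimage)
  also have "ennreal (c powr (-1 - \<alpha>) * c) * (ennreal \<bar>\<epsilon>\<bar> * emeasure (jump_intensity (stable_levy_measure \<alpha> ap am)) ((\<lambda>(s, z). (\<epsilon> * s, c * z)) -` A))
      = emeasure (jump_intensity (stable_levy_measure \<alpha> ap am)) ((\<lambda>(s, z). (\<epsilon> * s, c * z)) -` A)"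
    using c \<epsilon> ca by (simp flip: mult.assoc ennreal_mult)
  finally show ?thesis by (simp add: c_def)
qed

definition rescaled_jumps :: "real \<Rightarrow> real \<Rightarrow> ('a \<Rightarrow> (real \<times> real) measure) \<Rightarrow> 'a \<Rightarrow> (real \<times> real) measure" where
  "rescaled_jumps \<epsilon> c N \<omega> = distr (N \<omega>) (borel \<Otimes>\<^sub>M borel) (\<lambda>(s, z). (\<epsilon> * s, c * z))"

text \<open>Counts of the image measure are counts of preimages, and taking preimages under the
  scaling preserves measurability, disjointness and, by self-similarity, the intensity.\<close>

lemma poisson_rescaled_jumps:
  fixes \<alpha> ap am :: real
  defines "\<mu> \<equiv> jump_intensity (stable_levy_measure \<alpha> ap am)"
  assumes M: "prob_space M" and N: "poisson_random_measure M \<mu> N" and \<alpha>: "0 < \<alpha>" and \<epsilon>: "0 < \<epsilon>" and a: "0 \<le> ap" "0 \<le> am"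
  shows "poisson_random_measure M \<mu> (rescaled_jumps \<epsilon> (\<epsilon> powr (1/\<alpha>)) N)"
proof -
  define \<phi> where "\<phi> = (\<lambda>(s, z). (\<epsilon> * s, \<epsilon> powr (1/\<alpha>) * z))"
  have s: "sets \<mu> = sets (borel \<Otimes>\<^sub>M borel)" by (simp add: \<mu>_def sets_jump_intensity)
  have \<phi>: "\<phi> \<in> borel \<Otimes>\<^sub>M borel \<rightarrow>\<^sub>M borel \<Otimes>\<^sub>M borel" unfolding \<phi>_def by measurable
  have pre: "\<phi> -` A \<in> sets \<mu>" if "A \<in> sets \<mu>" for A
    using measurable_sets[OF \<phi>, of A] that s by (simp add: space_pair_measure)
  have em: "emeasure (rescaled_jumps \<epsilon> (\<epsilon> powr (1/\<alpha>)) N \<omega>) A = emeasure (N \<omega>) (\<phi> -` A)"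
    if "\<omega> \<in> space M" "A \<in> sets \<mu>" for \<omega> A
  proof -
    have sN: "sets (N \<omega>) = sets (borel \<Otimes>\<^sub>M borel)" using poisson_sets[OF N that(1)] s by simp
    have "\<phi> \<in> N \<omega> \<rightarrow>\<^sub>M borel \<Otimes>\<^sub>M borel" using \<phi> sN by (simp cong: measurable_cong_sets)
    moreover have "space (N \<omega>) = UNIV" using sets_eq_imp_space_eq[OF sN] by (simp add: space_pair_measure)
    ultimately show ?thesis
      using that(2) s unfolding rescaled_jumps_def \<phi>_def[symmetric] by (simp add: emeasure_distr)
  qed
  have \<mu>: "emeasure \<mu> (\<phi> -` A) = emeasure \<mu> A" if "A \<in> sets \<mu>" for A
    unfolding \<mu>_def \<phi>_def by (rule jump_intensity_self_similar[OF \<alpha> \<epsilon> _ a]) (use that s in simp)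
  have \<mu>': "measure \<mu> (\<phi> -` A) = measure \<mu> A" if "A \<in> sets \<mu>" for A
    using \<mu>[OF that] by (simp add: measure_def)
  note D = N[unfolded poisson_random_measure_def]
  show ?thesis
    unfolding poisson_random_measure_def
  proof (intro conjI ballI impI allI)
    fix \<omega> assume "\<omega> \<in> space M"
    show "sets (rescaled_jumps \<epsilon> (\<epsilon> powr (1/\<alpha>)) N \<omega>) = sets \<mu>" using s by (simp add: rescaled_jumps_def)
  next
    fix A assume A: "A \<in> sets \<mu>"
    show "(\<lambda>\<omega>. emeasure (rescaled_jumps \<epsilon> (\<epsilon> powr (1/\<alpha>)) N \<omega>) A) \<in> borel_measurable M"
      by (rule measurable_cong[THEN iffD2, OF em[OF _ A]]) (auto intro: poisson_measurable[OF N] pre A)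
  next
    fix A and k :: nat assume A: "A \<in> sets \<mu>" "emeasure \<mu> A < \<infinity>"
    have "{\<omega> \<in> space M. emeasure (rescaled_jumps \<epsilon> (\<epsilon> powr (1/\<alpha>)) N \<omega>) A = of_nat k}
        = {\<omega> \<in> space M. emeasure (N \<omega>) (\<phi> -` A) = of_nat k}"
      using em[OF _ A(1)] by auto
    then show "measure M {\<omega> \<in> space M. emeasure (rescaled_jumps \<epsilon> (\<epsilon> powr (1/\<alpha>)) N \<omega>) A = of_nat k} =
        measure \<mu> A ^ k / fact k * exp (- measure \<mu> A)"
      using D pre[OF A(1)] \<mu>[OF A(1)] \<mu>'[OF A(1)] A(2) by auto
  next
    fix A assume A: "A \<in> sets \<mu>" "emeasure \<mu> A = \<infinity>"
    have "AE \<omega> in M. emeasure (N \<omega>) (\<phi> -` A) = \<infinity>" using D pre[OF A(1)] \<mu>[OF A(1)] A(2) by auto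
    then show "AE \<omega> in M. emeasure (rescaled_jumps \<epsilon> (\<epsilon> powr (1/\<alpha>)) N \<omega>) A = \<infinity>"
      by (rule AE_mp) (intro AE_I2 impI, simp add: em A)
  next
    fix A :: "nat \<Rightarrow> (real \<times> real) set" assume A: "range A \<subseteq> sets \<mu> \<and> disjoint_family A"
    have "range (\<lambda>i. \<phi> -` A i) \<subseteq> sets \<mu>" using A pre by auto
    moreover have "disjoint_family (\<lambda>i. \<phi> -` A i)" using A unfolding disjoint_family_on_def by blast
    ultimately have ind: "prob_space.indep_vars M (\<lambda>_. borel) (\<lambda>i \<omega>. emeasure (N \<omega>) (\<phi> -` A i)) UNIV"
      using D by blast
    have em_eq: "emeasure (N \<omega>) (\<phi> -` A i) = emeasure (rescaled_jumps \<epsilon> (\<epsilon> powr (1/\<alpha>)) N \<omega>) (A i)"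
      if "\<omega> \<in> space M" for i \<omega>
      using em[OF that, of "A i"] A by auto
    show "prob_space.indep_vars M (\<lambda>_. borel) (\<lambda>i \<omega>. emeasure (rescaled_jumps \<epsilon> (\<epsilon> powr (1/\<alpha>)) N \<omega>) (A i)) UNIV"
    proof -
      have "(\<lambda>\<omega>. emeasure (rescaled_jumps \<epsilon> (\<epsilon> powr (1/\<alpha>)) N \<omega>) (A i)) \<in> borel_measurable M" for i
        by (rule measurable_cong[THEN iffD1, OF em_eq]) (use A pre in \<open>auto intro: poisson_measurable[OF N]\<close>)
      moreover have "(\<lambda>\<omega>. emeasure (rescaled_jumps \<epsilon> (\<epsilon> powr (1/\<alpha>)) N \<omega>) (A i)) -` B \<inter> space M
          = (\<lambda>\<omega>. emeasure (N \<omega>) (\<phi> -` A i)) -` B \<inter> space M" for i B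
        using em_eq by auto
      ultimately show ?thesis
        using ind unfolding prob_space.indep_vars_def2[OF M] by simp
    qed
  qed
qed

lemma jump_integral_rescaled:
  assumes sN: "sets (N \<omega>) = sets (borel \<Otimes>\<^sub>M borel)" and \<epsilon>: "0 < \<epsilon>" and A: "A \<in> sets borel"
  shows "jump_integral (rescaled_jumps \<epsilon> c N) t A \<omega> = c * jump_integral N (t / \<epsilon>) {z. c * z \<in> A} \<omega>"
proof -
  have \<phi>: "(\<lambda>(s, z). (\<epsilon> * s, c * z)) \<in> N \<omega> \<rightarrow>\<^sub>M borel \<Otimes>\<^sub>M borel"
    using sN by (simp cong: measurable_cong_sets)
  have B: "{0<..t} \<times> A \<in> sets (borel \<Otimes>\<^sub>M borel)" using A by auto
  then have m: "(\<lambda>p. indicator ({0<..t} \<times> A) p *\<^sub>R snd p :: real) \<in> borel_measurable (borel \<Otimes>\<^sub>M borel)"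
    by measurable
  have "jump_integral (rescaled_jumps \<epsilon> c N) t A \<omega>
      = (LINT p|N \<omega>. indicator ({0<..t} \<times> A) ((\<lambda>(s, z). (\<epsilon> * s, c * z)) p) *\<^sub>R snd ((\<lambda>(s, z). (\<epsilon> * s, c * z)) p))"
    unfolding jump_integral_def set_lebesgue_integral_def rescaled_jumps_def
    by (rule integral_distr[OF \<phi> m])
  also have "\<dots> = (LINT p|N \<omega>. c * (indicator ({0<..t / \<epsilon>} \<times> {z. c * z \<in> A}) p *\<^sub>R snd p))"
    using \<epsilon> by (intro Bochner_Integration.integral_cong)
      (auto simp: indicator_def pos_le_divide_eq zero_less_mult_iff mult.commute)
  finally show ?thesis by (simp add: jump_integral_def set_lebesgue_integral_def)
qed

text \<open>Homogeneity of the density contributes c powr (-1 - \<alpha>), while the integrand z and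
  Lebesgue measure contribute one factor c each.\<close>

lemma truncated_mean_scale:
  assumes c: "0 < c" and a: "0 \<le> ap" "0 \<le> am"
  shows "truncated_mean \<alpha> ap am (c * \<delta>) = c powr (1 - \<alpha>) * truncated_mean \<alpha> ap am \<delta>"
proof -
  have eq: "(LINT z : {z. d < \<bar>z\<bar>} | stable_levy_measure \<alpha> ap am. z)
      = (LINT z|lborel. stable_density \<alpha> ap am z * (indicator {z. d < \<bar>z\<bar>} z * z))" for d
  proof -
    have [measurable]: "{z::real. d < \<bar>z\<bar>} \<in> sets borel" by measurable
    show ?thesis
      unfolding set_lebesgue_integral_def stable_levy_measure_eq
      by (subst integral_density) (auto simp: stable_density_nonneg a)
  qed
  have "(LINT z|lborel. stable_density \<alpha> ap am z * (indicator {z. c * \<delta> < \<bar>z\<bar>} z * z))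
      = \<bar>c\<bar> *\<^sub>R (LINT z|lborel. stable_density \<alpha> ap am (0 + c * z) * (indicator {z. c * \<delta> < \<bar>z\<bar>} (0 + c * z) * (0 + c * z)))"
    by (rule lborel_integral_real_affine) (use c in simp)
  also have "\<dots> = c * (LINT z|lborel. c powr (-1 - \<alpha>) * c * (stable_density \<alpha> ap am z * (indicator {z. \<delta> < \<bar>z\<bar>} z * z)))"
  proof -
    have "stable_density \<alpha> ap am (0 + c * z) * (indicator {z. c * \<delta> < \<bar>z\<bar>} (0 + c * z) * (0 + c * z))
        = c powr (-1 - \<alpha>) * c * (stable_density \<alpha> ap am z * (indicator {z. \<delta> < \<bar>z\<bar>} z * z))" for z
      unfolding add_0_left stable_density_scale[OF c] using c by (auto simp: indicator_def abs_mult)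
    then show ?thesis using c by (simp only: abs_of_pos real_scaleR_def)
  qed
  also have "\<dots> = c * (c powr (-1 - \<alpha>) * c) * (LINT z|lborel. (stable_density \<alpha> ap am z * (indicator {z. \<delta> < \<bar>z\<bar>} z * z)))"
    by simp
  also have "c * (c powr (-1 - \<alpha>) * c) = c powr (1 - \<alpha>)"
  proof -
    have "c powr 1 * (c powr (-1 - \<alpha>) * c powr 1) = c powr (1 - \<alpha>)" by (simp only: powr_add[symmetric]) simp
    then show ?thesis using c by simp
  qed
  finally show ?thesis by (simp add: truncated_mean_def eq)
qed

text \<open>Scaling by c turns the cut at \<delta> into a cut at \<delta> / c. The compensators
  match because c powr (1 - \<alpha>) = c / \<epsilon>, the factor 1 / \<epsilon> being absorbed by
  the change of time. The whole discrepancy is c times the original one at time t / \<epsilon>, so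
  the level e becomes e / c.\<close>

lemma levy_limit_rescaled:
  assumes N: "poisson_random_measure M (jump_intensity (stable_levy_measure \<alpha> ap am)) N"
    and lim: "levy_limit M \<alpha> ap am N L" and \<alpha>: "0 < \<alpha>" and \<epsilon>: "0 < \<epsilon>" and a: "0 \<le> ap" "0 \<le> am"
  shows "levy_limit M \<alpha> ap am (rescaled_jumps \<epsilon> (\<epsilon> powr (1/\<alpha>)) N) (\<lambda>t \<omega>. \<epsilon> powr (1/\<alpha>) * L (t / \<epsilon>) \<omega>)"
  unfolding levy_limit_def
proof (intro allI impI)
  fix t e :: real assume t: "0 \<le> t" and e: "0 < e"
  define c where "c = \<epsilon> powr (1/\<alpha>)"
  have c: "0 < c" using \<epsilon> by (simp add: c_def)
  have ca: "c powr (1 - \<alpha>) = c / \<epsilon>"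
  proof -
    have "c powr (1 - \<alpha>) = c powr 1 / c powr \<alpha>" by (rule powr_diff)
    also have "c powr \<alpha> = \<epsilon>" using \<alpha> \<epsilon> by (simp add: c_def powr_powr)
    finally show ?thesis using c by simp
  qed
  have lim': "((\<lambda>\<delta>. measure M {\<omega>\<in>space M. e / c \<le> \<bar>jump_integral N (t / \<epsilon>) (jump_truncation \<alpha> \<delta>) \<omega>
        - (t / \<epsilon>) * truncated_mean \<alpha> ap am \<delta> - L (t / \<epsilon>) \<omega>\<bar>}) \<longlongrightarrow> 0) (at_right 0)"
    by (rule lim[unfolded levy_limit_def, rule_format]) (use t e c \<epsilon> in auto)
  have f: "filterlim (\<lambda>\<delta>. \<delta> / c) (at_right 0) (at_right 0)"
  proof -
    have "(\<lambda>\<delta>. \<delta> / c) = (*) (1 / c)" by (auto simp: fun_eq_iff)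
    then show ?thesis using filtermap_times_pos_at_right[of "1/c" 0] c by (simp add: filterlim_def)
  qed
  have "measure M {\<omega>\<in>space M. e / c \<le> \<bar>jump_integral N (t / \<epsilon>) (jump_truncation \<alpha> (\<delta> / c)) \<omega>
        - (t / \<epsilon>) * truncated_mean \<alpha> ap am (\<delta> / c) - L (t / \<epsilon>) \<omega>\<bar>}
     = measure M {\<omega>\<in>space M. e \<le> \<bar>jump_integral (rescaled_jumps \<epsilon> c N) t (jump_truncation \<alpha> \<delta>) \<omega>
        - t * truncated_mean \<alpha> ap am \<delta> - c * L (t / \<epsilon>) \<omega>\<bar>}" for \<delta>
  proof -
    have set: "{z. c * z \<in> jump_truncation \<alpha> \<delta>} = jump_truncation \<alpha> (\<delta> / c)"
      using c by (auto simp: jump_truncation_def abs_mult field_simps)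
    have mean: "truncated_mean \<alpha> ap am \<delta> = c / \<epsilon> * truncated_mean \<alpha> ap am (\<delta> / c)"
      using truncated_mean_scale[OF c a, of \<alpha> "\<delta> / c"] c ca by simp
    have "jump_integral (rescaled_jumps \<epsilon> c N) t (jump_truncation \<alpha> \<delta>) \<omega> - t * truncated_mean \<alpha> ap am \<delta> - c * L (t / \<epsilon>) \<omega>
      = c * (jump_integral N (t / \<epsilon>) (jump_truncation \<alpha> (\<delta> / c)) \<omega>
        - (t / \<epsilon>) * truncated_mean \<alpha> ap am (\<delta> / c) - L (t / \<epsilon>) \<omega>)" if "\<omega> \<in> space M" for \<omega>
    proof -
      have "sets (N \<omega>) = sets (borel \<Otimes>\<^sub>M borel)" using poisson_sets[OF N that] by (simp add: sets_jump_intensity)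
      from jump_integral_rescaled[where N=N and \<omega>=\<omega> and c=c and t=t and A="jump_truncation \<alpha> \<delta>", OF this \<epsilon> jump_truncation_sets]
      show ?thesis
        unfolding set mean by (simp add: algebra_simps)
    qed
    then have "{\<omega>\<in>space M. e / c \<le> \<bar>jump_integral N (t / \<epsilon>) (jump_truncation \<alpha> (\<delta> / c)) \<omega>
        - (t / \<epsilon>) * truncated_mean \<alpha> ap am (\<delta> / c) - L (t / \<epsilon>) \<omega>\<bar>}
      = {\<omega>\<in>space M. e \<le> \<bar>jump_integral (rescaled_jumps \<epsilon> c N) t (jump_truncation \<alpha> \<delta>) \<omega>
        - t * truncated_mean \<alpha> ap am \<delta> - c * L (t / \<epsilon>) \<omega>\<bar>}"
      using c by (auto simp: abs_mult pos_divide_le_eq mult.commute)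
    then show ?thesis by simp
  qed
  with filterlim_compose[OF lim' f]
  show "((\<lambda>\<delta>. measure M {\<omega>\<in>space M. e \<le> \<bar>jump_integral (rescaled_jumps \<epsilon> (\<epsilon> powr (1/\<alpha>)) N) t (jump_truncation \<alpha> \<delta>) \<omega>
        - t * truncated_mean \<alpha> ap am \<delta> - \<epsilon> powr (1/\<alpha>) * L (t / \<epsilon>) \<omega>\<bar>}) \<longlongrightarrow> 0) (at_right 0)"
    by (simp add: c_def)
qed

section \<open>Large jumps in the case \<alpha> = 1\<close>

lemma emeasure_large_jumps_finite:
  assumes \<delta>: "0 < \<delta>" and a: "0 \<le> ap" "0 \<le> am" and t: "0 \<le> t"
  shows "emeasure (jump_intensity (stable_levy_measure 1 ap am)) ({0<..t} \<times> {z. \<delta> < \<bar>z\<bar>}) < \<infinity>"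
proof -
  have [measurable]: "{z::real. \<delta> < \<bar>z\<bar>} \<in> sets borel" by measurable
  \<comment> \<open>On \<bar>z\<bar> > \<delta> the first factor compares the inverse square of z
    with \<open>inverse (1 + z\<^sup>2)\<close>, whose integrability is known.\<close>
  define C where "C = (1 + 1 / \<delta>\<^sup>2) * (ap + am)"
  have "integrable lborel (\<lambda>z::real. inverse (1 + z\<^sup>2))"
    using integrable_inverse_1_plus_square by (simp add: set_integrable_def einterval_def)
  then have "integrable lborel (\<lambda>z::real. C * inverse (1 + z\<^sup>2))" by simp
  then have fin: "(\<integral>\<^sup>+z. ennreal (C * inverse (1 + z\<^sup>2)) \<partial>lborel) < \<infinity>"
    using integrableD(2)[of lborel "\<lambda>z. C * inverse (1 + z\<^sup>2)"]
    by (simp add: less_top)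
  have bound: "stable_density 1 ap am z \<le> C * inverse (1 + z\<^sup>2)" if z: "\<delta> < \<bar>z\<bar>" for z
  proof -
    have z0: "0 < z\<^sup>2" using z \<delta> by auto
    have "\<bar>z\<bar> powr (-1 - 1) = inverse (z\<^sup>2)"
      using z \<delta> by (simp add: powr_minus powr_numeral)
    moreover have "ap * indicator {0<..} z + am * indicator {..<0} z \<le> ap + am"
      using a by (auto simp: indicator_def)
    ultimately have "stable_density 1 ap am z \<le> inverse (z\<^sup>2) * (ap + am)"
      unfolding stable_density_def by (simp add: mult_left_mono)
    also have "inverse (z\<^sup>2) \<le> (1 + 1 / \<delta>\<^sup>2) * inverse (1 + z\<^sup>2)"
    proof -
      have "\<delta>\<^sup>2 \<le> \<bar>z\<bar>\<^sup>2" using z \<delta> by (intro power_mono) auto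
      then have "1 \<le> 1 / \<delta>\<^sup>2 * z\<^sup>2" using \<delta> by (simp add: field_simps)
      then have "1 + z\<^sup>2 \<le> (1 + 1 / \<delta>\<^sup>2) * z\<^sup>2" by (simp add: distrib_right)
      then show ?thesis using z0 by (simp add: field_simps add_pos_pos)
    qed
    then have "inverse (z\<^sup>2) * (ap + am) \<le> (1 + 1 / \<delta>\<^sup>2) * inverse (1 + z\<^sup>2) * (ap + am)"
      using a by (intro mult_right_mono) auto
    finally show ?thesis by (simp add: C_def mult_ac)
  qed
  define K where "K = (\<integral>\<^sup>+z. ennreal (stable_density 1 ap am z) * indicator {z. \<delta> < \<bar>z\<bar>} z \<partial>lborel)"
  have "K \<le> (\<integral>\<^sup>+z. ennreal (C * inverse (1 + z\<^sup>2)) \<partial>lborel)"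
    unfolding K_def using bound by (intro nn_integral_mono) (auto simp: indicator_def intro!: ennreal_leI)
  then have K: "K < \<infinity>" using fin by (rule le_less_trans)
  have "{0<..t} \<times> {z::real. \<delta> < \<bar>z\<bar>} \<in> sets (borel \<Otimes>\<^sub>M borel)" by measurable
  then have "emeasure (jump_intensity (stable_levy_measure 1 ap am)) ({0<..t} \<times> {z. \<delta> < \<bar>z\<bar>})
      = (\<integral>\<^sup>+s. indicator {0..} s * (\<integral>\<^sup>+z. ennreal (stable_density 1 ap am z) * indicator ({0<..t} \<times> {z. \<delta> < \<bar>z\<bar>}) (s, z) \<partial>lborel) \<partial>lborel)"
    by (rule emeasure_jump_intensity)
  also have "\<dots> \<le> (\<integral>\<^sup>+s. K * indicator {0..t} s \<partial>lborel)"
  proof (rule nn_integral_mono)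
    fix s :: real
    have "(\<integral>\<^sup>+z. ennreal (stable_density 1 ap am z) * indicator ({0<..t} \<times> {z. \<delta> < \<bar>z\<bar>}) (s, z) \<partial>lborel)
        = (\<integral>\<^sup>+z. indicator {0<..t} s * (ennreal (stable_density 1 ap am z) * indicator {z. \<delta> < \<bar>z\<bar>} z) \<partial>lborel)"
      by (intro nn_integral_cong) (auto simp: indicator_def)
    also have "\<dots> = indicator {0<..t} s * K"
      unfolding K_def by (rule nn_integral_cmult) measurable
    finally show "indicator {0..} s * (\<integral>\<^sup>+z. ennreal (stable_density 1 ap am z) * indicator ({0<..t} \<times> {z. \<delta> < \<bar>z\<bar>}) (s, z) \<partial>lborel)
        \<le> K * indicator {0..t} s" by (auto simp: indicator_def)
  qed
  also have "\<dots> = K * ennreal t" using t by (subst nn_integral_cmult_indicator) auto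
  also have "\<dots> < \<infinity>" using K by (simp add: ennreal_mult_less_top)
  finally show ?thesis .
qed

text \<open>The Poisson weights of the finite counts already add up to 1.\<close>

lemma poisson_finite_AE:
  assumes M: "prob_space M" and N: "poisson_random_measure M \<mu> N" and A: "A \<in> sets \<mu>" "emeasure \<mu> A < \<infinity>"
  shows "AE \<omega> in M. emeasure (N \<omega>) A < \<infinity>"
proof -
  interpret prob_space M by fact
  have mN[measurable]: "(\<lambda>\<omega>. emeasure (N \<omega>) A) \<in> borel_measurable M" by (rule poisson_measurable[OF N A(1)])
  define E where "E k = {\<omega>\<in>space M. emeasure (N \<omega>) A = of_nat k}" for k :: nat
  have E: "E k \<in> events" for k unfolding E_def by measurable
  have pE: "prob (E k) = measure \<mu> A ^ k / fact k * exp (- measure \<mu> A)" for k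
    using N A unfolding poisson_random_measure_def E_def by blast
  have "disjoint_family E"
    unfolding disjoint_family_on_def E_def by (auto simp: ennreal_of_nat_eq_real_of_nat)
  then have "(\<lambda>k. prob (E k)) sums prob (\<Union>k. E k)"
    using E by (intro finite_measure_UNION) auto
  moreover have "(\<lambda>k. prob (E k)) sums (exp (measure \<mu> A) * exp (- measure \<mu> A))"
    using sums_mult2[OF exp_converges[of "measure \<mu> A"], of "exp (- measure \<mu> A)"]
    by (simp add: pE divide_inverse mult.commute mult.left_commute)
  ultimately have "prob (\<Union>k. E k) = exp (measure \<mu> A) * exp (- measure \<mu> A)"
    by (rule sums_unique2)
  then have "prob (\<Union>k. E k) = 1" by (simp only: mult_exp_exp) simp
  then have "AE \<omega> in M. \<omega> \<in> (\<Union>k. E k)" using E by (intro prob_eq_1[THEN iffD1]) auto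
  then show ?thesis
    by (rule AE_mp) (intro AE_I2 impI, auto simp: E_def of_nat_less_top)
qed

text \<open>At \<alpha> = 1 the large jumps need not have a finite mean, so integrability is not
  obtained from an expectation. Almost surely only finitely many jumps up to time t exceed \<delta>,
  and the probability \<open>exp (- measure \<mu> (B k))\<close> that no jump falls into
  \<open>B k\<close> tends to 1, so almost surely some \<open>B k\<close> is void. The integrand is
  then bounded on a set of finite measure.\<close>

lemma AE_integrable_large_jumps:
  fixes ap am :: real
  defines "\<mu> \<equiv> jump_intensity (stable_levy_measure 1 ap am)"
  assumes M: "prob_space M" and N: "poisson_random_measure M \<mu> N"
    and \<delta>: "0 < \<delta>" and a: "0 \<le> ap" "0 \<le> am" and t: "0 \<le> t"
  shows "AE \<omega> in M. set_integrable (N \<omega>) ({0<..t} \<times> {z. \<delta> < \<bar>z\<bar>}) snd"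
proof -
  interpret prob_space M by fact
  define B where "B k = {0<..t} \<times> {z::real. \<delta> + real k < \<bar>z\<bar>}" for k :: nat
  have s: "sets \<mu> = sets (borel \<Otimes>\<^sub>M borel)" by (simp add: \<mu>_def sets_jump_intensity)
  have B: "B k \<in> sets \<mu>" for k
  proof -
    have "{z::real. \<delta> + real k < \<bar>z\<bar>} \<in> sets borel" by measurable
    then show ?thesis unfolding s B_def by auto
  qed
  have fin: "emeasure \<mu> (B k) < \<infinity>" for k
    unfolding \<mu>_def B_def by (rule emeasure_large_jumps_finite) (use \<delta> a t in auto)
  have "(\<lambda>k. measure \<mu> (B k)) \<longlonglongrightarrow> measure \<mu> (\<Inter>k. B k)"
  proof (rule Lim_measure_decseq)
    show "range B \<subseteq> sets \<mu>" using B by auto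
    show "decseq B" by (intro decseq_SucI) (auto simp: B_def)
    show "emeasure \<mu> (B k) \<noteq> \<infinity>" for k using fin[of k] by simp
  qed
  moreover have "(\<Inter>k. B k) = {}"
  proof -
    have "p \<notin> (\<Inter>k. B k)" for p
    proof
      assume p: "p \<in> (\<Inter>k. B k)"
      have "real k < \<bar>snd p\<bar>" for k
      proof -
        have "p \<in> B k" using p by blast
        then show ?thesis using \<delta> by (auto simp: B_def)
      qed
      then show False using reals_Archimedean2[of "\<bar>snd p\<bar>"] by (metis less_asym)
    qed
    then show ?thesis by blast
  qed
  ultimately have m0: "(\<lambda>k. measure \<mu> (B k)) \<longlonglongrightarrow> 0" by simp
  define Z where "Z k = {\<omega>\<in>space M. emeasure (N \<omega>) (B k) = 0}" for k
  have Zm: "Z k \<in> events" for k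
    unfolding Z_def using poisson_measurable[OF N B[of k]] by measurable
  have pZ: "prob (Z k) = exp (- measure \<mu> (B k))" for k
  proof -
    have "prob {\<omega>\<in>space M. emeasure (N \<omega>) (B k) = of_nat 0} = measure \<mu> (B k) ^ 0 / fact 0 * exp (- measure \<mu> (B k))"
      using N B fin unfolding poisson_random_measure_def by blast
    then show ?thesis by (simp add: Z_def)
  qed
  have "(\<lambda>k. prob (Z k)) \<longlonglongrightarrow> exp (- 0)" unfolding pZ by (intro tendsto_intros m0)
  moreover have "prob (Z k) \<le> prob (\<Union>k. Z k)" for k
    using Zm by (intro finite_measure_mono) auto
  ultimately have "1 \<le> prob (\<Union>k. Z k)" by (intro LIMSEQ_le_const2) auto
  then have "prob (\<Union>k. Z k) = 1" using prob_le_1 by (simp add: antisym)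
  then have "AE \<omega> in M. \<omega> \<in> (\<Union>k. Z k)" using Zm by (intro prob_eq_1[THEN iffD1]) auto
  moreover have "AE \<omega> in M. emeasure (N \<omega>) (B 0) < \<infinity>" by (rule poisson_finite_AE[OF M N B fin])
  ultimately have "AE \<omega> in M. \<omega> \<in> (\<Union>k. Z k) \<and> emeasure (N \<omega>) (B 0) < \<infinity>" by (rule AE_conjI)
  then show ?thesis
  proof (rule AE_mp, intro AE_I2 impI)
    fix \<omega> assume \<omega>: "\<omega> \<in> space M" and *: "\<omega> \<in> (\<Union>k. Z k) \<and> emeasure (N \<omega>) (B 0) < \<infinity>"
    then obtain k where k: "emeasure (N \<omega>) (B k) = 0" by (auto simp: Z_def)
    have sN: "sets (N \<omega>) = sets (borel \<Otimes>\<^sub>M borel)" using poisson_sets[OF N \<omega>] s by simp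
    have B0: "B 0 \<in> sets (N \<omega>)" "B k \<in> sets (N \<omega>)" using B s sN by auto
    have "(\<lambda>p. indicator (B 0) p *\<^sub>R snd p :: real) \<in> borel_measurable (borel \<Otimes>\<^sub>M borel)"
      using B0(1) sN by measurable
    then have m: "(\<lambda>p. indicator (B 0) p *\<^sub>R snd p :: real) \<in> borel_measurable (N \<omega>)"
      using sN by (simp cong: measurable_cong_sets)
    have "AE p in N \<omega>. p \<notin> B k" using k B0(2) by (simp add: AE_iff_null_sets[symmetric] null_sets_def)
    then have bnd: "AE p in N \<omega>. p \<in> B 0 \<longrightarrow> norm (indicator (B 0) p *\<^sub>R snd p :: real) \<le> \<delta> + real k"
      by (rule AE_mp) (intro AE_I2 impI, auto simp: B_def)
    have "integrable (N \<omega>) (\<lambda>p. indicator (B 0) p *\<^sub>R snd p :: real)"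
      by (rule integrableI_bounded_set[OF B0(1) m _ bnd]) (use * in auto)
    then show "set_integrable (N \<omega>) ({0<..t} \<times> {z. \<delta> < \<bar>z\<bar>}) snd"
      by (simp add: set_integrable_def B_def)
  qed
qed

text \<open>The integrand is odd, so reflection shows the integral to be its own negative.\<close>

lemma symmetric_truncated_mean:
  assumes a: "0 \<le> ap" and A: "A \<in> sets borel" "\<And>z. - z \<in> A \<longleftrightarrow> z \<in> A"
  shows "(LINT z : A | stable_levy_measure \<alpha> ap ap. z) = 0"
proof -
  have eq: "(LINT z : A | stable_levy_measure \<alpha> ap ap. z)
      = (LINT z|lborel. stable_density \<alpha> ap ap z * (indicator A z * z))"
    unfolding set_lebesgue_integral_def stable_levy_measure_eq
    using A(1) by (subst integral_density) (auto simp: stable_density_nonneg a)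
  have odd: "stable_density \<alpha> ap ap (0 + (-1) * z) * (indicator A (0 + (-1) * z) * (0 + (-1) * z))
      = - (stable_density \<alpha> ap ap z * (indicator A z * z))" for z
    using A(2)[of z] by (auto simp: stable_density_def indicator_def)
  have "(LINT z|lborel. stable_density \<alpha> ap ap z * (indicator A z * z))
      = - (LINT z|lborel. stable_density \<alpha> ap ap z * (indicator A z * z))"
    by (subst lborel_integral_real_affine[of "-1" _ 0]) (simp_all only: odd, simp_all)
  then show ?thesis unfolding eq by simp
qed

text \<open>Above \<alpha> = 1 this is the definition, and below it the probabilities are 0 for
  every \<delta>. At \<alpha> = 1 and \<delta> < 1, the jumps between \<delta> and 1 and those of
  size at least 1 are recombined into one integral over \<bar>z\<bar> > \<delta>. This splitting is
  valid only where the integral exists, hence the almost sure integrability of large jumps; the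
  compensator over the symmetric set between \<delta> and 1 is zero.\<close>

lemma stable_levy_process_limit:
  assumes M: "prob_space M" and L: "stable_levy_process M \<alpha> ap am N L"
    and a: "0 \<le> ap" "0 \<le> am" "\<alpha> = 1 \<Longrightarrow> ap = am"
  shows "levy_limit M \<alpha> ap am N L"
  unfolding levy_limit_def
proof (intro allI impI)
  fix t e :: real assume t: "0 \<le> t" and e: "0 < e"
  interpret prob_space M by fact
  let ?\<nu> = "stable_levy_measure \<alpha> ap am"
  have N: "poisson_random_measure M (jump_intensity ?\<nu>) N"
    and cL: "cadlag_process M {0..} L"
    and D: "if \<alpha> < 1 then AE \<omega> in M. L t \<omega> = jump_integral N t (- {0}) \<omega>
        else if \<alpha> = 1 then
          \<exists>Y. compensated_jump_integral M ?\<nu> N t {z. 0 < \<bar>z\<bar> \<and> \<bar>z\<bar> < 1} Y \<and>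
              (AE \<omega> in M. L t \<omega> = Y \<omega> + jump_integral N t {z. 1 \<le> \<bar>z\<bar>} \<omega>)
        else compensated_jump_integral M ?\<nu> N t (- {0}) (L t)"
    using L t unfolding stable_levy_process_def Let_def by blast+
  have Lm[measurable]: "L t \<in> borel_measurable M" using cL t by (auto simp: cadlag_process_def)
  have JI: "jump_integral N t A \<in> borel_measurable M" if "A \<in> sets borel" for A
    by (rule jump_integral_measurable[OF N sets_jump_intensity that])
  consider "\<alpha> < 1" | "\<alpha> = 1" | "1 < \<alpha>" by linarith
  then show "((\<lambda>\<delta>. prob {\<omega> \<in> space M. e \<le> \<bar>jump_integral N t (jump_truncation \<alpha> \<delta>) \<omega>
      - t * truncated_mean \<alpha> ap am \<delta> - L t \<omega>\<bar>}) \<longlongrightarrow> 0) (at_right 0)"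
  proof cases
    case 1
    then have ae: "AE \<omega> in M. L t \<omega> = jump_integral N t (- {0}) \<omega>" using D by simp
    have "prob {\<omega> \<in> space M. e \<le> \<bar>jump_integral N t (- {0}) \<omega> - L t \<omega>\<bar>} = prob {}"
    proof (rule measure_eq_AE)
      show "AE \<omega> in M. \<omega> \<in> {\<omega> \<in> space M. e \<le> \<bar>jump_integral N t (- {0}) \<omega> - L t \<omega>\<bar>} \<longleftrightarrow> \<omega> \<in> {}"
        using ae by (rule AE_mp) (intro AE_I2 impI, use e in auto)
      have [measurable]: "jump_integral N t (- {0}) \<in> borel_measurable M" by (rule JI) auto
      show "{\<omega> \<in> space M. e \<le> \<bar>jump_integral N t (- {0}) \<omega> - L t \<omega>\<bar>} \<in> sets M" by measurable
    qed simp
    then show ?thesis using 1 by (simp add: jump_truncation_def truncated_mean_def)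
  next
    case 3
    then have "compensated_jump_integral M ?\<nu> N t (- {0}) (L t)" using D by simp
    then have lim: "((\<lambda>\<delta>. measure M {\<omega>\<in>space M.
         e \<le> \<bar>jump_integral N t (- {0} \<inter> {z. \<delta> < \<bar>z\<bar>}) \<omega>
               - t * (LINT z : - {0} \<inter> {z. \<delta> < \<bar>z\<bar>} | ?\<nu>. z) - L t \<omega>\<bar>}) \<longlongrightarrow> 0) (at_right 0)"
      using e unfolding compensated_jump_integral_def by blast
    have "\<forall>\<^sub>F \<delta> in at_right (0::real). 0 < \<delta>" by (simp add: eventually_at_right_less)
    then have "\<forall>\<^sub>F \<delta> in at_right 0. measure M {\<omega>\<in>space M.
         e \<le> \<bar>jump_integral N t (- {0} \<inter> {z. \<delta> < \<bar>z\<bar>}) \<omega>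
               - t * (LINT z : - {0} \<inter> {z. \<delta> < \<bar>z\<bar>} | ?\<nu>. z) - L t \<omega>\<bar>}
      = prob {\<omega> \<in> space M. e \<le> \<bar>jump_integral N t (jump_truncation \<alpha> \<delta>) \<omega>
      - t * truncated_mean \<alpha> ap am \<delta> - L t \<omega>\<bar>}"
    proof eventually_elim
      case (elim \<delta>)
      then have "- {0} \<inter> {z. \<delta> < \<bar>z\<bar>} = {z. \<delta> < \<bar>z\<bar>}" by auto
      then show ?case using 3 by (simp only: jump_truncation_def truncated_mean_def) auto
    qed
    from Lim_transform_eventually[OF lim this] show ?thesis .
  next
    case 2
    let ?A = "\<lambda>\<delta>. {z. 0 < \<bar>z\<bar> \<and> \<bar>z\<bar> < 1} \<inter> {z::real. \<delta> < \<bar>z\<bar>}"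
    obtain Y where Y: "compensated_jump_integral M ?\<nu> N t {z. 0 < \<bar>z\<bar> \<and> \<bar>z\<bar> < 1} Y"
      "AE \<omega> in M. L t \<omega> = Y \<omega> + jump_integral N t {z. 1 \<le> \<bar>z\<bar>} \<omega>" using D 2 by auto
    have Ym[measurable]: "Y \<in> borel_measurable M"
      and lim: "((\<lambda>\<delta>. measure M {\<omega>\<in>space M. e \<le> \<bar>jump_integral N t (?A \<delta>) \<omega>
               - t * (LINT z : ?A \<delta> | ?\<nu>. z) - Y \<omega>\<bar>}) \<longlongrightarrow> 0) (at_right 0)"
      using e Y(1) unfolding compensated_jump_integral_def by blast+
    have "\<forall>\<^sub>F \<delta> in at_right (0::real). 0 < \<delta>" "\<forall>\<^sub>F \<delta> in at_right (0::real). \<delta> < 1"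
      by (auto simp: eventually_at_right_less intro: eventually_at_right_real[of 0 1, THEN eventually_mono])
    then have "\<forall>\<^sub>F \<delta> in at_right 0. measure M {\<omega>\<in>space M. e \<le> \<bar>jump_integral N t (?A \<delta>) \<omega>
               - t * (LINT z : ?A \<delta> | ?\<nu>. z) - Y \<omega>\<bar>}
      = prob {\<omega> \<in> space M. e \<le> \<bar>jump_integral N t (jump_truncation \<alpha> \<delta>) \<omega>
      - t * truncated_mean \<alpha> ap am \<delta> - L t \<omega>\<bar>}"
    proof eventually_elim
      case (elim \<delta>)
      have sA: "?A \<delta> \<in> sets borel" "{z::real. 1 \<le> \<bar>z\<bar>} \<in> sets borel" "{z::real. \<delta> < \<bar>z\<bar>} \<in> sets borel" by measurable
      have mean: "(LINT z : ?A \<delta> | ?\<nu>. z) = 0"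
        using a(3)[OF 2] by (auto intro!: symmetric_truncated_mean a sA(1))
      have "AE \<omega> in M. set_integrable (N \<omega>) ({0<..t} \<times> {z. \<delta> < \<bar>z\<bar>}) snd"
        by (rule AE_integrable_large_jumps[OF M _ elim(1) a(1,2) t]) (use N 2 in simp)
      then have split: "AE \<omega> in M. jump_integral N t {z. \<delta> < \<bar>z\<bar>} \<omega>
          = jump_integral N t (?A \<delta>) \<omega> + jump_integral N t {z. 1 \<le> \<bar>z\<bar>} \<omega>"
      proof (rule AE_mp, intro AE_I2 impI)
        fix \<omega> assume \<omega>: "\<omega> \<in> space M" and int: "set_integrable (N \<omega>) ({0<..t} \<times> {z. \<delta> < \<bar>z\<bar>}) snd"
        have sN: "sets (N \<omega>) = sets (borel \<Otimes>\<^sub>M borel)"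
          using poisson_sets[OF N \<omega>] sets_jump_intensity by simp
        have "set_integrable (N \<omega>) ({0<..t} \<times> ?A \<delta>) snd" "set_integrable (N \<omega>) ({0<..t} \<times> {z. 1 \<le> \<bar>z\<bar>}) snd"
          by (rule set_integrable_subset[OF int]; use sA sN elim in auto)+
        moreover have "({0<..t} \<times> ?A \<delta>) \<union> ({0<..t} \<times> {z. 1 \<le> \<bar>z\<bar>}) = {0<..t} \<times> {z. \<delta> < \<bar>z\<bar>}"
          using elim by auto
        ultimately show "jump_integral N t {z. \<delta> < \<bar>z\<bar>} \<omega>
          = jump_integral N t (?A \<delta>) \<omega> + jump_integral N t {z. 1 \<le> \<bar>z\<bar>} \<omega>"
          unfolding jump_integral_def by (subst set_integral_Un[symmetric]) auto
      qed
      have [measurable]: "jump_integral N t (?A \<delta>) \<in> borel_measurable M"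
        "jump_integral N t (jump_truncation \<alpha> \<delta>) \<in> borel_measurable M"
        by (rule JI[OF sA(1)], rule JI[OF jump_truncation_sets])
      have trunc: "jump_truncation \<alpha> \<delta> = {z. \<delta> < \<bar>z\<bar>}" "truncated_mean \<alpha> ap am \<delta> = 0"
        using 2 by (auto simp: jump_truncation_def truncated_mean_def)
      have ae: "AE \<omega> in M. jump_integral N t (jump_truncation \<alpha> \<delta>) \<omega> - L t \<omega> = jump_integral N t (?A \<delta>) \<omega> - Y \<omega>"
        using Y(2) split unfolding trunc(1) by eventually_elim simp
      show ?case unfolding mean trunc(2)
      proof (rule measure_eq_AE)
        show "AE \<omega> in M. \<omega> \<in> {\<omega> \<in> space M. e \<le> \<bar>jump_integral N t (?A \<delta>) \<omega> - t * 0 - Y \<omega>\<bar>} \<longleftrightarrow>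
          \<omega> \<in> {\<omega> \<in> space M. e \<le> \<bar>jump_integral N t (jump_truncation \<alpha> \<delta>) \<omega> - t * 0 - L t \<omega>\<bar>}"
          using ae by eventually_elim simp
      qed measurable
    qed
    from Lim_transform_eventually[OF lim this] show ?thesis .
  qed
qed

lemma stable_levy_self_similar:
  assumes M: "prob_space M" and L: "stable_levy_process M \<alpha> ap am N L"
    and a: "0 \<le> ap" "0 \<le> am" "\<alpha> = 1 \<Longrightarrow> ap = am" and \<alpha>: "0 < \<alpha>" and \<epsilon>: "0 < \<epsilon>"
  shows "same_law M (\<lambda>t \<omega>. \<epsilon> powr (1/\<alpha>) * L (t / \<epsilon>) \<omega>) M L"
proof -
  have N: "poisson_random_measure M (jump_intensity (stable_levy_measure \<alpha> ap am)) N"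
    and cL: "cadlag_process M {0..} L"
    using L unfolding stable_levy_process_def Let_def by blast+
  have lim: "levy_limit M \<alpha> ap am N L" by (rule stable_levy_process_limit[OF M L a])
  have Lm: "L t \<in> borel_measurable M" if "0 \<le> t" for t using cL that by (auto simp: cadlag_process_def)
  show ?thesis
    unfolding same_law_def
  proof (rule levy_limit_law_unique[OF M _ N])
    show "poisson_random_measure M (jump_intensity (stable_levy_measure \<alpha> ap am)) (rescaled_jumps \<epsilon> (\<epsilon> powr (1/\<alpha>)) N)"
      by (rule poisson_rescaled_jumps[OF M N \<alpha> \<epsilon> a(1,2)])
    show "levy_limit M \<alpha> ap am (rescaled_jumps \<epsilon> (\<epsilon> powr (1/\<alpha>)) N) (\<lambda>t \<omega>. \<epsilon> powr (1/\<alpha>) * L (t / \<epsilon>) \<omega>)"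
      by (rule levy_limit_rescaled[OF N lim \<alpha> \<epsilon> a(1,2)])
    show "(\<lambda>\<omega>. \<epsilon> powr (1/\<alpha>) * L (t / \<epsilon>) \<omega>) \<in> borel_measurable M" if "0 \<le> t" for t
      using Lm[of "t / \<epsilon>"] that \<epsilon> by auto
  qed (use Lm lim in auto)
qed

section \<open>Pathwise estimates\<close>

text \<open>Allowing any positive \<kappa> above 1 - p avoids the distinction between p < 1, p = 1
  and p > 1: the surplus factor s powr (1 - p - \<kappa>) is decreasing and is replaced by its value
  at t0, and what remains integrates to a multiple of a power \<kappa>.\<close>

lemma powr_integral_bound:
  fixes p \<kappa> t0 :: real
  assumes t0: "0 < t0" and \<kappa>: "0 < \<kappa>" "1 - p < \<kappa>"
  obtains C where "0 < C" "\<And>T. t0 \<le> T \<Longrightarrow> set_integrable lborel {t0..T} (\<lambda>s. s powr (- p))"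
    "\<And>T. t0 \<le> T \<Longrightarrow> (LINT s : {t0..T} | lborel. s powr (- p)) \<le> C * T powr \<kappa>"
proof -
  define C where "C = t0 powr (1 - p - \<kappa>) / \<kappa>"
  have C: "0 < C" using t0 \<kappa> by (simp add: C_def)
  have int: "set_integrable lborel {t0..T} (\<lambda>s. s powr q)" for q T
    unfolding set_integrable_def
    using t0 by (intro borel_integrable_compact) (auto intro!: continuous_intros)
  have "(LINT s : {t0..T} | lborel. s powr (- p)) \<le> C * T powr \<kappa>" if T: "t0 \<le> T" for T
  proof -
    have "(LINT s : {t0..T} | lborel. s powr (- p)) \<le> (LINT s : {t0..T} | lborel. t0 powr (1 - p - \<kappa>) * s powr (\<kappa> - 1))"
    proof (rule set_integral_mono)
      show "set_integrable lborel {t0..T} (\<lambda>s. t0 powr (1 - p - \<kappa>) * s powr (\<kappa> - 1))"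
        using int by (intro set_integrable_mult_right) auto
      fix s assume s: "s \<in> {t0..T}"
      have "s powr (- p) = s powr (1 - p - \<kappa>) * s powr (\<kappa> - 1)" by (simp flip: powr_add)
      also have "s powr (1 - p - \<kappa>) \<le> t0 powr (1 - p - \<kappa>)"
        using s t0 \<kappa> by (intro powr_mono2') auto
      then have "s powr (1 - p - \<kappa>) * s powr (\<kappa> - 1) \<le> t0 powr (1 - p - \<kappa>) * s powr (\<kappa> - 1)"
        by (intro mult_right_mono) auto
      finally show "s powr (- p) \<le> t0 powr (1 - p - \<kappa>) * s powr (\<kappa> - 1)" .
    qed (rule int)
    also have "\<dots> = t0 powr (1 - p - \<kappa>) * (LINT s : {t0..T} | lborel. s powr (\<kappa> - 1))" by simp
    also have "(LINT s : {t0..T} | lborel. s powr (\<kappa> - 1)) = (LINT s|lborel. s powr (\<kappa> - 1) * indicator {t0..T} s)"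
      by (simp add: set_lebesgue_integral_def mult.commute)
    also have "\<dots> = T powr \<kappa> / \<kappa> - t0 powr \<kappa> / \<kappa>"
    proof (rule integral_FTC_Icc_real[OF T])
      fix s assume "t0 \<le> s" "s \<le> T"
      then have s: "0 < s" using t0 by simp
      show "((\<lambda>s. s powr \<kappa> / \<kappa>) has_real_derivative s powr (\<kappa> - 1)) (at s)"
        using \<kappa> s by (auto intro!: derivative_eq_intros simp: powr_diff)
      show "isCont (\<lambda>s. s powr (\<kappa> - 1)) s" using s by (auto intro!: continuous_intros)
    qed
    also have "t0 powr (1 - p - \<kappa>) * (T powr \<kappa> / \<kappa> - t0 powr \<kappa> / \<kappa>) \<le> t0 powr (1 - p - \<kappa>) * (T powr \<kappa> / \<kappa>)"
      using \<kappa> by (intro mult_left_mono) auto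
    finally show ?thesis by (simp add: C_def)
  qed
  then show thesis using that C int by blast
qed

text \<open>Scaling from 1 and -1 covers v \<noteq> 0; at the origin, F 0 = 2 powr \<gamma> * F 0
  with \<gamma> > 0 forces F 0 = 0.\<close>

lemma homogeneous_bound:
  fixes F :: "real \<Rightarrow> real"
  assumes hom: "\<And>v l. 0 < l \<Longrightarrow> F (l * v) = l powr \<gamma> * F v" and \<gamma>: "0 < \<gamma>"
  shows "\<bar>F v\<bar> \<le> (\<bar>F 1\<bar> + \<bar>F (- 1)\<bar>) * \<bar>v\<bar> powr \<gamma>"
proof -
  have "(2::real) powr \<gamma> > 2 powr 0" using \<gamma> by (intro powr_less_mono) auto
  moreover have "F 0 = 2 powr \<gamma> * F 0" using hom[of 2 0] by simp
  ultimately have F0: "F 0 = 0" using \<gamma> by auto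
  consider "v = 0" | "0 < v" | "v < 0" by linarith
  then show ?thesis
  proof cases
    case 2
    then have "\<bar>F v\<bar> = v powr \<gamma> * \<bar>F 1\<bar>" using hom[of v 1] by (simp add: abs_mult)
    also have "\<dots> \<le> v powr \<gamma> * (\<bar>F 1\<bar> + \<bar>F (- 1)\<bar>)" by (intro mult_left_mono) auto
    finally show ?thesis using 2 by (simp add: mult.commute)
  next
    case 3
    then have "\<bar>F v\<bar> = (- v) powr \<gamma> * \<bar>F (- 1)\<bar>" using hom[of "- v" "- 1"] by (simp add: abs_mult)
    also have "\<dots> \<le> (- v) powr \<gamma> * (\<bar>F 1\<bar> + \<bar>F (- 1)\<bar>)" by (intro mult_left_mono) auto
    finally show ?thesis using 3 by (simp add: mult.commute)
  qed (use F0 in simp)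
qed

lemma cadlag_on_set_measurable:
  assumes f: "cadlag_on {a..} f"
  shows "(\<lambda>s. indicator {a..b} s * f s) \<in> borel_measurable borel"
proof -
  have "(\<lambda>s. indicator {a..b} s * f s) = (\<lambda>s. indicator {a..b} s * f (max a s))"
    by (auto simp: fun_eq_iff indicator_def max_def)
  then show ?thesis using cadlag_on_measurable[OF f] by simp
qed

lemma cadlag_on_set_integrable:
  assumes f: "cadlag_on {a..} f"
  shows "set_integrable lborel {a..b} f"
proof -
  have c: "cadlag_on {a..b} f" by (rule cadlag_on_subset[OF f]) auto
  obtain B where B: "0 \<le> B" "\<And>s. s \<in> {a..b} \<Longrightarrow> \<bar>f s\<bar> \<le> B" using cadlag_on_bounded[OF c] by metis
  show ?thesis
    unfolding set_integrable_def
    by (rule integrableI_bounded_set[of "{a..b}" _ _ B])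
      (use cadlag_on_set_measurable[OF f, of b] B(2) in \<open>auto simp: emeasure_lborel_Icc_eq\<close>)
qed

lemma drift_set_integrable:
  fixes F :: "real \<Rightarrow> real"
  assumes v: "cadlag_on {t0..} v" and F: "continuous_on UNIV F" and t0: "0 < t0"
  shows "set_integrable lborel {t0..T} (\<lambda>s. s powr (- \<beta>) * F (v s))"
proof -
  have c: "cadlag_on {t0..T} v" by (rule cadlag_on_subset[OF v]) auto
  obtain B where B: "0 \<le> B" "\<And>s. s \<in> {t0..T} \<Longrightarrow> \<bar>v s\<bar> \<le> B" using cadlag_on_bounded[OF c] by metis
  have "compact (F ` {- B..B})" by (intro compact_continuous_image continuous_on_subset[OF F]) auto
  then obtain K where K: "\<And>x. x \<in> {- B..B} \<Longrightarrow> \<bar>F x\<bar> \<le> K"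
    using compact_imp_bounded bounded_iff by (metis imageI real_norm_def)
  have "compact ((\<lambda>s. s powr (- \<beta>)) ` {t0..T})"
    using t0 by (intro compact_continuous_image) (auto intro!: continuous_intros)
  then obtain K' where K': "\<And>s. s \<in> {t0..T} \<Longrightarrow> \<bar>s powr (- \<beta>)\<bar> \<le> K'"
    using compact_imp_bounded bounded_iff by (metis (mono_tags, lifting) imageI real_norm_def)
  have Fm: "F \<in> borel_measurable borel" using F by (rule borel_measurable_continuous_onI)
  have eq: "(\<lambda>s. indicator {t0..T} s *\<^sub>R (s powr (- \<beta>) * F (v s)))
      = (\<lambda>s. indicator {t0..T} s * (s powr (- \<beta>) * F (v (max t0 s))))"
    by (auto simp: fun_eq_iff indicator_def max_def)
  have "(\<lambda>s. F (v (max t0 s))) \<in> borel_measurable borel"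
    by (rule measurable_compose[OF cadlag_on_measurable[OF v] Fm])
  then have m: "(\<lambda>s. indicator {t0..T} s *\<^sub>R (s powr (- \<beta>) * F (v s))) \<in> borel_measurable lborel"
    unfolding eq by measurable
  show ?thesis
    unfolding set_integrable_def
  proof (rule integrableI_bounded_set[OF _ m, of "{t0..T}" "K' * K"])
    have "norm (indicator {t0..T} s *\<^sub>R (s powr (- \<beta>) * F (v s))) \<le> K' * K" if s: "s \<in> {t0..T}" for s
    proof -
      have "v s \<in> {- B..B}" using B(2)[OF s] by auto
      moreover have "0 \<le> K'" using K'[OF s] abs_ge_zero order_trans by blast
      ultimately have "\<bar>s powr (- \<beta>)\<bar> * \<bar>F (v s)\<bar> \<le> K' * K"
        using K K'[OF s] by (intro mult_mono) auto
      then show ?thesis using s by (simp add: abs_mult)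
    qed
    then show "AE s in lborel. s \<in> {t0..T} \<longrightarrow> norm (indicator {t0..T} s *\<^sub>R (s powr (- \<beta>) * F (v s))) \<le> K' * K" by auto
  qed (auto simp: emeasure_lborel_Icc_eq)
qed

lemma set_integral_nonneg:
  fixes f :: "_ \<Rightarrow> real"
  shows "(\<And>x. x \<in> A \<Longrightarrow> 0 \<le> f x) \<Longrightarrow> 0 \<le> (LINT x : A | M. f x)"
  unfolding set_lebesgue_integral_def
  by (intro Bochner_Integration.integral_nonneg) (auto simp: indicator_def)

lemma set_integral_mono_set:
  fixes f :: "_ \<Rightarrow> real"
  assumes f: "set_integrable M B f" and A: "A \<subseteq> B" "A \<in> sets M" and nonneg: "\<And>x. x \<in> B \<Longrightarrow> 0 \<le> f x"
  shows "(LINT x : A | M. f x) \<le> (LINT x : B | M. f x)"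
  unfolding set_lebesgue_integral_def
proof (rule integral_mono)
  show "integrable M (\<lambda>x. indicator A x *\<^sub>R f x)"
    using set_integrable_subset[OF f A(2,1)] by (simp add: set_integrable_def)
  show "integrable M (\<lambda>x. indicator B x *\<^sub>R f x)" using f by (simp add: set_integrable_def)
  show "indicator A x *\<^sub>R f x \<le> indicator B x *\<^sub>R f x" for x
    using A(1) nonneg by (auto simp: indicator_def)
qed

lemma set_integral_abs_le:
  fixes f g :: "real \<Rightarrow> real"
  assumes f: "set_integrable lborel {a..b} f" and g: "set_integrable lborel {a..b} g"
    and le: "\<And>s. s \<in> {a..b} \<Longrightarrow> \<bar>f s\<bar> \<le> g s"
  shows "\<bar>LINT s : {a..b} | lborel. f s\<bar> \<le> (LINT s : {a..b} | lborel. g s)"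
proof -
  have "\<bar>LINT s : {a..b} | lborel. f s\<bar> \<le> (LINT s : {a..b} | lborel. \<bar>f s\<bar>)"
    using set_integral_norm_bound[OF f] by simp
  also have "\<dots> \<le> (LINT s : {a..b} | lborel. g s)"
    by (rule set_integral_mono) (use f g le in \<open>auto intro: set_integrable_abs\<close>)
  finally show ?thesis .
qed

lemma set_integral_continuous:
  fixes f :: "real \<Rightarrow> real"
  assumes "set_integrable lborel {a..b} f"
  shows "continuous_on {a..b} (\<lambda>t. LINT s : {a..t} | lborel. f s)"
proof -
  have "set_integrable lborel {a..t} f" if "t \<in> {a..b}" for t
    by (rule set_integrable_subset[OF assms]) (use that in auto)
  then have "(LINT s : {a..t} | lborel. f s) = integral {a..t} f" if "t \<in> {a..b}" for t
    using that by (intro set_borel_integral_eq_integral(2)) auto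
  moreover have "continuous_on {a..b} (\<lambda>t. integral {a..t} f)"
    by (intro indefinite_integral_continuous_1 set_borel_integral_eq_integral(1) assms)
  ultimately show ?thesis by (subst continuous_on_cong) auto
qed

section \<open>A priori bounds on the velocity\<close>

text \<open>Past the level \<open>R\<close> the noise-free part of the solution has the sign of the solution, so that
  a restoring force can only bring it back.\<close>

lemma restoring_one_sided:
  fixes f v l :: "real \<Rightarrow> real"
  assumes int: "set_integrable lborel {t0..T} f"
    and eq: "\<And>t. t \<in> {t0..T} \<Longrightarrow> v t = v0 + l t - (LINT s : {t0..t} | lborel. f s)"
    and l: "\<And>t. t \<in> {t0..T} \<Longrightarrow> \<bar>l t\<bar> \<le> R"
    and sign: "\<And>t. t \<in> {t0..T} \<Longrightarrow> 0 < v t \<Longrightarrow> 0 \<le> f t"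
    and t: "t \<in> {t0..T}"
  shows "v t \<le> \<bar>v0\<bar> + 2 * R"
proof -
  \<comment> \<open>Without the noise the solution is continuous, whereas v may jump across any
    level; so the last time below the level is sought for W.\<close>
  define W where "W t = v0 - (LINT s : {t0..t} | lborel. f s)" for t
  have intt: "set_integrable lborel A f" if "A \<subseteq> {t0..T}" "A \<in> sets lborel" for A
    by (rule set_integrable_subset[OF int]) (use that in auto)
  have W0: "W t0 = v0"
    using set_borel_integral_eq_integral(2)[OF intt[of "{t0..t0}"]] t by (simp add: W_def)
  have R0: "0 \<le> R" using l[OF t] by linarith
  have "W t \<le> \<bar>v0\<bar> + R"
  proof (rule ccontr)
    assume "\<not> W t \<le> \<bar>v0\<bar> + R"
    then have Wt: "\<bar>v0\<bar> + R < W t" by simp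
    have cont: "continuous_on {t0..t} W"
      unfolding W_def
      by (intro continuous_on_diff continuous_on_const continuous_on_subset[OF set_integral_continuous[OF int]]) (use t in auto)
    \<comment> \<open>The maximum m of A is the last time up to t at which W is below the level.
      After m, W exceeds the level, which makes v positive since \<bar>l\<bar> \<le> R; then f is
      nonnegative and W cannot have grown since m.\<close>
    define A where "A = {t0..t} \<inter> W -` {..\<bar>v0\<bar> + R}"
    have "closed A" unfolding A_def by (rule continuous_closed_preimage[OF cont]) auto
    moreover have "bounded A" unfolding A_def by (rule bounded_subset[of "{t0..t}"]) auto
    ultimately have "compact A" by (simp add: compact_eq_bounded_closed)
    moreover have "t0 \<in> A" using t W0 R0 by (auto simp: A_def)
    ultimately obtain m where m: "m \<in> A" "\<And>s. s \<in> A \<Longrightarrow> s \<le> m"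
      using compact_attains_sup[of A] by blast
    have mt: "t0 \<le> m" "m \<le> t" "W m \<le> \<bar>v0\<bar> + R" using m(1) by (auto simp: A_def)
    have "0 \<le> f s" if s: "s \<in> {m<..t}" for s
    proof -
      have s': "s \<in> {t0..T}" using s mt t by auto
      have "s \<notin> A" using m(2)[of s] s by auto
      then have "\<bar>v0\<bar> + R < W s" using s mt by (auto simp: A_def)
      then have "0 < v s" using eq[OF s'] l[OF s'] by (simp add: W_def)
      then show ?thesis using sign s' by simp
    qed
    then have "0 \<le> (LINT s : {m<..t} | lborel. f s)"
      by (intro set_integral_nonneg) auto
    moreover have "(LINT s : {t0..m} \<union> {m<..t} | lborel. f s) = (LINT s : {t0..m} | lborel. f s) + (LINT s : {m<..t} | lborel. f s)"
      using t mt by (intro set_integral_Un intt) auto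
    moreover have "{t0..m} \<union> {m<..t} = {t0..t}" using mt by auto
    ultimately have "W t \<le> W m" by (simp add: W_def)
    then show False using mt Wt by simp
  qed
  then show ?thesis using eq[OF t] l[OF t] by (simp add: W_def)
qed

lemma restoring_bound:
  fixes f v l :: "real \<Rightarrow> real"
  assumes int: "set_integrable lborel {t0..T} f"
    and eq: "\<And>t. t \<in> {t0..T} \<Longrightarrow> v t = v0 + l t - (LINT s : {t0..t} | lborel. f s)"
    and l: "\<And>t. t \<in> {t0..T} \<Longrightarrow> \<bar>l t\<bar> \<le> R"
    and sign: "\<And>t. t \<in> {t0..T} \<Longrightarrow> 0 \<le> v t * f t"
    and t: "t \<in> {t0..T}"
  shows "\<bar>v t\<bar> \<le> \<bar>v0\<bar> + 2 * R"
proof -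
  have "v t \<le> \<bar>v0\<bar> + 2 * R"
  proof (rule restoring_one_sided[OF int eq l _ t])
    show "0 \<le> f t" if "t \<in> {t0..T}" "0 < v t" for t
      using sign[OF that(1)] that(2) by (simp add: zero_le_mult_iff)
  qed
  moreover have "- v t \<le> \<bar>- v0\<bar> + 2 * R"
  proof (rule restoring_one_sided[of t0 T "\<lambda>s. - f s" "\<lambda>s. - v s" "- v0" "\<lambda>s. - l s"])
    show "set_integrable lborel {t0..T} (\<lambda>s. - f s)" using int by (simp add: set_integrable_def)
    show "- v t = - v0 + - l t - (LINT s : {t0..t} | lborel. - f s)" if "t \<in> {t0..T}" for t
      using eq[OF that] by (simp add: set_lebesgue_integral_def)
    show "0 \<le> - f t" if "t \<in> {t0..T}" "0 < - v t" for t
      using sign[OF that(1)] that(2) by (auto simp: zero_le_mult_iff)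
  qed (use l t in auto)
  ultimately show ?thesis by (simp add: abs_le_iff)
qed

text \<open>If m exceeds 2 * A, then A is less than half of m, which leaves m \<le> 2 * I * m powr
  \<gamma>, that is m powr (1 - \<gamma>) \<le> 2 * I; since \<gamma> < 1 the root can be
  taken.\<close>

lemma sublinear_absorption:
  fixes m A I \<gamma> :: real
  assumes "0 \<le> m" "0 \<le> A" "0 \<le> I" "0 < \<gamma>" "\<gamma> < 1" and le: "m \<le> A + I * m powr \<gamma>"
  shows "m \<le> 2 * A + (2 * I) powr (1 / (1 - \<gamma>))"
proof (cases "m \<le> 2 * A")
  case True
  then show ?thesis by (smt (verit) powr_ge_zero)
next
  case False
  then have m: "0 < m" "m \<le> 2 * I * m powr \<gamma>" using assms by auto
  have "m powr (1 - \<gamma>) * m powr \<gamma> = m" using m(1) by (simp flip: powr_add)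
  then have "m powr (1 - \<gamma>) * m powr \<gamma> \<le> 2 * I * m powr \<gamma>" using m by simp
  then have "m powr (1 - \<gamma>) \<le> 2 * I" using m(1) by simp
  then have "(m powr (1 - \<gamma>)) powr (1 / (1 - \<gamma>)) \<le> (2 * I) powr (1 / (1 - \<gamma>))"
    using assms by (intro powr_mono2) auto
  then show ?thesis using m(1) assms by (simp add: powr_powr)
qed

text \<open>The supremum m of \<bar>v\<bar> over the whole horizon is finite because v is cadlag.
  Bounding the drift by m powr \<gamma> gives an inequality for m alone, which is solved at once
  instead of by iteration in time.\<close>

lemma sublinear_bound:
  fixes v l F :: "real \<Rightarrow> real"
  assumes v: "cadlag_on {t0..} v" and F: "continuous_on UNIV F" and t0: "0 < t0"
    and eq: "\<And>t. t0 \<le> t \<Longrightarrow> v t = v0 + l t - (LINT s : {t0..t} | lborel. s powr (- \<beta>) * F (v s))"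
    and l: "\<And>t. t \<in> {t0..T} \<Longrightarrow> \<bar>l t\<bar> \<le> R"
    and K: "0 \<le> K" "\<And>x. \<bar>F x\<bar> \<le> K * \<bar>x\<bar> powr \<gamma>" and \<gamma>: "0 < \<gamma>" "\<gamma> < 1"
    and I: "set_integrable lborel {t0..T} (\<lambda>s. s powr (- \<beta>))" "(LINT s : {t0..T} | lborel. s powr (- \<beta>)) \<le> I"
    and t: "t \<in> {t0..T}"
  shows "\<bar>v t\<bar> \<le> 2 * (\<bar>v0\<bar> + R) + (2 * (K * I)) powr (1 / (1 - \<gamma>))"
proof -
  have c: "cadlag_on {t0..T} v" by (rule cadlag_on_subset[OF v]) auto
  obtain B where B: "0 \<le> B" "\<And>s. s \<in> {t0..T} \<Longrightarrow> \<bar>v s\<bar> \<le> B" using cadlag_on_bounded[OF c] by metis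
  define m where "m = (SUP s\<in>{t0..T}. \<bar>v s\<bar>)"
  have bdd: "bdd_above ((\<lambda>s. \<bar>v s\<bar>) ` {t0..T})" using B(2) by (intro bdd_aboveI[of _ B]) auto
  have vm: "\<bar>v s\<bar> \<le> m" if "s \<in> {t0..T}" for s unfolding m_def by (rule cSUP_upper[OF that bdd])
  have m0: "0 \<le> m" using vm[OF t] by linarith
  have I0: "0 \<le> I"
    using I(2) set_integral_nonneg[of "{t0..T}" "\<lambda>s. s powr (- \<beta>)" lborel] by force
  have R0: "0 \<le> R" using l[OF t] by linarith
  have "\<bar>v u\<bar> \<le> (\<bar>v0\<bar> + R) + K * I * m powr \<gamma>" if u: "u \<in> {t0..T}" for u
  proof -
    have iu: "set_integrable lborel {t0..u} (\<lambda>s. s powr (- \<beta>))"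
      by (rule set_integrable_subset[OF I(1)]) (use u in auto)
    have "\<bar>LINT s : {t0..u} | lborel. s powr (- \<beta>) * F (v s)\<bar> \<le> (LINT s : {t0..u} | lborel. (K * m powr \<gamma>) * s powr (- \<beta>))"
    proof (rule set_integral_abs_le)
      show "set_integrable lborel {t0..u} (\<lambda>s. s powr (- \<beta>) * F (v s))" by (rule drift_set_integrable[OF v F t0])
      show "set_integrable lborel {t0..u} (\<lambda>s. (K * m powr \<gamma>) * s powr (- \<beta>))" using iu by simp
      fix s assume s: "s \<in> {t0..u}"
      have "\<bar>F (v s)\<bar> \<le> K * \<bar>v s\<bar> powr \<gamma>" by (rule K(2))
      also have "\<dots> \<le> K * m powr \<gamma>" using vm[of s] s u K(1) \<gamma> by (intro mult_left_mono powr_mono2) auto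
      finally have "\<bar>F (v s)\<bar> * s powr (- \<beta>) \<le> (K * m powr \<gamma>) * s powr (- \<beta>)"
        by (intro mult_right_mono) auto
      then show "\<bar>s powr (- \<beta>) * F (v s)\<bar> \<le> (K * m powr \<gamma>) * s powr (- \<beta>)"
        by (simp add: abs_mult mult.commute)
    qed
    also have "\<dots> = (K * m powr \<gamma>) * (LINT s : {t0..u} | lborel. s powr (- \<beta>))" by simp
    also have "(LINT s : {t0..u} | lborel. s powr (- \<beta>)) \<le> (LINT s : {t0..T} | lborel. s powr (- \<beta>))"
      using u I(1) by (intro set_integral_mono_set) auto
    then have "(K * m powr \<gamma>) * (LINT s : {t0..u} | lborel. s powr (- \<beta>)) \<le> (K * m powr \<gamma>) * I"
      using I(2) K(1) by (intro mult_left_mono) auto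
    finally have "\<bar>LINT s : {t0..u} | lborel. s powr (- \<beta>) * F (v s)\<bar> \<le> K * I * m powr \<gamma>" by (simp add: mult_ac)
    then show ?thesis using eq[of u] l[OF u] u by auto
  qed
  then have "m \<le> (\<bar>v0\<bar> + R) + K * I * m powr \<gamma>"
    unfolding m_def using t by (intro cSUP_least) auto
  then have "m \<le> 2 * (\<bar>v0\<bar> + R) + (2 * (K * I)) powr (1 / (1 - \<gamma>))"
    using m0 R0 I0 K(1) \<gamma> by (intro sublinear_absorption) auto
  then show ?thesis using vm[OF t] by linarith
qed

text \<open>C must depend neither on the path nor on T and R, because the bound is used for every
  \<omega> and at several horizons. The initial value is absorbed into T powr (1 / \<alpha>) through
  T \<ge> t0. In the sublinear case the condition on \<beta> leaves room for \<kappa> < (1 -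
  \<gamma>) / \<alpha>, so that the power T powr (\<kappa> / (1 - \<gamma>)) produced by absorption
  stays below T powr (1 / \<alpha>) up to a constant.\<close>

lemma velocity_bound:
  fixes F :: "real \<Rightarrow> real" and \<alpha> \<beta> \<gamma> t0 v0 :: real
  assumes \<alpha>: "0 < \<alpha>" and \<gamma>: "0 < \<gamma>" and F: "continuous_on UNIV F" and t0: "0 < t0"
    and hom: "\<And>v l. 0 < l \<Longrightarrow> F (l * v) = l powr \<gamma> * F v"
    and cases: "(\<forall>v. 0 \<le> v * F v) \<or> \<gamma> < 1 \<and> 1 + (\<gamma> - 1) / \<alpha> < \<beta>"
  obtains C where "0 < C"
    "\<And>v l T R t. cadlag_on {t0..} v \<Longrightarrow>
      (\<And>t. t0 \<le> t \<Longrightarrow> v t = v0 + (l t - l t0) - (LINT s : {t0..t} | lborel. s powr (- \<beta>) * F (v s))) \<Longrightarrow>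
      (\<And>s. s \<in> {0..T} \<Longrightarrow> \<bar>l s\<bar> \<le> R) \<Longrightarrow> t \<in> {t0..T} \<Longrightarrow> \<bar>v t\<bar> \<le> C * (T powr (1 / \<alpha>) + R)"
proof -
  define K where "K = \<bar>F 1\<bar> + \<bar>F (- 1)\<bar>"
  have K: "0 \<le> K" "\<And>x. \<bar>F x\<bar> \<le> K * \<bar>x\<bar> powr \<gamma>"
    using homogeneous_bound[OF hom \<gamma>] by (auto simp: K_def)
  define c0 where "c0 = t0 powr (1/\<alpha>)"
  have c0: "0 < c0" using t0 by (simp add: c0_def)
  have cT: "c0 \<le> T powr (1/\<alpha>)" if "t0 \<le> T" for T
    unfolding c0_def using that t0 \<alpha> by (intro powr_mono2) auto
  have vT: "\<bar>v0\<bar> \<le> \<bar>v0\<bar> / c0 * T powr (1/\<alpha>)" if "t0 \<le> T" for T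
  proof -
    have "\<bar>v0\<bar> = \<bar>v0\<bar> / c0 * c0" using c0 by simp
    also have "\<dots> \<le> \<bar>v0\<bar> / c0 * T powr (1/\<alpha>)" using cT[OF that] c0 by (intro mult_left_mono) auto
    finally show ?thesis .
  qed
  have incr: "\<bar>l s - l t0\<bar> \<le> 2 * R" if "\<And>s. s \<in> {0..T} \<Longrightarrow> \<bar>l s\<bar> \<le> R" "s \<in> {t0..T}" for l :: "real \<Rightarrow> real" and T R s
    using that(1)[of s] that(1)[of t0] that(2) t0 by auto
  from cases show thesis
  proof
    assume pos: "\<forall>v. 0 \<le> v * F v"
    show thesis
    proof (rule that[of "\<bar>v0\<bar> / c0 + 4"])
      show "0 < \<bar>v0\<bar> / c0 + 4" using c0 by (smt (verit) divide_nonneg_pos)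
      fix v l :: "real \<Rightarrow> real" and T R t
      assume v: "cadlag_on {t0..} v"
        and eq: "\<And>t. t0 \<le> t \<Longrightarrow> v t = v0 + (l t - l t0) - (LINT s : {t0..t} | lborel. s powr (- \<beta>) * F (v s))"
        and l: "\<And>s. s \<in> {0..T} \<Longrightarrow> \<bar>l s\<bar> \<le> R" and t: "t \<in> {t0..T}"
      have "\<bar>v t\<bar> \<le> \<bar>v0\<bar> + 2 * (2 * R)"
      proof (rule restoring_bound[OF drift_set_integrable[OF v F t0] _ _ _ t])
        show "v t = v0 + (l t - l t0) - (LINT s : {t0..t} | lborel. s powr (- \<beta>) * F (v s))" if "t \<in> {t0..T}" for t
          using eq that by auto
        show "\<bar>l t - l t0\<bar> \<le> 2 * R" if "t \<in> {t0..T}" for t using incr[OF l that] .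
        show "0 \<le> v t * (t powr (- \<beta>) * F (v t))" for t
          using pos[rule_format, of "v t"] mult_nonneg_nonneg[of "t powr (- \<beta>)" "v t * F (v t)"] by (simp add: mult_ac)
      qed
      moreover have "0 \<le> R" using l[of t] t t0 by force
      moreover have "0 \<le> \<bar>v0\<bar> / c0 * R" using c0 \<open>0 \<le> R\<close> by simp
      moreover have "0 \<le> T powr (1/\<alpha>)" by simp
      ultimately show "\<bar>v t\<bar> \<le> (\<bar>v0\<bar> / c0 + 4) * (T powr (1 / \<alpha>) + R)"
        using vT[of T] t unfolding distrib_left distrib_right atLeastAtMost_iff by linarith
    qed
  next
    assume "\<gamma> < 1 \<and> 1 + (\<gamma> - 1) / \<alpha> < \<beta>"
    then have \<gamma>1: "\<gamma> < 1" and \<beta>: "1 - \<beta> < (1 - \<gamma>) / \<alpha>"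
      by (auto simp: diff_divide_distrib)
    obtain \<kappa> where \<kappa>: "max 0 (1 - \<beta>) < \<kappa>" "\<kappa> < (1 - \<gamma>) / \<alpha>"
      using dense[of "max 0 (1 - \<beta>)" "(1 - \<gamma>) / \<alpha>"] \<beta> \<gamma>1 \<alpha> by auto
    obtain C1 where C1: "0 < C1" "\<And>T. t0 \<le> T \<Longrightarrow> set_integrable lborel {t0..T} (\<lambda>s. s powr (- \<beta>))"
      "\<And>T. t0 \<le> T \<Longrightarrow> (LINT s : {t0..T} | lborel. s powr (- \<beta>)) \<le> C1 * T powr \<kappa>"
      by (rule powr_integral_bound[of t0 \<kappa> \<beta>]) (use t0 \<kappa> in auto)
    define x where "x = \<kappa> / (1 - \<gamma>)"
    have x: "x < 1/\<alpha>" using \<kappa>(2) \<gamma>1 \<alpha> by (simp add: x_def field_simps)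
    define C2 where "C2 = (2 * (K * C1)) powr (1 / (1 - \<gamma>)) * t0 powr (x - 1/\<alpha>)"
    have C2: "0 \<le> C2" by (simp add: C2_def)
    show thesis
    proof (rule that[of "2 * (\<bar>v0\<bar> / c0) + 4 + C2"])
      show "0 < 2 * (\<bar>v0\<bar> / c0) + 4 + C2" using c0 C2 by (smt (verit) divide_nonneg_pos)
      fix v l :: "real \<Rightarrow> real" and T R t
      assume v: "cadlag_on {t0..} v"
        and eq: "\<And>t. t0 \<le> t \<Longrightarrow> v t = v0 + (l t - l t0) - (LINT s : {t0..t} | lborel. s powr (- \<beta>) * F (v s))"
        and l: "\<And>s. s \<in> {0..T} \<Longrightarrow> \<bar>l s\<bar> \<le> R" and t: "t \<in> {t0..T}"
      have T: "t0 \<le> T" using t by auto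
      have "\<bar>v t\<bar> \<le> 2 * (\<bar>v0\<bar> + 2 * R) + (2 * (K * (C1 * T powr \<kappa>))) powr (1 / (1 - \<gamma>))"
        by (rule sublinear_bound[OF v F t0 eq incr[OF l] K \<gamma> \<gamma>1 C1(2)[OF T] C1(3)[OF T] t]) auto
      also have "(2 * (K * (C1 * T powr \<kappa>))) powr (1 / (1 - \<gamma>)) = (2 * (K * C1)) powr (1 / (1 - \<gamma>)) * T powr x"
      proof -
        have "2 * (K * (C1 * T powr \<kappa>)) = (2 * (K * C1)) * T powr \<kappa>" by simp
        then show ?thesis using K(1) C1(1) by (simp only: powr_mult powr_powr x_def) simp
      qed
      also have "T powr x = T powr (x - 1/\<alpha>) * T powr (1/\<alpha>)" by (simp flip: powr_add)
      also have "T powr (x - 1/\<alpha>) \<le> t0 powr (x - 1/\<alpha>)" using T t0 x by (intro powr_mono2') auto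
      then have "(2 * (K * C1)) powr (1 / (1 - \<gamma>)) * (T powr (x - 1/\<alpha>) * T powr (1/\<alpha>)) \<le> C2 * T powr (1/\<alpha>)"
        unfolding C2_def mult.assoc by (intro mult_left_mono mult_right_mono) auto
      finally have "\<bar>v t\<bar> \<le> 2 * (\<bar>v0\<bar> + 2 * R) + C2 * T powr (1/\<alpha>)" by simp
      moreover have "0 \<le> R" using l[of t] t t0 by force
      moreover have "0 \<le> \<bar>v0\<bar> / c0 * R" "0 \<le> C2 * R" using c0 C2 \<open>0 \<le> R\<close> by simp_all
      moreover have "0 \<le> T powr (1/\<alpha>)" by simp
      ultimately show "\<bar>v t\<bar> \<le> (2 * (\<bar>v0\<bar> / c0) + 4 + C2) * (T powr (1 / \<alpha>) + R)"
        using vT[OF T] unfolding distrib_left distrib_right by linarith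
    qed
  qed
qed

text \<open>Inserting the growth of v leaves the integral of s powr (- p) with p = \<beta> -
  \<gamma> / \<alpha>, and the condition on \<beta> is exactly 1 - p < 1 / \<alpha>, which provides
  \<kappa>. The factor q in the growth assumption is reserved for the ratio of the time grid; the
  constants do not depend on it.\<close>

lemma drift_bound:
  fixes F :: "real \<Rightarrow> real" and \<alpha> \<beta> \<gamma> t0 :: real
  assumes \<alpha>: "0 < \<alpha>" and \<gamma>: "0 < \<gamma>" and F: "continuous_on UNIV F" and t0: "0 < t0"
    and hom: "\<And>v l. 0 < l \<Longrightarrow> F (l * v) = l powr \<gamma> * F v"
    and \<beta>: "1 + (\<gamma> - 1) / \<alpha> < \<beta>"
  obtains C \<kappa> where "0 \<le> C" "0 < \<kappa>" "\<kappa> < 1 / \<alpha>"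
    "\<And>v T q c t. cadlag_on {t0..} v \<Longrightarrow> 0 < q \<Longrightarrow> 0 \<le> c \<Longrightarrow>
      (\<And>s. s \<in> {t0..T} \<Longrightarrow> \<bar>v s\<bar> \<le> c * (s * q) powr (1 / \<alpha>)) \<Longrightarrow> t \<in> {t0..T} \<Longrightarrow>
      \<bar>LINT s : {t0..t} | lborel. s powr (- \<beta>) * F (v s)\<bar> \<le> C * c powr \<gamma> * q powr (\<gamma> / \<alpha>) * T powr \<kappa>"
proof -
  define K where "K = \<bar>F 1\<bar> + \<bar>F (- 1)\<bar>"
  have K: "0 \<le> K" "\<And>x. \<bar>F x\<bar> \<le> K * \<bar>x\<bar> powr \<gamma>"
    using homogeneous_bound[OF hom \<gamma>] by (auto simp: K_def)
  define p where "p = \<beta> - \<gamma> / \<alpha>"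
  have p: "1 - p < 1 / \<alpha>" using \<beta> by (simp add: p_def diff_divide_distrib)
  obtain \<kappa> where \<kappa>: "max 0 (1 - p) < \<kappa>" "\<kappa> < 1 / \<alpha>"
    using dense[of "max 0 (1 - p)" "1 / \<alpha>"] p \<alpha> by auto
  obtain C1 where C1: "0 < C1" "\<And>T. t0 \<le> T \<Longrightarrow> set_integrable lborel {t0..T} (\<lambda>s. s powr (- p))"
    "\<And>T. t0 \<le> T \<Longrightarrow> (LINT s : {t0..T} | lborel. s powr (- p)) \<le> C1 * T powr \<kappa>"
    by (rule powr_integral_bound[of t0 \<kappa> p]) (use t0 \<kappa> in auto)
  show thesis
  proof (rule that[of "K * C1" \<kappa>])
    fix v :: "real \<Rightarrow> real" and T q c t
    assume v: "cadlag_on {t0..} v" and q: "0 < q" and c: "0 \<le> c"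
      and le: "\<And>s. s \<in> {t0..T} \<Longrightarrow> \<bar>v s\<bar> \<le> c * (s * q) powr (1 / \<alpha>)" and t: "t \<in> {t0..T}"
    define A where "A = K * c powr \<gamma> * q powr (\<gamma> / \<alpha>)"
    have A: "0 \<le> A" using K(1) by (simp add: A_def)
    have tt: "t0 \<le> t" "t \<le> T" using t by auto
    have "\<bar>LINT s : {t0..t} | lborel. s powr (- \<beta>) * F (v s)\<bar> \<le> (LINT s : {t0..t} | lborel. A * s powr (- p))"
    proof (rule set_integral_abs_le)
      show "set_integrable lborel {t0..t} (\<lambda>s. s powr (- \<beta>) * F (v s))" by (rule drift_set_integrable[OF v F t0])
      show "set_integrable lborel {t0..t} (\<lambda>s. A * s powr (- p))" using C1(2)[OF tt(1)] by simp
      fix s assume s: "s \<in> {t0..t}"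
      then have s0: "0 < s" "s \<in> {t0..T}" using t0 tt by auto
      have "\<bar>F (v s)\<bar> \<le> K * \<bar>v s\<bar> powr \<gamma>" by (rule K(2))
      also have "\<dots> \<le> K * (c * (s * q) powr (1 / \<alpha>)) powr \<gamma>"
        using le[OF s0(2)] K(1) \<gamma> by (intro mult_left_mono powr_mono2) auto
      also have "(c * (s * q) powr (1 / \<alpha>)) powr \<gamma> = c powr \<gamma> * (s powr (\<gamma> / \<alpha>) * q powr (\<gamma> / \<alpha>))"
        using c s0 q by (simp add: powr_mult powr_powr)
      finally have "\<bar>F (v s)\<bar> \<le> A * s powr (\<gamma> / \<alpha>)" by (simp add: A_def mult_ac)
      then have "\<bar>s powr (- \<beta>) * F (v s)\<bar> \<le> s powr (- \<beta>) * (A * s powr (\<gamma> / \<alpha>))"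
        by (simp add: abs_mult mult_left_mono)
      also have "\<dots> = A * (s powr (- \<beta>) * s powr (\<gamma> / \<alpha>))" by simp
      also have "s powr (- \<beta>) * s powr (\<gamma> / \<alpha>) = s powr (- p)" by (simp add: p_def flip: powr_add)
      finally show "\<bar>s powr (- \<beta>) * F (v s)\<bar> \<le> A * s powr (- p)" .
    qed
    also have "\<dots> = A * (LINT s : {t0..t} | lborel. s powr (- p))" by simp
    also have "\<dots> \<le> A * (C1 * T powr \<kappa>)"
    proof (rule mult_left_mono[OF _ A])
      have "(LINT s : {t0..t} | lborel. s powr (- p)) \<le> C1 * t powr \<kappa>" by (rule C1(3)[OF tt(1)])
      also have "\<dots> \<le> C1 * T powr \<kappa>" using tt t0 C1(1) \<kappa>(1) by (intro mult_left_mono powr_mono2) auto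
      finally show "(LINT s : {t0..t} | lborel. s powr (- p)) \<le> C1 * T powr \<kappa>" .
    qed
    finally show "\<bar>LINT s : {t0..t} | lborel. s powr (- \<beta>) * F (v s)\<bar> \<le> K * C1 * c powr \<gamma> * q powr (\<gamma> / \<alpha>) * T powr \<kappa>"
      by (simp add: A_def mult_ac)
  qed (use K C1 \<kappa> in auto)
qed

section \<open>Path functionals and running suprema\<close>

lemma cadlag_on_cong: "(\<And>t. t \<in> I \<Longrightarrow> f t = g t) \<Longrightarrow> cadlag_on I f \<longleftrightarrow> cadlag_on I g"
  unfolding cadlag_on_def continuous_within
  by (intro ball_cong refl conj_cong ex_cong1 Lim_cong_within) auto

lemma continuous_on_cadlag:
  assumes "continuous_on I f" shows "cadlag_on I f"
proof -
  have "(f \<longlongrightarrow> f t) (at t within I)" if "t \<in> I" for t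
    using assms that by (auto simp: continuous_on_def)
  then show ?thesis
    unfolding cadlag_on_def continuous_within
    by (meson Int_lower1 tendsto_within_subset)
qed

lemma cadlag_on_restrict: "cadlag_on I f \<Longrightarrow> cadlag_on I (restrict f I)"
  by (subst cadlag_on_cong[of I _ f]) auto

lemma cadlag_on_rescale:
  assumes f: "cadlag_on {a..} f" and e: "0 < (e::real)"
  shows "cadlag_on {e * a..} (\<lambda>t. k * f (t / e))"
  unfolding cadlag_on_def
proof (intro ballI conjI)
  fix t assume t: "t \<in> {e * a..}"
  then have te: "t / e \<in> {a..}" using e by (simp add: field_simps)
  have tend: "((\<lambda>t. t / e) \<longlongrightarrow> t / e) (at t within S)" for S
    using e by (intro tendsto_intros) auto
  have "filterlim (\<lambda>t. t / e) (at (t / e) within {a..} \<inter> {t / e..}) (at t within {e * a..} \<inter> {t..})"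
    unfolding filterlim_at using tend e
    by (auto simp: eventually_at_filter field_simps divide_right_mono)
  moreover have "(f \<longlongrightarrow> f (t / e)) (at (t / e) within {a..} \<inter> {t / e..})"
    using f te unfolding cadlag_on_def continuous_within by blast
  ultimately have "((\<lambda>t. f (t / e)) \<longlongrightarrow> f (t / e)) (at t within {e * a..} \<inter> {t..})"
    by (rule filterlim_compose[rotated])
  then show "continuous (at t within {e * a..} \<inter> {t..}) (\<lambda>t. k * f (t / e))"
    unfolding continuous_within by (intro tendsto_intros)
  obtain l where l: "(f \<longlongrightarrow> l) (at (t / e) within {a..} \<inter> {..<t / e})"
    using f te unfolding cadlag_on_def by blast
  have "filterlim (\<lambda>t. t / e) (at (t / e) within {a..} \<inter> {..<t / e}) (at t within {e * a..} \<inter> {..<t})"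
    unfolding filterlim_at using tend e
    by (auto simp: eventually_at_filter field_simps divide_strict_right_mono)
  with l have "((\<lambda>t. f (t / e)) \<longlongrightarrow> l) (at t within {e * a..} \<inter> {..<t})"
    by (rule filterlim_compose)
  then have "((\<lambda>t. k * f (t / e)) \<longlongrightarrow> k * l) (at t within {e * a..} \<inter> {..<t})"
    by (intro tendsto_intros)
  then show "\<exists>l. ((\<lambda>t. k * f (t / e)) \<longlongrightarrow> l) (at t within {e * a..} \<inter> {..<t})" ..
qed

text \<open>Right continuity passes through the continuous nondecreasing map \<open>max a\<close>.
  To the left of t the path is constant if t \<le> a; otherwise the left limit only sees times above
  a.\<close>

lemma extended_path_cadlag:
  assumes f: "cadlag_on {a..} f"
  shows "extended_path a f \<in> cadlag_space"
proof -
  have "cadlag_on {0<..} (\<lambda>t. f (max a t))"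
    unfolding cadlag_on_def
  proof (intro ballI conjI)
    fix t :: real assume t: "t \<in> {0<..}"
    have "continuous (at (max a t) within {a..} \<inter> {max a t..}) f"
      using f unfolding cadlag_on_def by auto
    then have "continuous (at (max a t) within max a ` ({0<..} \<inter> {t..})) f"
      by (rule continuous_within_subset) auto
    moreover have "continuous (at t within {0<..} \<inter> {t..}) (max a)"
      by (intro continuous_intros)
    ultimately show "continuous (at t within {0<..} \<inter> {t..}) (\<lambda>t. f (max a t))"
      using continuous_within_compose[of t "{0<..} \<inter> {t..}" "max a" f] by (simp add: comp_def)
    show "\<exists>l. ((\<lambda>t. f (max a t)) \<longlongrightarrow> l) (at t within {0<..} \<inter> {..<t})"
    proof (cases "t \<le> a")
      case True
      have "((\<lambda>t. f a) \<longlongrightarrow> f a) (at t within {0<..} \<inter> {..<t})" by simp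
      also have "?this \<longleftrightarrow> ((\<lambda>t. f (max a t)) \<longlongrightarrow> f a) (at t within {0<..} \<inter> {..<t})"
        using True by (intro Lim_cong_within) (auto simp: max_def)
      finally show ?thesis ..
    next
      case False
      then have "t \<in> {a..}" by auto
      with f obtain l where "(f \<longlongrightarrow> l) (at t within {a..} \<inter> {..<t})"
        unfolding cadlag_on_def by blast
      also have "?this \<longleftrightarrow> ((\<lambda>t. f (max a t)) \<longlongrightarrow> l) (at t within {a..} \<inter> {..<t})"
        by (intro Lim_cong_within) (auto simp: max_def)
      also have "at t within {a..} \<inter> {..<t} = at t within {0<..} \<inter> {..<t}"
        by (rule at_within_nhd[of _ "{max a 0<..}"]) (use t False in auto)
      finally show ?thesis ..
    qed
  qed
  then show ?thesis
    using cadlag_on_restrict by (auto simp: extended_path_def cadlag_space_def)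
qed

definition path_pair :: "(real \<Rightarrow> real) \<Rightarrow> (real \<Rightarrow> real) \<times> (real \<Rightarrow> real)" where
  "path_pair f = (\<lambda>t\<in>{0<..}. f t, \<lambda>t\<in>{0<..}. LINT s : {0..t} | lborel. f s)"

lemma path_pair_paths2:
  assumes f: "cadlag_on {0..} f" shows "path_pair f \<in> paths2"
proof -
  have "continuous_on {0<..} (\<lambda>t. LINT s : {0..t} | lborel. f s)"
  proof (rule continuous_at_imp_continuous_on, rule ballI)
    fix t :: real assume t: "t \<in> {0<..}"
    have "continuous_on {0<..<t+1} (\<lambda>t. LINT s : {0..t} | lborel. f s)"
      by (rule continuous_on_subset[OF set_integral_continuous[OF cadlag_on_set_integrable[OF f, of "t + 1"]]]) auto
    then show "isCont (\<lambda>t. LINT s : {0..t} | lborel. f s) t"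
      using t by (simp add: continuous_on_eq_continuous_at)
  qed
  from cadlag_on_restrict[OF continuous_on_cadlag[OF this]]
  have "cadlag_on {0<..} (\<lambda>t\<in>{0<..}. LINT s : {0..t} | lborel. f s)" .
  moreover have "cadlag_on {0<..} (restrict f {0<..})"
    by (rule cadlag_on_restrict[OF cadlag_on_subset[OF f]]) auto
  ultimately show ?thesis
    by (simp only: path_pair_def paths2_def cadlag_space_def mem_Times_iff fst_conv snd_conv mem_Collect_eq)
      (simp only: restrict_extensional conj_absorb simp_thms)
qed

text \<open>The integral has to be a measurable function of the coordinates, although evaluation at
  a real time is not jointly measurable on all functions. For cadlag paths \<open>J w s\<close>, a
  limit of evaluations at dyadic times, equals \<open>w s\<close>, and J is jointly measurable in
  path and time, so that integration in s yields a measurable functional. \<Psi> is defined on all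
  of the product space, but agrees with \<open>path_pair\<close> only where J recovers the
  path.\<close>

lemma path_pair_functional:
  obtains \<Psi> where "\<Psi> \<in> Pi\<^sub>M {0..} (\<lambda>_. borel) \<rightarrow>\<^sub>M coords"
    "\<And>f. cadlag_on {0..} f \<Longrightarrow> \<Psi> (\<lambda>t\<in>{0..}. f t) = path_pair f"
proof -
  let ?W = "Pi\<^sub>M {0..} (\<lambda>_::real. borel :: real measure)"
  define J where "J w s = lim (\<lambda>k. w (max 0 (dyadic_ceiling k s)))" for w :: "real \<Rightarrow> real" and s
  have Jm: "(\<lambda>p. J (fst p) (snd p)) \<in> borel_measurable (?W \<Otimes>\<^sub>M lborel)"
    unfolding J_def
  proof (rule borel_measurable_lim_metric)
    fix k
    have "(\<lambda>p::(real \<Rightarrow> real) \<times> real. \<lceil>2 ^ k * snd p\<rceil>) \<in> ?W \<Otimes>\<^sub>M lborel \<rightarrow>\<^sub>M count_space UNIV"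
      by measurable
    moreover have "(\<lambda>p. fst p (max 0 (of_int i / 2 ^ k))) \<in> borel_measurable (?W \<Otimes>\<^sub>M lborel)" for i
      by (rule measurable_compose[OF measurable_fst]) (rule measurable_component_singleton, simp)
    ultimately have "(\<lambda>p::(real \<Rightarrow> real) \<times> real. fst p (max 0 (of_int \<lceil>2 ^ k * snd p\<rceil> / 2 ^ k))) \<in> borel_measurable (?W \<Otimes>\<^sub>M lborel)"
      using measurable_compose_countable[of "\<lambda>i p. fst p (max 0 (of_int i / 2 ^ k))" "?W \<Otimes>\<^sub>M lborel" borel] by simp
    then show "(\<lambda>p. fst p (max 0 (dyadic_ceiling k (snd p)))) \<in> borel_measurable (?W \<Otimes>\<^sub>M lborel)"
      by (simp add: dyadic_ceiling_def)
  qed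
  define G where "G t w = (LINT s|lborel. indicator {0..t} s * J w s)" for t w
  have Gm: "G t \<in> borel_measurable ?W" for t
    unfolding G_def
    by (rule lborel.borel_measurable_lebesgue_integral) (use Jm in \<open>simp add: split_beta'\<close>)
  define \<Psi> where "\<Psi> w = (\<lambda>t\<in>{0<..}. w t, \<lambda>t\<in>{0<..}. G t w)" for w :: "real \<Rightarrow> real"
  show thesis
  proof (rule that[of \<Psi>])
    show "\<Psi> \<in> ?W \<rightarrow>\<^sub>M coords"
      unfolding \<Psi>_def
      by (intro measurable_Pair measurable_restrict Gm measurable_component_singleton) auto
    fix f :: "real \<Rightarrow> real" assume f: "cadlag_on {0..} f"
    have J: "J (\<lambda>t\<in>{0..}. f t) s = f s" if s: "0 \<le> s" for s
    proof -
      have "cadlag_on {0..s+1} f" by (rule cadlag_on_subset[OF f]) auto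
      then have "(\<lambda>k. f (dyadic_ceiling k s)) \<longlonglongrightarrow> f s"
        using dyadic_ceiling_tendsto s by simp
      moreover have "(\<lambda>t\<in>{0..}. f t) (max 0 (dyadic_ceiling k s)) = f (dyadic_ceiling k s)" for k
        using dyadic_ceiling_bounds(1)[of s k] s by simp
      ultimately show ?thesis by (simp add: J_def limI)
    qed
    have "G t (\<lambda>t\<in>{0..}. f t) = (LINT s : {0..t} | lborel. f s)" for t
      unfolding G_def set_lebesgue_integral_def
      by (intro Bochner_Integration.integral_cong) (auto simp: indicator_def J)
    then show "\<Psi> (\<lambda>t\<in>{0..}. f t) = path_pair f"
      by (auto simp: \<Psi>_def path_pair_def restrict_def fun_eq_iff)
  qed
qed

lemma cadlag_process_restrict_measurable:
  "cadlag_process M {0..} X \<Longrightarrow> (\<lambda>\<omega>. \<lambda>t\<in>{0..}. X t \<omega>) \<in> M \<rightarrow>\<^sub>M Pi\<^sub>M {0..} (\<lambda>_. borel)"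
  by (intro measurable_restrict) (auto simp: cadlag_process_def)

lemma path_pair_measurable:
  assumes X: "cadlag_process M {0..} X"
  shows "(\<lambda>\<omega>. path_pair (\<lambda>t. X t \<omega>)) \<in> M \<rightarrow>\<^sub>M coords"
proof -
  obtain \<Psi> where \<Psi>: "\<Psi> \<in> Pi\<^sub>M {0..} (\<lambda>_. borel) \<rightarrow>\<^sub>M coords"
    "\<And>f. cadlag_on {0..} f \<Longrightarrow> \<Psi> (\<lambda>t\<in>{0..}. f t) = path_pair f"
    by (rule path_pair_functional) (rule that)
  have "(\<lambda>\<omega>. \<Psi> (\<lambda>t\<in>{0..}. X t \<omega>)) \<in> M \<rightarrow>\<^sub>M coords"
    by (rule measurable_compose[OF cadlag_process_restrict_measurable[OF X] \<Psi>(1)])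
  then show ?thesis
    by (rule measurable_cong[THEN iffD1, rotated]) (use X \<Psi>(2) in \<open>auto simp: cadlag_process_def\<close>)
qed

lemma path_pair_law:
  assumes X: "cadlag_process M {0..} X" and Y: "cadlag_process M' {0..} Y" and law: "same_law M X M' Y"
  shows "distr M coords (\<lambda>\<omega>. path_pair (\<lambda>t. X t \<omega>)) = distr M' coords (\<lambda>\<omega>. path_pair (\<lambda>t. Y t \<omega>))"
proof -
  obtain \<Psi> where \<Psi>: "\<Psi> \<in> Pi\<^sub>M {0..} (\<lambda>_. borel) \<rightarrow>\<^sub>M coords"
    "\<And>f. cadlag_on {0..} f \<Longrightarrow> \<Psi> (\<lambda>t\<in>{0..}. f t) = path_pair f"
    by (rule path_pair_functional) (rule that)
  have *: "distr M0 coords (\<lambda>\<omega>. path_pair (\<lambda>t. X0 t \<omega>))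
      = distr (distr M0 (Pi\<^sub>M {0..} (\<lambda>_. borel)) (\<lambda>\<omega>. \<lambda>t\<in>{0..}. X0 t \<omega>)) coords \<Psi>"
    if X0: "cadlag_process M0 {0..} X0" for M0 :: "'z measure" and X0
    unfolding distr_distr[OF \<Psi>(1) cadlag_process_restrict_measurable[OF X0]]
    by (rule distr_cong) (use X0 \<Psi>(2) in \<open>auto simp: cadlag_process_def\<close>)
  show ?thesis
    unfolding *[OF X] *[OF Y] law[unfolded same_law_def] ..
qed

text \<open>Right continuity decides the bound at s < T from dyadic times to the right of s, which
  are rational. The time T has to be added separately, as no such times of \<open>{0..T}\<close> lie
  to its right.\<close>

lemma cadlag_on_bound_countable:
  assumes f: "cadlag_on {0..} f" and T: "0 \<le> T"
  shows "(\<forall>s\<in>{0..T}. \<bar>f s\<bar> \<le> x) \<longleftrightarrow> (\<forall>s\<in>insert T (\<rat> \<inter> {0..T}). \<bar>f s\<bar> \<le> x)"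
proof
  assume R: "\<forall>s\<in>insert T (\<rat> \<inter> {0..T}). \<bar>f s\<bar> \<le> x"
  show "\<forall>s\<in>{0..T}. \<bar>f s\<bar> \<le> x"
  proof
    fix s assume s: "s \<in> {0..T}"
    show "\<bar>f s\<bar> \<le> x"
    proof (cases "s = T")
      case False
      then have sT: "0 \<le> s" "s < T" using s by auto
      have "cadlag_on {0..T} f" by (rule cadlag_on_subset[OF f]) auto
      then have lim: "(\<lambda>k. \<bar>f (dyadic_ceiling k s)\<bar>) \<longlonglongrightarrow> \<bar>f s\<bar>"
        using dyadic_ceiling_tendsto sT by (intro tendsto_rabs) auto
      have "\<forall>\<^sub>F k in sequentially. 1 / 2 ^ k < T - s"
        using sT by (intro eventually_inverse_pow2_less) auto
      then have "\<forall>\<^sub>F k in sequentially. \<bar>f (dyadic_ceiling k s)\<bar> \<le> x"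
      proof eventually_elim
        case (elim k)
        have "dyadic_ceiling k s \<in> \<rat>" unfolding dyadic_ceiling_def by simp
        moreover have "dyadic_ceiling k s \<in> {0..T}"
          using dyadic_ceiling_bounds[where t=s and k=k] sT elim by simp
        ultimately show ?case using R by blast
      qed
      with lim show ?thesis by (rule tendsto_upperbound) simp
    qed (use R in auto)
  qed
qed (use T in auto)

lemma sup_bound_law:
  assumes X: "cadlag_process M {0..} X" and Y: "cadlag_process M' {0..} Y" and law: "same_law M X M' Y" and T: "0 \<le> T"
  shows "{\<omega>\<in>space M. \<forall>s\<in>{0..T}. \<bar>X s \<omega>\<bar> \<le> x} \<in> sets M"
    "measure M {\<omega>\<in>space M. \<forall>s\<in>{0..T}. \<bar>X s \<omega>\<bar> \<le> x} = measure M' {\<omega>\<in>space M'. \<forall>s\<in>{0..T}. \<bar>Y s \<omega>\<bar> \<le> x}"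
proof -
  let ?W = "Pi\<^sub>M {0..} (\<lambda>_::real. borel :: real measure)"
  define D where "D = insert T (\<rat> \<inter> {0..T})"
  have D: "countable D" "D \<subseteq> {0..}" using T by (auto simp: D_def intro: countable_subset[OF _ countable_rat])
  define C where "C = {w\<in>space ?W. \<forall>s\<in>D. \<bar>w s\<bar> \<le> x}"
  have C: "C \<in> sets ?W"
    unfolding C_def
  proof (rule sets.sets_Collect_countable_All'[OF _ D(1)])
    fix s assume "s \<in> D"
    then have [measurable]: "(\<lambda>w. w s) \<in> borel_measurable ?W" using D by (intro measurable_component_singleton) auto
    show "{w \<in> space ?W. \<bar>w s\<bar> \<le> x} \<in> sets ?W" by measurable
  qed
  have pre: "{\<omega>\<in>space M0. \<forall>s\<in>{0..T}. \<bar>X0 s \<omega>\<bar> \<le> x} = (\<lambda>\<omega>. \<lambda>t\<in>{0..}. X0 t \<omega>) -` C \<inter> space M0"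
    if X0: "cadlag_process M0 {0..} X0" for M0 :: "'z measure" and X0
  proof -
    have "(\<forall>s\<in>{0..T}. \<bar>X0 s \<omega>\<bar> \<le> x) \<longleftrightarrow> (\<lambda>t\<in>{0..}. X0 t \<omega>) \<in> C" if "\<omega> \<in> space M0" for \<omega>
    proof -
      have "cadlag_on {0..} (\<lambda>t. X0 t \<omega>)" using X0 that by (auto simp: cadlag_process_def)
      from cadlag_on_bound_countable[OF this T, of x]
      have "(\<forall>s\<in>{0..T}. \<bar>X0 s \<omega>\<bar> \<le> x) \<longleftrightarrow> (\<forall>s\<in>D. \<bar>X0 s \<omega>\<bar> \<le> x)" by (simp add: D_def)
      also have "\<dots> \<longleftrightarrow> (\<forall>s\<in>D. \<bar>(\<lambda>t\<in>{0..}. X0 t \<omega>) s\<bar> \<le> x)" using D(2) by (intro ball_cong) auto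
      finally show ?thesis by (simp add: C_def space_PiM)
    qed
    then show ?thesis by blast
  qed
  show "{\<omega>\<in>space M. \<forall>s\<in>{0..T}. \<bar>X s \<omega>\<bar> \<le> x} \<in> sets M"
    unfolding pre[OF X] by (rule measurable_sets[OF cadlag_process_restrict_measurable[OF X] C])
  show "measure M {\<omega>\<in>space M. \<forall>s\<in>{0..T}. \<bar>X s \<omega>\<bar> \<le> x} = measure M' {\<omega>\<in>space M'. \<forall>s\<in>{0..T}. \<bar>Y s \<omega>\<bar> \<le> x}"
    unfolding pre[OF X] pre[OF Y]
    by (simp only: measure_distr[OF cadlag_process_restrict_measurable[OF X] C, symmetric]
        measure_distr[OF cadlag_process_restrict_measurable[OF Y] C, symmetric] law[unfolded same_law_def])
qed

lemma cadlag_process_rescale: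
  assumes L: "cadlag_process M {0..} L" and \<epsilon>: "0 < \<epsilon>"
  shows "cadlag_process M {0..} (\<lambda>t \<omega>. c * L (t / \<epsilon>) \<omega>)"
proof -
  have "L (t / \<epsilon>) \<in> borel_measurable M" if "0 \<le> t" for t
    using L that \<epsilon> by (simp add: cadlag_process_def)
  then have "(\<lambda>\<omega>. c * L (t / \<epsilon>) \<omega>) \<in> borel_measurable M" if "0 \<le> t" for t
    using that by (intro borel_measurable_times) auto
  then show ?thesis
    using L \<epsilon> cadlag_on_rescale[of 0 _ \<epsilon> c] by (auto simp: cadlag_process_def)
qed

text \<open>Self-similarity with \<epsilon> = 1 / T maps \<open>{0..T}\<close> to
  \<open>{0..1}\<close> and divides the level by T powr (1 / \<alpha>).\<close>

lemma self_similar_sup_bound: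
  assumes L: "cadlag_process M {0..} L"
    and ss: "\<And>\<epsilon>. 0 < \<epsilon> \<Longrightarrow> same_law M (\<lambda>t \<omega>. \<epsilon> powr (1/\<alpha>) * L (t / \<epsilon>) \<omega>) M L" and T: "0 < T"
  shows "measure M {\<omega>\<in>space M. \<forall>s\<in>{0..T}. \<bar>L s \<omega>\<bar> \<le> x * T powr (1/\<alpha>)}
    = measure M {\<omega>\<in>space M. \<forall>s\<in>{0..1}. \<bar>L s \<omega>\<bar> \<le> x}"
proof -
  have k: "(1 / T) powr (1/\<alpha>) = 1 / T powr (1/\<alpha>)" using T by (simp add: powr_divide)
  have Tp: "0 < T powr (1/\<alpha>)" using T by simp
  have "(\<forall>s\<in>{0..1}. \<bar>(1 / T) powr (1/\<alpha>) * L (s / (1 / T)) \<omega>\<bar> \<le> x) \<longleftrightarrow> (\<forall>s\<in>{0..T}. \<bar>L s \<omega>\<bar> \<le> x * T powr (1/\<alpha>))" for \<omega>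
  proof -
    have "(\<forall>s\<in>{0..1}. \<bar>(1 / T) powr (1/\<alpha>) * L (s / (1 / T)) \<omega>\<bar> \<le> x) \<longleftrightarrow> (\<forall>s\<in>{0..1}. \<bar>L (s * T) \<omega>\<bar> \<le> x * T powr (1/\<alpha>))"
      unfolding k using Tp by (simp add: abs_mult pos_divide_le_eq)
    also have "\<dots> \<longleftrightarrow> (\<forall>s\<in>(\<lambda>s. s * T) ` {0..1}. \<bar>L s \<omega>\<bar> \<le> x * T powr (1/\<alpha>))" by simp
    also have "(\<lambda>s. s * T) ` {0..1} = {0..T}"
    proof
      show "(\<lambda>s. s * T) ` {0..1} \<subseteq> {0..T}" using T by (auto simp: mult_left_le_one_le)
      show "{0..T} \<subseteq> (\<lambda>s. s * T) ` {0..1}"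
        using T by (auto intro!: image_eqI[of _ _ "_ / T"] simp: divide_le_eq)
    qed
    finally show ?thesis .
  qed
  then show ?thesis
    using sup_bound_law(2)[OF cadlag_process_rescale[OF L] L ss[of "1 / T"], of 1 x] T by simp
qed

lemma sup_bound_tight:
  assumes M: "prob_space M" and L: "cadlag_process M {0..} L" and e: "0 < e"
  obtains n :: nat where "1 - e < measure M {\<omega>\<in>space M. \<forall>s\<in>{0..1}. \<bar>L s \<omega>\<bar> \<le> real n}"
proof -
  interpret prob_space M by fact
  define A where "A n = {\<omega>\<in>space M. \<forall>s\<in>{0..1}. \<bar>L s \<omega>\<bar> \<le> real n}" for n
  have "same_law M L M L" by (simp add: same_law_def)
  then have A: "A n \<in> sets M" for n unfolding A_def by (intro sup_bound_law(1)[OF L L]) auto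
  have "(\<lambda>n. prob (A n)) \<longlonglongrightarrow> prob (\<Union>n. A n)"
    by (rule finite_Lim_measure_incseq) (use A in \<open>auto simp: A_def incseq_def intro: order_trans\<close>)
  also have "(\<Union>n. A n) = space M"
  proof
    show "space M \<subseteq> (\<Union>n. A n)"
    proof
      fix \<omega> assume \<omega>: "\<omega> \<in> space M"
      then have "cadlag_on {0..1} (\<lambda>t. L t \<omega>)"
        using L by (auto simp: cadlag_process_def intro: cadlag_on_subset)
      then obtain B where B: "\<And>s. s \<in> {0..1} \<Longrightarrow> \<bar>L s \<omega>\<bar> \<le> B" using cadlag_on_bounded by metis
      obtain n :: nat where n: "B \<le> real n" using real_arch_simple by blast
      have "\<bar>L s \<omega>\<bar> \<le> real n" if "s \<in> {0..1}" for s using B[OF that] n by linarith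
      then have "\<omega> \<in> A n" using \<omega> by (auto simp: A_def)
      then show "\<omega> \<in> (\<Union>n. A n)" by blast
    qed
  qed (auto simp: A_def)
  finally have "(\<lambda>n. prob (A n)) \<longlonglongrightarrow> 1" by (simp add: prob_space)
  then have "\<forall>\<^sub>F n in sequentially. 1 - e < prob (A n)" using e by (intro order_tendstoD(1)) auto
  then show thesis using that by (auto simp: eventually_sequentially A_def)
qed

section \<open>The drift is negligible\<close>

text \<open>Substitution turns the second integral into e * k times the integral of l over
  \<open>{0..t / e}\<close>. The discrepancy then has three sources: the initial position, the
  interval \<open>{0..t0}\<close> where only l is integrated and r bounds it, and the remaining
  interval where v and l differ by at most \<psi> / k.\<close>

lemma rescaled_position_close:
  fixes v l :: "real \<Rightarrow> real"
  assumes v: "cadlag_on {t0..} v" and l: "cadlag_on {0..} l" and t0: "0 < t0" and e: "0 < e" and k: "0 < k"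
    and r: "\<And>s. s \<in> {0..t0} \<Longrightarrow> \<bar>l s\<bar> \<le> r" and \<psi>: "0 \<le> \<psi>" "\<And>s. s \<in> {t0..t / e} \<Longrightarrow> k * \<bar>v s - l s\<bar> \<le> \<psi>"
    and t: "0 < t"
  shows "\<bar>e * k * (x0 + (LINT s : {t0..t / e} | lborel. v s)) - (LINT s : {0..t} | lborel. k * l (s / e))\<bar>
    \<le> e * k * (\<bar>x0\<bar> + t0 * r) + t * \<psi>"
proof -
  define \<tau> where "\<tau> = t / e"
  have \<tau>: "0 < \<tau>" using t e by (simp add: \<tau>_def)
  have r0: "0 \<le> r" using r[of 0] t0 by simp
  have "(LINT s : {0..t} | lborel. k * l (s / e)) = (LINT s|lborel. indicator {0..t} s * (k * l (s / e)))"
    by (simp only: set_lebesgue_integral_def real_scaleR_def)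
  also have "\<dots> = \<bar>e\<bar> *\<^sub>R (LINT s|lborel. indicator {0..t} (0 + e * s) * (k * l ((0 + e * s) / e)))"
    by (rule lborel_integral_real_affine) (use e in simp)
  also have "(LINT s|lborel. indicator {0..t} (0 + e * s) * (k * l ((0 + e * s) / e))) = (LINT s|lborel. k * (indicator {0..\<tau>} s * l s))"
    using e by (intro Bochner_Integration.integral_cong)
      (auto simp: indicator_def \<tau>_def pos_le_divide_eq zero_le_mult_iff mult.commute)
  finally have L: "(LINT s : {0..t} | lborel. k * l (s / e)) = e * k * (LINT s|lborel. indicator {0..\<tau>} s * l s)"
    using e by simp
  have il: "integrable lborel (\<lambda>s. indicator {0..\<tau>} s * l s)"
    using cadlag_on_set_integrable[OF l, of \<tau>] by (simp add: set_integrable_def)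
  have iv: "integrable lborel (\<lambda>s. indicator {t0..\<tau>} s * v s)"
    using cadlag_on_set_integrable[OF v, of \<tau>] by (simp add: set_integrable_def)
  have ig: "integrable lborel (\<lambda>s. r * indicator {0..t0} s + (\<psi> / k) * indicator {0..\<tau>} s)"
    by (intro Bochner_Integration.integrable_add integrable_mult_right integrable_real_indicator)
      (auto simp: emeasure_lborel_Icc_eq)
  have g: "(LINT s|lborel. r * indicator {0..t0} s + (\<psi> / k) * indicator {0..\<tau>} s) = r * t0 + (\<psi> / k) * \<tau>"
    using t0 \<tau> by simp
  have "\<bar>(LINT s|lborel. indicator {t0..\<tau>} s * v s) - (LINT s|lborel. indicator {0..\<tau>} s * l s)\<bar>
      = \<bar>LINT s|lborel. indicator {t0..\<tau>} s * v s - indicator {0..\<tau>} s * l s\<bar>"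
    using il iv by simp
  also have "\<dots> \<le> (LINT s|lborel. r * indicator {0..t0} s + (\<psi> / k) * indicator {0..\<tau>} s)"
    unfolding real_norm_def[symmetric]
  proof (rule Bochner_Integration.integral_norm_bound_integral)
    show "integrable lborel (\<lambda>s. indicator {t0..\<tau>} s * v s - indicator {0..\<tau>} s * l s)" using il iv by simp
    fix s
    have vs: "\<bar>v s - l s\<bar> \<le> \<psi> / k" if "s \<in> {t0..\<tau>}"
      using \<psi>(2)[of s] that k by (simp add: \<tau>_def pos_le_divide_eq mult.commute)
    have \<psi>k: "0 \<le> \<psi> / k" using \<psi> k by simp
    consider "s < 0" | "0 \<le> s" "s < t0" | "t0 \<le> s" by linarith
    then show "norm (indicator {t0..\<tau>} s * v s - indicator {0..\<tau>} s * l s) \<le> r * indicator {0..t0} s + (\<psi> / k) * indicator {0..\<tau>} s"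
    proof cases
      case 1
      then show ?thesis using t0 by simp
    next
      case 2
      then show ?thesis using r[of s] r0 \<psi>k by (auto simp: indicator_def)
    next
      case 3
      then show ?thesis using vs r0 t0 by (auto simp: indicator_def)
    qed
  qed (rule ig)
  also note g
  finally have main: "\<bar>(LINT s : {t0..\<tau>} | lborel. v s) - (LINT s|lborel. indicator {0..\<tau>} s * l s)\<bar> \<le> r * t0 + (\<psi> / k) * \<tau>"
    by (simp add: set_lebesgue_integral_def)
  have "\<bar>e * k * (x0 + (LINT s : {t0..\<tau>} | lborel. v s)) - e * k * (LINT s|lborel. indicator {0..\<tau>} s * l s)\<bar>
      = e * k * \<bar>x0 + ((LINT s : {t0..\<tau>} | lborel. v s) - (LINT s|lborel. indicator {0..\<tau>} s * l s))\<bar>"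
    using e k by (simp add: abs_mult flip: right_diff_distrib add_diff_eq)
  also have "\<dots> \<le> e * k * (\<bar>x0\<bar> + (r * t0 + (\<psi> / k) * \<tau>))"
    using main e k by (intro mult_left_mono) auto
  also have "\<dots> = e * k * (\<bar>x0\<bar> + t0 * r) + t * \<psi>"
    using e k by (simp add: \<tau>_def field_simps)
  finally show ?thesis unfolding L \<tau>_def .
qed

text \<open>On the geometric grid \<open>t0 Q\<^sup>j\<^sup>/\<^sup>J\<close>, tightness of the running supremum of \<open>l\<close> at finitely many
  times controls \<open>l\<close> at all times up to the small factor \<open>Q\<^sup>1\<^sup>/\<^sup>J\<close>: no tail estimate is needed.\<close>

lemma velocity_bound_grid:
  fixes v l :: "real \<Rightarrow> real"
  assumes C: "0 \<le> C" "\<And>T R t. (\<And>s. s \<in> {0..T} \<Longrightarrow> \<bar>l s\<bar> \<le> R) \<Longrightarrow> t \<in> {t0..T} \<Longrightarrow> \<bar>v t\<bar> \<le> C * (T powr (1 / \<alpha>) + R)"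
    and t0: "0 < t0" and \<alpha>: "0 < \<alpha>" and Q: "1 \<le> Q" and J: "0 < J" and c: "0 \<le> c"
    and l: "\<And>j s. j \<le> J \<Longrightarrow> s \<in> {0..t0 * Q powr (real j / real J)} \<Longrightarrow> \<bar>l s\<bar> \<le> c * (t0 * Q powr (real j / real J)) powr (1 / \<alpha>)"
    and s: "s \<in> {t0..t0 * Q}"
  shows "\<bar>v s\<bar> \<le> C * (1 + c) * (s * Q powr (1 / real J)) powr (1 / \<alpha>)"
proof -
  define T where "T j = t0 * Q powr (real j / real J)" for j :: nat
  have TJ: "T J = t0 * Q" using J Q by (simp add: T_def)
  \<comment> \<open>The first grid time not before s. Its predecessor lies before s, so it exceeds s
    at most by the grid ratio; for j = 0 the grid time is t0, which is at most s.\<close>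
  define j where "j = (LEAST j. s \<le> T j)"
  have sj: "s \<le> T j" unfolding j_def by (rule LeastI[of _ J]) (use s TJ in auto)
  have jJ: "j \<le> J" unfolding j_def by (rule Least_le) (use s TJ in auto)
  have Ts: "T j \<le> s * Q powr (1 / real J)"
  proof (cases j)
    case 0
    have "1 \<le> Q powr (1 / real J)" using Q by (intro ge_one_powr_ge_zero) auto
    then have "t0 * 1 \<le> s * Q powr (1 / real J)" using s t0 by (intro mult_mono) auto
    then show ?thesis using 0 Q by (simp add: T_def)
  next
    case (Suc i)
    then have "\<not> s \<le> T i" unfolding j_def by (metis lessI not_less_Least)
    then have "T i * Q powr (1 / real J) \<le> s * Q powr (1 / real J)" by (intro mult_right_mono) auto
    moreover have "T i * Q powr (1 / real J) = T j"
      using Suc by (simp add: T_def mult.assoc add_divide_distrib flip: powr_add) (simp add: add.commute)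
    ultimately show ?thesis by simp
  qed
  have "\<bar>v s\<bar> \<le> C * (T j powr (1 / \<alpha>) + c * T j powr (1 / \<alpha>))"
    by (rule C(2)) (use l[OF jJ] s sj in \<open>auto simp: T_def\<close>)
  also have "\<dots> = C * (1 + c) * T j powr (1 / \<alpha>)" by (simp add: algebra_simps)
  also have "\<dots> \<le> C * (1 + c) * (s * Q powr (1 / real J)) powr (1 / \<alpha>)"
    using Ts C(1) c \<alpha> t0 by (intro mult_left_mono powr_mono2) (auto simp: T_def)
  finally show ?thesis .
qed

lemma powr_tendsto_0_at_right: "0 < p \<Longrightarrow> ((\<lambda>e::real. e powr p) \<longlongrightarrow> 0) (at_right 0)"
proof (rule tendsto_zero_powrI[OF _ tendsto_const])
  show "\<forall>\<^sub>F e::real in at_right 0. 0 \<le> e"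
    using eventually_at_right_less[of "0::real"] by eventually_elim simp
qed (auto intro!: tendsto_intros)

text \<open>All constants of the pathwise bounds are deterministic, so one pair of deterministic
  errors \<psi> \<epsilon> and \<phi> \<epsilon> serves every \<omega> of the good event G. On G the
  drift up to time b / \<epsilon> is at most a constant times
  \<open>\<epsilon> powr (- \<kappa> - g)\<close>, which the scaling factor \<epsilon> powr (1 /
  \<alpha>) beats.\<close>

lemma drift_negligible:
  fixes M :: "'a measure" and L V X :: "real \<Rightarrow> 'a \<Rightarrow> real" and F :: "real \<Rightarrow> real"
  assumes \<alpha>: "0 < \<alpha>" and \<gamma>: "0 < \<gamma>" and \<beta>: "1 + (\<gamma> - 1) / \<alpha> < \<beta>"
    and F: "continuous_on UNIV F" and hom: "\<And>v l. 0 < l \<Longrightarrow> F (l * v) = l powr \<gamma> * F v"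
    and cases: "(\<forall>v. 0 \<le> v * F v) \<or> \<gamma> < 1"
    and M: "prob_space M" and L: "cadlag_process M {0..} L" and t0: "0 < t0"
    and ss: "\<And>\<epsilon>. 0 < \<epsilon> \<Longrightarrow> same_law M (\<lambda>t \<omega>. \<epsilon> powr (1/\<alpha>) * L (t / \<epsilon>) \<omega>) M L"
    and sol: "kinetic_solution M \<F> L \<beta> F t0 v0 x0 V X"
    and a: "0 < a" and \<eta>: "0 < \<eta>" and b: "0 < b"
  shows "\<forall>\<^sub>F \<epsilon> in at_right 0. \<exists>G\<in>sets M. 1 - \<eta> \<le> measure M G \<and> (\<forall>\<omega>\<in>G.
    \<forall>t\<in>{\<epsilon> * t0..b}. \<bar>\<epsilon> powr (1/\<alpha>) * V (t / \<epsilon>) \<omega> - \<epsilon> powr (1/\<alpha>) * L (t / \<epsilon>) \<omega>\<bar> \<le> a \<and>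
      \<bar>\<epsilon> powr (1 + 1/\<alpha>) * X (t / \<epsilon>) \<omega> - (LINT s : {0..t} | lborel. \<epsilon> powr (1/\<alpha>) * L (s / \<epsilon>) \<omega>)\<bar> \<le> a)"
proof -
  interpret prob_space M by fact
  have cV: "cadlag_process M {t0..} V" and
    ae: "AE \<omega> in M. \<forall>t\<ge>t0.
        V t \<omega> = v0 + (L t \<omega> - L t0 \<omega>) - (LINT s : {t0..t} | lborel. s powr (- \<beta>) * F (V s \<omega>)) \<and>
        X t \<omega> = x0 + (LINT s : {t0..t} | lborel. V s \<omega>)"
    using sol unfolding kinetic_solution_def by blast+
  \<comment> \<open>The set where the equations hold is not known to be measurable; E is a
    measurable part of it with full probability.\<close>
  obtain E where E: "E \<in> sets M" "prob E = 1" and eqs: "\<And>\<omega> t. \<omega> \<in> E \<Longrightarrow> t0 \<le> t \<Longrightarrow>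
        V t \<omega> = v0 + (L t \<omega> - L t0 \<omega>) - (LINT s : {t0..t} | lborel. s powr (- \<beta>) * F (V s \<omega>)) \<and>
        X t \<omega> = x0 + (LINT s : {t0..t} | lborel. V s \<omega>)"
  proof -
    from AE_E_prob[OF ae] obtain S where "S \<subseteq> {\<omega>\<in>space M. \<forall>t\<ge>t0.
        V t \<omega> = v0 + (L t \<omega> - L t0 \<omega>) - (LINT s : {t0..t} | lborel. s powr (- \<beta>) * F (V s \<omega>)) \<and>
        X t \<omega> = x0 + (LINT s : {t0..t} | lborel. V s \<omega>)}" "S \<in> sets M" "prob S = 1" .
    then show thesis by (intro that[of S]) auto
  qed
  obtain C where C: "0 < C"
    "\<And>v l T R t. cadlag_on {t0..} v \<Longrightarrow>
      (\<And>t. t0 \<le> t \<Longrightarrow> v t = v0 + (l t - l t0) - (LINT s : {t0..t} | lborel. s powr (- \<beta>) * F (v s))) \<Longrightarrow>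
      (\<And>s. s \<in> {0..T} \<Longrightarrow> \<bar>l s\<bar> \<le> R) \<Longrightarrow> t \<in> {t0..T} \<Longrightarrow> \<bar>v t\<bar> \<le> C * (T powr (1 / \<alpha>) + R)"
    by (rule velocity_bound[of \<alpha> \<gamma> F t0 \<beta> v0, OF \<alpha> \<gamma> F t0 hom]) (use cases \<beta> in \<open>auto intro: that\<close>)
  obtain D \<kappa> where D: "0 \<le> D" "0 < \<kappa>" "\<kappa> < 1 / \<alpha>"
    "\<And>v T q c t. cadlag_on {t0..} v \<Longrightarrow> 0 < q \<Longrightarrow> 0 \<le> c \<Longrightarrow>
      (\<And>s. s \<in> {t0..T} \<Longrightarrow> \<bar>v s\<bar> \<le> c * (s * q) powr (1 / \<alpha>)) \<Longrightarrow> t \<in> {t0..T} \<Longrightarrow>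
      \<bar>LINT s : {t0..t} | lborel. s powr (- \<beta>) * F (v s)\<bar> \<le> D * c powr \<gamma> * q powr (\<gamma> / \<alpha>) * T powr \<kappa>"
    by (rule drift_bound[of \<alpha> \<gamma> F t0 \<beta>, OF \<alpha> \<gamma> F t0 hom \<beta>]) (auto intro: that)
  \<comment> \<open>The ratio of a grid with J steps costs the exponent \<gamma> / (\<alpha> J),
    which must fit into the gap between \<kappa> and 1 / \<alpha>.\<close>
  obtain J :: nat where J: "0 < J" "\<gamma> / \<alpha> / real J < 1 / \<alpha> - \<kappa>"
  proof -
    have pos: "0 < 1 / \<alpha> - \<kappa>" using D(3) by simp
    obtain n :: nat where "\<gamma> / \<alpha> / (1 / \<alpha> - \<kappa>) < real n" using reals_Archimedean2 by blast
    then have "\<gamma> / \<alpha> / (1 / \<alpha> - \<kappa>) < real (Suc n)" by (rule less_trans) simp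
    then have "\<gamma> / \<alpha> < real (Suc n) * (1 / \<alpha> - \<kappa>)" by (simp only: pos_divide_less_eq[OF pos])
    then have "\<gamma> / \<alpha> / real (Suc n) < 1 / \<alpha> - \<kappa>"
      by (subst pos_divide_less_eq) (simp_all only: mult.commute of_nat_0_less_iff zero_less_Suc)
    then show thesis by (intro that[of "Suc n"]) auto
  qed
  define g where "g = \<gamma> / \<alpha> / real J"
  have g: "0 < 1 / \<alpha> - \<kappa> - g" using J by (simp add: g_def)
  \<comment> \<open>By self-similarity this level has the same probability at every grid time after
    rescaling; the J + 1 exceptional events together then have probability at most \<eta>.\<close>
  obtain n :: nat where n: "1 - \<eta> / (real J + 1) < prob {\<omega>\<in>space M. \<forall>s\<in>{0..1}. \<bar>L s \<omega>\<bar> \<le> real n}"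
    by (rule sup_bound_tight[OF M L, of "\<eta> / (real J + 1)"]) (use \<eta> in \<open>auto intro: that\<close>)
  define c where "c = real n"
  have c: "0 \<le> c" by (simp add: c_def)
  define A where "A = D * (C * (1 + c)) powr \<gamma> * (b / t0) powr g * b powr \<kappa>"
  define r where "r = c * t0 powr (1/\<alpha>)"
  \<comment> \<open>\<psi> bounds the rescaled difference of V and L: the first term comes from v0
    and L at t0, where r is the bound at the grid time j = 0, and the second from the drift. \<phi>
    is the resulting error for the position at times up to b.\<close>
  define \<psi> where "\<psi> \<epsilon> = \<epsilon> powr (1/\<alpha>) * (\<bar>v0\<bar> + r) + A * \<epsilon> powr (1 / \<alpha> - \<kappa> - g)" for \<epsilon>
  define \<phi> where "\<phi> \<epsilon> = \<epsilon> powr (1 + 1/\<alpha>) * (\<bar>x0\<bar> + t0 * r) + b * \<psi> \<epsilon>" for \<epsilon>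
  have \<psi>0: "(\<psi> \<longlongrightarrow> 0) (at_right 0)"
    unfolding \<psi>_def using \<alpha> g
    by (auto intro!: tendsto_add_zero tendsto_mult_left_zero tendsto_mult_right_zero powr_tendsto_0_at_right)
  have \<phi>0: "(\<phi> \<longlongrightarrow> 0) (at_right 0)"
    unfolding \<phi>_def using \<alpha> \<psi>0
    by (auto intro!: tendsto_add_zero tendsto_mult_left_zero tendsto_mult_right_zero powr_tendsto_0_at_right simp: add_pos_pos)
  have "\<forall>\<^sub>F \<epsilon> in at_right 0. \<epsilon> \<in> {0<..<b / t0}"
    using b t0 by (intro eventually_at_right_real) auto
  moreover have "\<forall>\<^sub>F \<epsilon> in at_right 0. \<psi> \<epsilon> < a" "\<forall>\<^sub>F \<epsilon> in at_right 0. \<phi> \<epsilon> < a"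
    using order_tendstoD(2)[OF \<psi>0 a] order_tendstoD(2)[OF \<phi>0 a] .
  ultimately show ?thesis
  proof eventually_elim
    case (elim \<epsilon>)
    have \<epsilon>: "0 < \<epsilon>" using elim by auto
    define k where "k = \<epsilon> powr (1/\<alpha>)"
    have k: "0 < k" using \<epsilon> by (simp add: k_def)
    define Q where "Q = b / (\<epsilon> * t0)"
    have Q: "1 \<le> Q" using elim t0 \<epsilon> by (simp add: Q_def field_simps)
    have t0Q: "t0 * Q = b / \<epsilon>" using t0 by (simp add: Q_def)
    define T where "T j = t0 * Q powr (real j / real J)" for j :: nat
    have T: "0 < T j" for j using t0 Q by (simp add: T_def)
    define B where "B j = {\<omega>\<in>space M. \<forall>s\<in>{0..T j}. \<bar>L s \<omega>\<bar> \<le> c * T j powr (1/\<alpha>)}" for j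
    have law: "same_law M L M L" by (simp add: same_law_def)
    have B: "B j \<in> sets M" for j unfolding B_def by (rule sup_bound_law(1)[OF L L law less_imp_le[OF T]])
    have pB: "1 - \<eta> / (real J + 1) < prob (B j)" for j
      using n self_similar_sup_bound[OF L ss T[of j], where x=c] by (simp add: B_def c_def)
    define G where "G = E \<inter> (\<Inter>j\<in>{..J}. B j)"
    have G: "G \<in> sets M" unfolding G_def using E(1) B by (intro sets.Int sets.finite_INT) auto
    have "prob (space M - G) \<le> prob ((space M - E) \<union> (\<Union>j\<in>{..J}. space M - B j))"
      using E(1) B by (intro finite_measure_mono) (auto simp: G_def)
    also have "\<dots> \<le> prob (space M - E) + prob (\<Union>j\<in>{..J}. space M - B j)"
      using E(1) B by (intro measure_Un_le) auto
    also have "prob (\<Union>j\<in>{..J}. space M - B j) \<le> (\<Sum>j\<in>{..J}. prob (space M - B j))"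
      using B by (intro measure_UNION_le) auto
    also have "\<dots> \<le> (\<Sum>j\<in>{..J}. \<eta> / (real J + 1))"
      using pB B by (intro sum_mono) (simp add: prob_compl less_imp_le algebra_simps)
    also have "\<dots> = \<eta>"
    proof -
      have "real J + 1 \<noteq> 0" by simp
      then show ?thesis by (simp add: field_simps)
    qed
    also have "prob (space M - E) = 0" using E by (simp add: prob_compl)
    finally have pG: "1 - \<eta> \<le> prob G" using G by (simp add: prob_compl)
    have "\<bar>\<epsilon> powr (1/\<alpha>) * V (t / \<epsilon>) \<omega> - \<epsilon> powr (1/\<alpha>) * L (t / \<epsilon>) \<omega>\<bar> \<le> a \<and>
      \<bar>\<epsilon> powr (1 + 1/\<alpha>) * X (t / \<epsilon>) \<omega> - (LINT s : {0..t} | lborel. \<epsilon> powr (1/\<alpha>) * L (s / \<epsilon>) \<omega>)\<bar> \<le> a"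
      if \<omega>: "\<omega> \<in> G" and t: "t \<in> {\<epsilon> * t0..b}" for \<omega> t
    proof -
      have \<omega>M: "\<omega> \<in> space M" and \<omega>E: "\<omega> \<in> E" and \<omega>B: "\<And>j. j \<le> J \<Longrightarrow> \<omega> \<in> B j"
        using \<omega> sets.sets_into_space[OF E(1)] by (auto simp: G_def)
      have v: "cadlag_on {t0..} (\<lambda>t. V t \<omega>)" and l: "cadlag_on {0..} (\<lambda>t. L t \<omega>)"
        using cV L \<omega>M by (auto simp: cadlag_process_def)
      have lT: "\<bar>L s \<omega>\<bar> \<le> c * T j powr (1/\<alpha>)" if "j \<le> J" "s \<in> {0..T j}" for j s
        using \<omega>B[OF that(1)] that(2) by (auto simp: B_def)
      have lr: "\<bar>L s \<omega>\<bar> \<le> r" if "s \<in> {0..t0}" for s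
        using lT[of 0 s] that Q by (simp add: T_def r_def)
      have vb: "\<bar>V s \<omega>\<bar> \<le> C * (1 + c) * (s * Q powr (1 / real J)) powr (1 / \<alpha>)" if "s \<in> {t0..b / \<epsilon>}" for s
      proof (rule velocity_bound_grid[OF _ _ t0 \<alpha> Q J(1) c])
        show "\<bar>V t \<omega>\<bar> \<le> C * (T powr (1 / \<alpha>) + R)" if "\<And>s. s \<in> {0..T} \<Longrightarrow> \<bar>L s \<omega>\<bar> \<le> R" "t \<in> {t0..T}" for T R t
          by (rule C(2)[OF v _ that]) (use eqs[OF \<omega>E] in auto)
        show "s \<in> {t0..t0 * Q}" using that t0Q by simp
      qed (use C(1) lT in \<open>auto simp: T_def\<close>)
      have drift: "\<bar>LINT s : {t0..u} | lborel. s powr (- \<beta>) * F (V s \<omega>)\<bar>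
          \<le> D * (C * (1 + c)) powr \<gamma> * (Q powr (1 / real J)) powr (\<gamma> / \<alpha>) * (b / \<epsilon>) powr \<kappa>" if "u \<in> {t0..b / \<epsilon>}" for u
        by (rule D(4)[OF v _ _ vb that]) (use Q C(1) c in auto)
      have scale: "k * (D * (C * (1 + c)) powr \<gamma> * (Q powr (1 / real J)) powr (\<gamma> / \<alpha>) * (b / \<epsilon>) powr \<kappa>)
          = A * \<epsilon> powr (1 / \<alpha> - \<kappa> - g)"
      proof -
        have "(Q powr (1 / real J)) powr (\<gamma> / \<alpha>) = Q powr g" by (simp add: powr_powr g_def mult.commute)
        moreover have "Q = (b / t0) / \<epsilon>" by (simp add: Q_def)
        then have "Q powr g = (b / t0) powr g / \<epsilon> powr g" using b t0 \<epsilon> by (simp only:) (subst powr_divide, auto)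
        ultimately have 1: "(Q powr (1 / real J)) powr (\<gamma> / \<alpha>) = (b / t0) powr g / \<epsilon> powr g" by simp
        have 2: "(b / \<epsilon>) powr \<kappa> = b powr \<kappa> / \<epsilon> powr \<kappa>" using b \<epsilon> by (subst powr_divide) auto
        have 3: "\<epsilon> powr (1 / \<alpha> - \<kappa> - g) = k / \<epsilon> powr \<kappa> / \<epsilon> powr g" by (simp add: powr_diff k_def)
        show ?thesis unfolding 1 2 3 A_def by (simp add: mult_ac)
      qed
      have close: "k * \<bar>V u \<omega> - L u \<omega>\<bar> \<le> \<psi> \<epsilon>" if u: "u \<in> {t0..b / \<epsilon>}" for u
      proof -
        have "\<bar>L t0 \<omega>\<bar> \<le> r" using lr[of t0] t0 by simp
        moreover have "V u \<omega> = v0 + (L u \<omega> - L t0 \<omega>) - (LINT s : {t0..u} | lborel. s powr (- \<beta>) * F (V s \<omega>))"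
          using eqs[OF \<omega>E, of u] u by simp
        ultimately have "\<bar>V u \<omega> - L u \<omega>\<bar> \<le> (\<bar>v0\<bar> + r) + (D * (C * (1 + c)) powr \<gamma> * (Q powr (1 / real J)) powr (\<gamma> / \<alpha>) * (b / \<epsilon>) powr \<kappa>)"
          using drift[OF u] by linarith
        then have "k * \<bar>V u \<omega> - L u \<omega>\<bar> \<le> k * ((\<bar>v0\<bar> + r) + (D * (C * (1 + c)) powr \<gamma> * (Q powr (1 / real J)) powr (\<gamma> / \<alpha>) * (b / \<epsilon>) powr \<kappa>))"
          using k by (intro mult_left_mono) auto
        also have "\<dots> = \<psi> \<epsilon>" by (simp only: distrib_left \<psi>_def scale[symmetric] k_def[symmetric])
        finally show ?thesis .
      qed
      have te: "t / \<epsilon> \<in> {t0..b / \<epsilon>}" using t \<epsilon> by (auto simp: field_simps)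
      have t1: "0 < t" using t \<epsilon> t0 by (auto intro: less_le_trans[of 0 "\<epsilon> * t0"])
      have \<psi>nn: "0 \<le> \<psi> \<epsilon>" using close[OF te] k by (smt (verit) abs_ge_zero mult_nonneg_nonneg)
      have "\<bar>k * V (t / \<epsilon>) \<omega> - k * L (t / \<epsilon>) \<omega>\<bar> = k * \<bar>V (t / \<epsilon>) \<omega> - L (t / \<epsilon>) \<omega>\<bar>"
        using k by (simp add: abs_mult flip: right_diff_distrib)
      then have 1: "\<bar>k * V (t / \<epsilon>) \<omega> - k * L (t / \<epsilon>) \<omega>\<bar> \<le> a" using close[OF te] elim by simp
      have ek: "\<epsilon> powr (1 + 1/\<alpha>) = \<epsilon> * k" using \<epsilon> by (simp add: powr_add k_def)
      have "\<bar>\<epsilon> * k * (x0 + (LINT s : {t0..t / \<epsilon>} | lborel. V s \<omega>)) - (LINT s : {0..t} | lborel. k * L (s / \<epsilon>) \<omega>)\<bar>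
          \<le> \<epsilon> * k * (\<bar>x0\<bar> + t0 * r) + t * \<psi> \<epsilon>"
        by (rule rescaled_position_close[OF v l t0 \<epsilon> k lr \<psi>nn close t1]) (use te in auto)
      also have "\<dots> \<le> \<phi> \<epsilon>"
        unfolding \<phi>_def ek using t \<psi>nn by (intro add_left_mono mult_right_mono) auto
      finally have 2: "\<bar>\<epsilon> powr (1 + 1/\<alpha>) * X (t / \<epsilon>) \<omega> - (LINT s : {0..t} | lborel. k * L (s / \<epsilon>) \<omega>)\<bar> \<le> a"
        using eqs[OF \<omega>E, of "t / \<epsilon>"] te elim by (simp add: ek)
      show ?thesis using 1 2 by (simp add: k_def)
    qed
    then show ?case using G pG by blast
  qed
qed

section \<open>Convergence in distribution\<close>

lemma near2_refl: "0 \<le> a \<Longrightarrow> near2 a f f"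
proof -
  assume "0 \<le> a"
  moreover have "(\<lambda>t. t) \<in> time_changes"
    by (auto simp: time_changes_def strict_mono_on_def filterlim_ident)
  ultimately show ?thesis
    unfolding near2_def skorokhod_near_def log_slope_le_def by (auto intro!: bexI[of _ "\<lambda>t. t"])
qed

text \<open>The law of \<open>Z i\<close> is fixed, so almost all of its mass sits on an open set where \<open>\<Phi>\<close> has
  small oscillation at some fixed scale: neither tightness nor uniform continuity is needed.\<close>

lemma converges_in_distribution_near:
  assumes M: "prob_space M" and M': "prob_space M'"
    and Y: "\<forall>\<^sub>F i in Q. Y i \<in> M \<rightarrow>\<^sub>M coords \<and> (\<forall>\<omega>\<in>space M. Y i \<omega> \<in> paths2)"
    and Z: "\<forall>\<^sub>F i in Q. Z i \<in> M \<rightarrow>\<^sub>M coords \<and> (\<forall>\<omega>\<in>space M. Z i \<omega> \<in> paths2) \<and> distr M coords (Z i) = distr M' coords W"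
    and W: "W \<in> M' \<rightarrow>\<^sub>M coords" "\<And>\<omega>. \<omega> \<in> space M' \<Longrightarrow> W \<omega> \<in> paths2"
    and near: "\<And>a \<eta>. 0 < a \<Longrightarrow> 0 < \<eta> \<Longrightarrow> \<forall>\<^sub>F i in Q. \<exists>G\<in>sets M. 1 - \<eta> \<le> measure M G \<and> (\<forall>\<omega>\<in>G. near2 a (Y i \<omega>) (Z i \<omega>))"
  shows "converges_in_distribution skorokhod2 M Y M' W Q"
  unfolding converges_in_distribution_def
proof (intro conjI allI impI)
  interpret M: prob_space M by fact
  interpret M': prob_space M' by fact
  show "\<forall>\<^sub>F i in Q. Y i \<in> M \<rightarrow>\<^sub>M borel_of_topology skorokhod2"
    using Y by eventually_elim (intro measurable_skorokhod2; simp)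
  have Wm: "W \<in> M' \<rightarrow>\<^sub>M borel_of_topology skorokhod2" by (rule measurable_skorokhod2[OF W])
  then show "W \<in> M' \<rightarrow>\<^sub>M borel_of_topology skorokhod2" .
  fix \<Phi> assume \<Phi>: "continuous_map skorokhod2 euclideanreal \<Phi> \<and> bounded (\<Phi> ` topspace skorokhod2)"
  then have cont: "continuous_map skorokhod2 euclideanreal \<Phi>" by simp
  have \<Phi>m: "\<Phi> \<in> borel_measurable (borel_of_topology skorokhod2)" by (rule continuous_map_measurable[OF cont])
  obtain B where B: "0 < B" "\<And>f. f \<in> paths2 \<Longrightarrow> \<bar>\<Phi> f\<bar> \<le> B"
  proof -
    have "bounded (\<Phi> ` paths2)" using \<Phi> by (simp only: topspace_skorokhod2)
    then show thesis using that by (auto simp: bounded_pos)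
  qed
  show "((\<lambda>i. \<integral>\<omega>. \<Phi> (Y i \<omega>) \<partial>M) \<longlongrightarrow> (\<integral>\<omega>. \<Phi> (W \<omega>) \<partial>M')) Q"
  proof (rule tendstoI)
    fix e :: real assume e: "0 < e"
    \<comment> \<open>Two exceptional sets of probability at most \<delta>, on which the integrands
      differ by at most 2 * B, contribute at most 4 * B * \<delta> = e / 3.\<close>
    define \<delta> where "\<delta> = e / (12 * B)"
    have \<delta>: "0 < \<delta>" using e B by (simp add: \<delta>_def)
    define A where "A j = {f \<in> paths2. \<forall>g\<in>paths2. near2 (1 / real (Suc j)) g f \<longrightarrow> \<bar>\<Phi> g - \<Phi> f\<bar> \<le> e / 3}" for j
    \<comment> \<open>\<open>A j\<close> is not known to be open, so its measurability is not at
      hand. Its interior gives measurable events, and the interiors still exhaust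
      \<open>paths2\<close> because \<Phi> is continuous at every path.\<close>
    define U where "U j = near_interior (A j)" for j
    have U: "near_open (U j)" for j unfolding U_def by (rule near_open_interior)
    have UA: "U j \<subseteq> A j" for j
      unfolding U_def near_interior_def using near2_refl by (auto intro: less_imp_le)
    have "incseq A"
    proof (rule incseq_SucI)
      fix j
      have "near2 (1 / real (Suc j)) g f" if "near2 (1 / real (Suc (Suc j))) g f" for g f
        by (rule near2_mono[OF that]) (auto simp: frac_le)
      then show "A j \<subseteq> A (Suc j)" by (auto simp: A_def simp del: of_nat_Suc)
    qed
    then have incU: "incseq U"
      unfolding U_def near_interior_def incseq_def by blast
    have covU: "f \<in> (\<Union>j. U j)" if f: "f \<in> paths2" for f
    proof -
      \<comment> \<open>If h and g are both close to f, then \<Phi> varies between them by less than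
        twice e / 6; so a whole neighbourhood of f lies in \<open>A j\<close>, which puts f into the
        interior.\<close>
      obtain a where a: "0 < a" "\<And>g. g \<in> paths2 \<Longrightarrow> near2 a g f \<Longrightarrow> \<bar>\<Phi> g - \<Phi> f\<bar> < e / 6"
        using continuous_map_near[OF cont f, of "e / 6"] e by auto
      define b where "b = min a 1"
      have b: "0 < b" "b \<le> 1" "b \<le> a" using a by (auto simp: b_def)
      obtain j where j: "1 / real (Suc j) < b / 2" using b(1) by (metis half_gt_zero_iff nat_approx_posE)
      have "h \<in> A j" if h: "h \<in> paths2" "near2 (b / 2) h f" for h
      proof -
        have "near2 a h f" using near2_mono[OF h(2)] b by simp
        then have hf: "\<bar>\<Phi> h - \<Phi> f\<bar> < e / 6" using a(2) h(1) by blast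
        have "\<bar>\<Phi> g - \<Phi> h\<bar> \<le> e / 3" if g: "g \<in> paths2" "near2 (1 / real (Suc j)) g h" for g
        proof -
          have "near2 (b / 2) g h" by (rule near2_mono[OF g(2)]) (use j in auto)
          from near2_trans[OF this h(2) b(1,2)] have "near2 a g f" using near2_mono b by blast
          then have "\<bar>\<Phi> g - \<Phi> f\<bar> < e / 6" using a(2) g(1) by blast
          then show ?thesis using hf by linarith
        qed
        then show ?thesis using h(1) by (simp add: A_def)
      qed
      then have "f \<in> U j"
        unfolding U_def near_interior_def using f b(1) by (auto intro!: exI[of _ "b / 2"])
      then show ?thesis by blast
    qed
    have UM: "{\<omega>\<in>space M'. W \<omega> \<in> U j} \<in> sets M'" for j by (rule sets_near_open[OF W U])
    have "(\<lambda>j. M'.prob {\<omega>\<in>space M'. W \<omega> \<in> U j}) \<longlonglongrightarrow> M'.prob (\<Union>j. {\<omega>\<in>space M'. W \<omega> \<in> U j})"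
    proof (rule M'.finite_Lim_measure_incseq)
      show "range (\<lambda>j. {\<omega>\<in>space M'. W \<omega> \<in> U j}) \<subseteq> sets M'" using UM by auto
      show "incseq (\<lambda>j. {\<omega>\<in>space M'. W \<omega> \<in> U j})" using incU unfolding incseq_def by blast
    qed
    also have "(\<Union>j. {\<omega>\<in>space M'. W \<omega> \<in> U j}) = space M'" using covU[OF W(2)] by blast
    finally have "(\<lambda>j. M'.prob {\<omega>\<in>space M'. W \<omega> \<in> U j}) \<longlonglongrightarrow> 1" by (simp add: M'.prob_space)
    then have "\<forall>\<^sub>F j in sequentially. 1 - \<delta> < M'.prob {\<omega>\<in>space M'. W \<omega> \<in> U j}"
      using \<delta> by (intro order_tendstoD(1)) auto
    then obtain j where j: "1 - \<delta> < M'.prob {\<omega>\<in>space M'. W \<omega> \<in> U j}" by (auto simp: eventually_sequentially)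
    have "\<forall>\<^sub>F i in Q. \<exists>G\<in>sets M. 1 - \<delta> \<le> measure M G \<and> (\<forall>\<omega>\<in>G. near2 (1 / real (Suc j)) (Y i \<omega>) (Z i \<omega>))"
      using \<delta> by (intro near) auto
    with Y Z show "\<forall>\<^sub>F i in Q. dist (\<integral>\<omega>. \<Phi> (Y i \<omega>) \<partial>M) (\<integral>\<omega>. \<Phi> (W \<omega>) \<partial>M') < e"
    proof eventually_elim
      case (elim i)
      have Yi: "Y i \<in> M \<rightarrow>\<^sub>M coords" "\<And>\<omega>. \<omega> \<in> space M \<Longrightarrow> Y i \<omega> \<in> paths2"
        and Zi: "Z i \<in> M \<rightarrow>\<^sub>M coords" "\<And>\<omega>. \<omega> \<in> space M \<Longrightarrow> Z i \<omega> \<in> paths2"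
        and law: "distr M coords (Z i) = distr M' coords W" using elim by auto
      obtain G where G: "G \<in> sets M" "1 - \<delta> \<le> M.prob G" "\<And>\<omega>. \<omega> \<in> G \<Longrightarrow> near2 (1 / real (Suc j)) (Y i \<omega>) (Z i \<omega>)"
        using elim by blast
      define H where "H = {\<omega>\<in>space M. Z i \<omega> \<in> U j}"
      have H: "H \<in> sets M" unfolding H_def by (rule sets_near_open[OF Zi U])
      \<comment> \<open>j was fixed from the law of W alone; equality of laws carries the estimate
        to \<open>Z i\<close>, with the same scale for all i.\<close>
      have pH: "1 - \<delta> < M.prob H"
        using j emeasure_near_open_cong[OF Zi W law U[of j]] by (simp add: H_def measure_def)
      have Ym: "(\<lambda>\<omega>. \<Phi> (Y i \<omega>)) \<in> borel_measurable M"
        by (rule measurable_compose[OF measurable_skorokhod2[OF Yi] \<Phi>m])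
      have Zm': "Z i \<in> M \<rightarrow>\<^sub>M borel_of_topology skorokhod2" by (rule measurable_skorokhod2[OF Zi])
      have Zm: "(\<lambda>\<omega>. \<Phi> (Z i \<omega>)) \<in> borel_measurable M"
        by (rule measurable_compose[OF Zm' \<Phi>m])
      have iY: "integrable M (\<lambda>\<omega>. \<Phi> (Y i \<omega>))"
        by (rule M.integrable_const_bound[of _ B, OF _ Ym]) (use B(2)[OF Yi(2)] in auto)
      have iZ: "integrable M (\<lambda>\<omega>. \<Phi> (Z i \<omega>))"
        by (rule M.integrable_const_bound[of _ B, OF _ Zm]) (use B(2)[OF Zi(2)] in auto)
      have "(\<integral>\<omega>. \<Phi> (W \<omega>) \<partial>M') = (\<integral>f. \<Phi> f \<partial>distr M' (borel_of_topology skorokhod2) W)"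
        by (rule integral_distr[OF Wm \<Phi>m, symmetric])
      also have "\<dots> = (\<integral>f. \<Phi> f \<partial>distr M (borel_of_topology skorokhod2) (Z i))"
        using distr_skorokhod2_eq[OF M.finite_measure_axioms Zi W law] by simp
      also have "\<dots> = (\<integral>\<omega>. \<Phi> (Z i \<omega>) \<partial>M)" by (rule integral_distr[OF Zm' \<Phi>m])
      finally have EW: "(\<integral>\<omega>. \<Phi> (W \<omega>) \<partial>M') = (\<integral>\<omega>. \<Phi> (Z i \<omega>) \<partial>M)" .
      define N where "N = (space M - G) \<union> (space M - H)"
      have N: "N \<in> sets M" using G H by (auto simp: N_def)
      have "M.prob N \<le> M.prob (space M - G) + M.prob (space M - H)"
        unfolding N_def using G H by (intro measure_Un_le) auto
      then have pN: "M.prob N \<le> 2 * \<delta>" using G H pH by (simp add: M.prob_compl)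
      have iN: "integrable M (indicator N :: _ \<Rightarrow> real)" using N by (simp add: M.emeasure_eq_measure)
      have "\<bar>(\<integral>\<omega>. \<Phi> (Y i \<omega>) \<partial>M) - (\<integral>\<omega>. \<Phi> (Z i \<omega>) \<partial>M)\<bar> = \<bar>\<integral>\<omega>. \<Phi> (Y i \<omega>) - \<Phi> (Z i \<omega>) \<partial>M\<bar>"
        using iY iZ by simp
      also have "\<dots> \<le> (\<integral>\<omega>. \<bar>\<Phi> (Y i \<omega>) - \<Phi> (Z i \<omega>)\<bar> \<partial>M)" by (rule integral_abs_bound)
      also have "\<dots> \<le> (\<integral>\<omega>. e / 3 + 2 * B * indicator N \<omega> \<partial>M)"
      proof (rule integral_mono)
        show "integrable M (\<lambda>\<omega>. \<bar>\<Phi> (Y i \<omega>) - \<Phi> (Z i \<omega>)\<bar>)" using iY iZ by simp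
        show "integrable M (\<lambda>\<omega>. e / 3 + 2 * B * indicator N \<omega>)" using iN by simp
        fix \<omega> assume \<omega>: "\<omega> \<in> space M"
        show "\<bar>\<Phi> (Y i \<omega>) - \<Phi> (Z i \<omega>)\<bar> \<le> e / 3 + 2 * B * indicator N \<omega>"
        proof (cases "\<omega> \<in> N")
          case True
          then show ?thesis using B(2)[OF Yi(2)[OF \<omega>]] B(2)[OF Zi(2)[OF \<omega>]] e by auto
        next
          case False
          then have "\<omega> \<in> G" "Z i \<omega> \<in> A j" using \<omega> UA by (auto simp: N_def H_def)
          then have "\<bar>\<Phi> (Y i \<omega>) - \<Phi> (Z i \<omega>)\<bar> \<le> e / 3"
            using G(3) Yi(2)[OF \<omega>] by (auto simp: A_def)
          then show ?thesis using False by simp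
        qed
      qed
      also have "\<dots> = e / 3 + 2 * B * M.prob N" using iN N by (simp add: M.prob_space)
      also have "\<dots> \<le> e / 3 + 2 * B * (2 * \<delta>)" using pN B by (intro add_left_mono mult_left_mono) auto
      also have "\<dots> = e / 3 + e / 3" using B by (simp add: \<delta>_def)
      also have "\<dots> < e" using e by simp
      finally show ?case by (simp add: dist_real_def EW)
    qed
  qed
qed

lemma extended_path_measurable:
  assumes "\<And>t. a \<le> t \<Longrightarrow> (\<lambda>\<omega>. f t \<omega>) \<in> borel_measurable M"
  shows "(\<lambda>\<omega>. extended_path a (\<lambda>t. f t \<omega>)) \<in> M \<rightarrow>\<^sub>M Pi\<^sub>M {0<..} (\<lambda>_. borel)"
  unfolding extended_path_def by (intro measurable_restrict assms) auto

text \<open>Uniform closeness on the window is closeness with the identity as time change. As c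
  \<le> a, the constant extension below c is not seen by the window.\<close>

lemma near2_uniform:
  assumes a: "0 < a" and c: "c \<le> a"
    and f: "\<And>t. t \<in> {a..1 / a} \<Longrightarrow> \<bar>f t - fst h t\<bar> \<le> a" and g: "\<And>t. t \<in> {a..1 / a} \<Longrightarrow> \<bar>g t - snd h t\<bar> \<le> a"
  shows "near2 a (extended_path c f, extended_path c g) h"
proof -
  have "(\<lambda>t. t) \<in> time_changes"
    by (auto simp: time_changes_def strict_mono_on_def filterlim_ident)
  moreover have "extended_path c k t = k t" if "t \<in> {a..1 / a}" for k t
    using that a c by (simp add: extended_path_def max_def)
  ultimately show ?thesis
    unfolding near2_def skorokhod_near_def log_slope_le_def
    using a f g by (auto intro!: bexI[of _ "\<lambda>t. t"])
qed

theorem theorem2p2: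
  fixes \<alpha> \<beta> \<gamma> ap am t0 v0 x0 :: real
    and F :: "real \<Rightarrow> real"
    and M :: "'a measure" and \<F> :: "real \<Rightarrow> 'a measure"
    and N :: "'a \<Rightarrow> (real \<times> real) measure"
    and L V X :: "real \<Rightarrow> 'a \<Rightarrow> real"
    and M' :: "'b measure" and S :: "real \<Rightarrow> 'b \<Rightarrow> real"
  assumes "0 < \<alpha>" "\<alpha> < 2"
    and "1 - \<alpha> / 2 < \<gamma>" "\<gamma> < \<alpha>"
    and "0 \<le> \<beta>" "1 + (\<gamma> - 1) / \<alpha> < \<beta>"
    and "continuous_on UNIV F"
    and "\<And>v l. 0 < l \<Longrightarrow> F (l * v) = l powr \<gamma> * F v"
    and "\<alpha> \<le> 1 \<or> 1 < \<alpha> \<and> 1 \<le> \<gamma> \<Longrightarrow> \<forall>v. 0 \<le> v * F v"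
    and "0 \<le> ap" "0 \<le> am" "\<alpha> = 1 \<Longrightarrow> ap = am"
    and "prob_space M"
    and "stable_levy_process M \<alpha> ap am N L"
    and "filtration_for_jumps M \<F> N"
    and "0 < t0" "0 < v0"
    and "kinetic_solution M \<F> L \<beta> F t0 v0 x0 V X"
    and "prob_space M'"
    and "cadlag_process M' {0..} S"
    and "same_law M L M' S"
  shows "converges_in_distribution (prod_topology skorokhod_topology skorokhod_topology)
           M (\<lambda>\<epsilon> \<omega>. (extended_path (\<epsilon> * t0) (\<lambda>t. \<epsilon> powr (1 / \<alpha>) * V (t / \<epsilon>) \<omega>),
                      extended_path (\<epsilon> * t0) (\<lambda>t. \<epsilon> powr (1 + 1 / \<alpha>) * X (t / \<epsilon>) \<omega>)))
           M' (\<lambda>\<omega>. (\<lambda>t\<in>{0<..}. S t \<omega>, \<lambda>t\<in>{0<..}. LINT s : {0..t} | lborel. S s \<omega>))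
           (at_right 0)"
proof -
  note M = \<open>prob_space M\<close> and M' = \<open>prob_space M'\<close> and \<alpha> = \<open>0 < \<alpha>\<close> and t0 = \<open>0 < t0\<close>
  have L: "cadlag_process M {0..} L"
    using \<open>stable_levy_process M \<alpha> ap am N L\<close> unfolding stable_levy_process_def Let_def by blast
  have V: "cadlag_process M {t0..} V" and X: "cadlag_process M {t0..} X"
    using \<open>kinetic_solution M \<F> L \<beta> F t0 v0 x0 V X\<close> unfolding kinetic_solution_def by blast+
  have ss: "same_law M (\<lambda>t \<omega>. \<epsilon> powr (1/\<alpha>) * L (t / \<epsilon>) \<omega>) M L" if "0 < \<epsilon>" for \<epsilon>
    by (rule stable_levy_self_similar[OF M \<open>stable_levy_process M \<alpha> ap am N L\<close> assms(10-12) \<alpha> that])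
  have \<gamma>: "0 < \<gamma>" using assms(2,3) by simp
  \<comment> \<open>When \<gamma> \<ge> 1 both ranges of \<alpha> fall under the sign condition, so
    the force is either restoring or sublinear.\<close>
  have cases: "(\<forall>v. 0 \<le> v * F v) \<or> \<gamma> < 1"
  proof (cases "\<gamma> < 1")
    case False
    then have "\<alpha> \<le> 1 \<or> 1 < \<alpha> \<and> 1 \<le> \<gamma>" by linarith
    then show ?thesis using assms(9) by blast
  qed simp
  define Y where "Y \<epsilon> \<omega> = (extended_path (\<epsilon> * t0) (\<lambda>t. \<epsilon> powr (1 / \<alpha>) * V (t / \<epsilon>) \<omega>),
      extended_path (\<epsilon> * t0) (\<lambda>t. \<epsilon> powr (1 + 1 / \<alpha>) * X (t / \<epsilon>) \<omega>))" for \<epsilon> \<omega>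
  \<comment> \<open>The comparison process lives on M together with Y, and as a pair of paths it has
    the law of the limit for every \<epsilon> > 0.\<close>
  define Z where "Z \<epsilon> \<omega> = path_pair (\<lambda>t. \<epsilon> powr (1 / \<alpha>) * L (t / \<epsilon>) \<omega>)" for \<epsilon> \<omega>
  have "converges_in_distribution skorokhod2 M Y M' (\<lambda>\<omega>. path_pair (\<lambda>t. S t \<omega>)) (at_right 0)"
  proof (rule converges_in_distribution_near[OF M M'])
    show "\<forall>\<^sub>F \<epsilon> in at_right 0. Y \<epsilon> \<in> M \<rightarrow>\<^sub>M coords \<and> (\<forall>\<omega>\<in>space M. Y \<epsilon> \<omega> \<in> paths2)"
      using eventually_at_right_less[of "0::real"]
    proof eventually_elim
      case (elim \<epsilon>)
      have meas: "(\<lambda>\<omega>. extended_path (\<epsilon> * t0) (\<lambda>t. k * U (t / \<epsilon>) \<omega>)) \<in> M \<rightarrow>\<^sub>M Pi\<^sub>M {0<..} (\<lambda>_. borel)"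
        if U: "cadlag_process M {t0..} U" for U :: "real \<Rightarrow> 'a \<Rightarrow> real" and k
      proof (rule extended_path_measurable)
        fix t assume "\<epsilon> * t0 \<le> t"
        then have "t0 \<le> t / \<epsilon>" using elim by (simp add: field_simps)
        then have "U (t / \<epsilon>) \<in> borel_measurable M" using U by (simp add: cadlag_process_def)
        then show "(\<lambda>\<omega>. k * U (t / \<epsilon>) \<omega>) \<in> borel_measurable M" by (intro borel_measurable_times) auto
      qed
      have path: "extended_path (\<epsilon> * t0) (\<lambda>t. k * U (t / \<epsilon>) \<omega>) \<in> cadlag_space"
        if "cadlag_process M {t0..} U" "\<omega> \<in> space M" for U :: "real \<Rightarrow> 'a \<Rightarrow> real" and k \<omega>
        using that elim by (intro extended_path_cadlag cadlag_on_rescale) (auto simp: cadlag_process_def)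
      show ?case
        unfolding Y_def paths2_def
        by (intro conjI ballI SigmaI measurable_Pair meas[OF V] meas[OF X] path[OF V] path[OF X])
    qed
    show "\<forall>\<^sub>F \<epsilon> in at_right 0. Z \<epsilon> \<in> M \<rightarrow>\<^sub>M coords \<and> (\<forall>\<omega>\<in>space M. Z \<epsilon> \<omega> \<in> paths2) \<and>
        distr M coords (Z \<epsilon>) = distr M' coords (\<lambda>\<omega>. path_pair (\<lambda>t. S t \<omega>))"
      using eventually_at_right_less[of "0::real"]
    proof eventually_elim
      case (elim \<epsilon>)
      have cZ: "cadlag_process M {0..} (\<lambda>t \<omega>. \<epsilon> powr (1/\<alpha>) * L (t / \<epsilon>) \<omega>)"
        by (rule cadlag_process_rescale[OF L elim])
      have law: "same_law M (\<lambda>t \<omega>. \<epsilon> powr (1/\<alpha>) * L (t / \<epsilon>) \<omega>) M' S"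
        using ss[OF elim] \<open>same_law M L M' S\<close> by (simp add: same_law_def)
      have "path_pair (\<lambda>t. \<epsilon> powr (1/\<alpha>) * L (t / \<epsilon>) \<omega>) \<in> paths2" if "\<omega> \<in> space M" for \<omega>
        by (rule path_pair_paths2[OF bspec[OF conjunct2[OF cZ[unfolded cadlag_process_def]] that]])
      then show ?case
        unfolding Z_def using path_pair_measurable[OF cZ] path_pair_law[OF cZ assms(20) law] by blast
    qed
    show "(\<lambda>\<omega>. path_pair (\<lambda>t. S t \<omega>)) \<in> M' \<rightarrow>\<^sub>M coords"
      by (rule path_pair_measurable[OF \<open>cadlag_process M' {0..} S\<close>])
    show "path_pair (\<lambda>t. S t \<omega>) \<in> paths2" if "\<omega> \<in> space M'" for \<omega>
      by (rule path_pair_paths2[OF bspec[OF conjunct2[OF assms(20)[unfolded cadlag_process_def]] that]])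
    \<comment> \<open>Closeness at scale a concerns the window \<open>{a..1 / a}\<close> alone: its
      right end gives the horizon 1 / a for the drift estimate, its left end is beyond \<epsilon> *
      t0 for small \<epsilon>.\<close>
    fix a \<eta> :: real assume a: "0 < a" and \<eta>: "0 < \<eta>"
    have "\<forall>\<^sub>F \<epsilon> in at_right 0. \<exists>G\<in>sets M. 1 - \<eta> \<le> measure M G \<and> (\<forall>\<omega>\<in>G.
      \<forall>t\<in>{\<epsilon> * t0..1 / a}. \<bar>\<epsilon> powr (1/\<alpha>) * V (t / \<epsilon>) \<omega> - \<epsilon> powr (1/\<alpha>) * L (t / \<epsilon>) \<omega>\<bar> \<le> a \<and>
      \<bar>\<epsilon> powr (1 + 1/\<alpha>) * X (t / \<epsilon>) \<omega> - (LINT s : {0..t} | lborel. \<epsilon> powr (1/\<alpha>) * L (s / \<epsilon>) \<omega>)\<bar> \<le> a)"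
      by (rule drift_negligible[OF \<alpha> \<gamma> assms(6-8) cases M L t0 ss assms(18) a \<eta>]) (use a in simp_all)
    moreover have "\<forall>\<^sub>F \<epsilon> in at_right 0. \<epsilon> \<in> {0<..<a / t0}"
      using a t0 by (intro eventually_at_right_real) auto
    ultimately show "\<forall>\<^sub>F \<epsilon> in at_right 0. \<exists>G\<in>sets M. 1 - \<eta> \<le> measure M G \<and> (\<forall>\<omega>\<in>G. near2 a (Y \<epsilon> \<omega>) (Z \<epsilon> \<omega>))"
    proof eventually_elim
      case (elim \<epsilon>)
      have \<epsilon>a: "\<epsilon> * t0 \<le> a" using elim(2) t0 by (simp add: field_simps)
      from elim(1) obtain G where G: "G \<in> sets M" "1 - \<eta> \<le> measure M G"
        "\<And>\<omega> t. \<omega> \<in> G \<Longrightarrow> t \<in> {\<epsilon> * t0..1 / a} \<Longrightarrow>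
          \<bar>\<epsilon> powr (1/\<alpha>) * V (t / \<epsilon>) \<omega> - \<epsilon> powr (1/\<alpha>) * L (t / \<epsilon>) \<omega>\<bar> \<le> a \<and>
          \<bar>\<epsilon> powr (1 + 1/\<alpha>) * X (t / \<epsilon>) \<omega> - (LINT s : {0..t} | lborel. \<epsilon> powr (1/\<alpha>) * L (s / \<epsilon>) \<omega>)\<bar> \<le> a"
        by blast
      have "near2 a (Y \<epsilon> \<omega>) (Z \<epsilon> \<omega>)" if \<omega>: "\<omega> \<in> G" for \<omega>
        unfolding Y_def Z_def
        by (rule near2_uniform[OF a \<epsilon>a])
          (use G(3)[OF \<omega>] \<epsilon>a a in \<open>simp_all add: path_pair_def\<close>)
      then show ?case using G(1,2) by blast
    qed
  qed
  then show ?thesis unfolding Y_def path_pair_def .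
qed

end
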